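(* Let $n\ge 0$, let $s_0,\dots,s_{2n}\in\mathbb R$, and suppose that the Hankel matrix $S_n=(s_{i+j})_{i,j=0}^n$ is degenerate ($\det S_n=0$). Let $n_1<n_2<\dots<n_N$ be the sequence of all normal indices of $S_n$, and let $\kappa=\nu_-(S_n)$. Then the following statements are equivalent: (i) the moment problem $MP_\kappa({\bf s},2n)$ is solvable; (ii) $\operatorname{rank} S_n=n_N$; (iii) $S_n$ admits a Hankel extension $S_{n+1}=(s_{i+j})_{i,j=0}^{n+1}$ (with some $s_{2n+1},s_{2n+2}\in\mathbb R$) such that $\nu_-(S_{n+1})=\nu_-(S_n)$; (iv) the sequence ${\bf s}=\{s_j\}_{j=0}^{2n}$ is recursively generated. If any of (i)--(iv) is satisfied, then the problem $MP_\kappa({\bf s},2n)$ has a unique solution, namely $$\varphi(\lambda)=-\frac{Q_{n_N}(\lambda)}{P_{n_N}(\lambda)}.$$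
   Context: $\nu_-(A)$ is the number of negative eigenvalues (with multiplicities) of a Hermitian matrix $A$. Normal indices. An integer $j$ with $1\le j\le n+1$ is a normal index of $S_n$ if $\det S_{j-1}\ne0$, where $S_k=(s_{i+j})_{i,j=0}^k$. If there are no normal indices, put $n_N:=0$. Recursively generated. The Hankel rank $r$ of $({\bf s},2n)$ is $n+1$ if $\det S_n\neq0$; otherwise it is the smallest integer $r$, $0\le r\le n$, such that $(s_r,\dots,s_{r+n})^\top\in\operatorname{span}\{(s_i,\dots,s_{i+n})^\top: 0\le i\le r-1\}$ (the span of the empty set is $\{0\}$). The sequence is recursively generated if there are numbers $\alpha_0,\dots,\alpha_{r-1}$ with $s_j=\alpha_0s_{j-r}+\dots+\alpha_{r-1}s_{j-1}$ for $r\le j\le 2n$. Polynomials. $P_{n_N}$ is the polynomial of the first kind of degree $n_N$ associated with ${\bf s}$: up to a nonzero constant factor, $$P_{n_N}(\lambda)=\det\begin{pmatrix}s_0&s_1&\dots&s_{n_N}\\ \vdots&&&\vdots\\ s_{n_N-1}&s_{n_N}&\dots&s_{2n_N-1}\\1&\lambda&\dots&\lambda^{n_N}\end{pmatrix},$$ ($P_0=1$) and $Q_{n_N}$ is the corresponding polynomial of the second kind $Q_{n_N}(\lambda)=\mathfrak S\left(\frac{P_{n_N}(t)-P_{n_N}(\lambda)}{t-\lambda}\right)$, where $\mathfrak S$ is the linear functional with $\mathfrak S(t^j)=s_j$ acting in the variable $t$. (The quotient $Q_{n_N}/P_{n_N}$ does not depend on the constant factor.) Function classes. $\mathbf N_\kappa$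 ($\kappa\ge0$ integer) is the class of functions $\varphi$ meromorphic on the open upper half-plane $\mathbb C_+$ (extended to $\mathbb C_-$ by $\varphi(\bar\lambda)=\overline{\varphi(\lambda)}$) whose kernel $\frac{\varphi(\lambda)-\overline{\varphi(\omega)}}{\lambda-\bar\omega}$ has $\kappa$ negative squares on $\mathbb C_+$: for all $m$ and all points $\lambda_1,\dots,\lambda_m\in\mathbb C_+$ of holomorphy the Hermitian matrix $\left(\frac{\varphi(\lambda_i)-\overline{\varphi(\lambda_k)}}{\lambda_i-\bar\lambda_k}\right)_{i,k=1}^m$ has at most $\kappa$, and for some choice exactly $\kappa$, negative eigenvalues. $\lambda\hat\to\infty$ means that $\lambda\to\infty$ nontangentially ($\delta<\arg\lambda<\pi-\delta$, $\delta>0$). $\mathbf N_{\kappa,0}$ is the set of $\varphi\in\mathbf N_\kappa$ with $\lim_{z\hat\to\infty}\varphi(z)/z=0$ and $\limsup_{z\hat\to\infty}|z\,\mathrm{Im}\,\varphi(z)|<\infty$. For $k\ge1$, $\mathbf N_{\kappa,-2k}$ is the set of $\varphi\in\mathbf N_\kappa$ for which there are real $\gamma,c_0,\dots,c_{2k-1}$ such that $z^{2k}\left(\varphi(z)-\gamma+\sum_{j=1}^{2k}c_{j-1}z^{-j}\right)=O(1/z)$ as $z\hat\to\infty$. The moment problem $MP_\kappa({\bf s},2n)$: find $\varphi\in\mathbf N_{\kappa,-2n}$ such that $\varphi(\lambda)=-\frac{s_0}{\lambda}-\dots-\frac{s_{2n}}{\lambda^{2n+1}}+o\left(\frac1{\lambda^{2n+1}}\right)$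 as $\lambda\hat\to\infty$. *)

theory Defs
  imports
    "HOL-Complex_Analysis.Complex_Analysis"
    "HOL-Library.Landau_Symbols"
    "Jordan_Normal_Form.Char_Poly"
    "Jordan_Normal_Form.DL_Rank"
begin

section \<open>Hankel matrices\<close>

text \<open>A finite sequence \<open>s\<^sub>0, \<dots>, s\<^sub>2\<^sub>n\<close> is given as a function on the naturals;
  its values beyond \<open>2n\<close> are never used.\<close>

definition hankel :: "(nat \<Rightarrow> real) \<Rightarrow> nat \<Rightarrow> real mat" where
  "hankel s k = Matrix.mat (k + 1) (k + 1) (\<lambda>(i, j). s (i + j))"

text \<open>Number of negative eigenvalues of a Hermitian matrix, counted with multiplicity. For
  such matrices the algebraic multiplicity used here is also the geometric one.\<close>

definition neg_eigenvalues :: "'a :: real_field mat \<Rightarrow> nat" where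
  "neg_eigenvalues A =
     (\<Sum>x | x < 0 \<and> eigenvalue A (of_real x). Polynomial.order (of_real x) (char_poly A))"

definition normal_indices :: "(nat \<Rightarrow> real) \<Rightarrow> nat \<Rightarrow> nat set" where
  "normal_indices s n = {j. 1 \<le> j \<and> j \<le> n + 1 \<and> Determinant.det (hankel s (j - 1)) \<noteq> 0}"

definition last_normal_index :: "(nat \<Rightarrow> real) \<Rightarrow> nat \<Rightarrow> nat" where
  "last_normal_index s n = (if normal_indices s n = {} then 0 else Max (normal_indices s n))"

text \<open>The vector \<open>(s\<^sub>i, \<dots>, s\<^sub>i\<^sub>+\<^sub>n)\<close> is column \<open>i\<close> of the Hankel matrix.\<close>

definition hankel_rank :: "(nat \<Rightarrow> real) \<Rightarrow> nat \<Rightarrow> nat" where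
  "hankel_rank s n =
     (if Determinant.det (hankel s n) \<noteq> 0 then n + 1
      else (LEAST r. r \<le> n \<and> col (hankel s n) r \<in>
              LinearCombinations.module.span class_ring (module_vec TYPE(real) (n + 1))
                (col (hankel s n) ` {..<r})))"

definition recursively_generated :: "(nat \<Rightarrow> real) \<Rightarrow> nat \<Rightarrow> bool" where
  "recursively_generated s n \<longleftrightarrow>
     (let r = hankel_rank s n in
        \<exists>\<alpha> :: nat \<Rightarrow> real. \<forall>j. r \<le> j \<and> j \<le> 2 * n \<longrightarrow> s j = (\<Sum>i<r. \<alpha> i * s (j - r + i)))"

section \<open>Polynomials of the first and second kind\<close>

definition poly_first_kind :: "(nat \<Rightarrow> real) \<Rightarrow> nat \<Rightarrow> complex poly" where
  "poly_first_kind s m =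
     Determinant.det (Matrix.mat (m + 1) (m + 1)
       (\<lambda>(i, j). if i < m then [:complex_of_real (s (i + j)):] else monom 1 j))"

definition moment_functional :: "(nat \<Rightarrow> real) \<Rightarrow> complex poly \<Rightarrow> complex" where
  "moment_functional s p = (\<Sum>j\<le>degree p. coeff p j * complex_of_real (s j))"

text \<open>For fixed \<open>z\<close>, the difference quotient \<open>(P(t) - P(z)) / (t - z)\<close> is the (exact) quotient
  of two polynomials in \<open>t\<close>.\<close>

definition second_kind :: "(nat \<Rightarrow> real) \<Rightarrow> nat \<Rightarrow> complex \<Rightarrow> complex" where
  "second_kind s m z =
     (let P = poly_first_kind s m in
        moment_functional s ((P - [:poly P z:]) div [:- z, 1:]))"

section \<open>Generalized Nevanlinna functions\<close>

definition kernel_matrix :: "(complex \<Rightarrow> complex) \<Rightarrow> nat \<Rightarrow> (nat \<Rightarrow> complex) \<Rightarrow> complex mat" where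
  "kernel_matrix \<phi> m w =
     Matrix.mat m m (\<lambda>(i, k). (\<phi> (w i) - cnj (\<phi> (w k))) / (w i - cnj (w k)))"

definition holomorphy_points :: "(complex \<Rightarrow> complex) \<Rightarrow> nat \<Rightarrow> (nat \<Rightarrow> complex) \<Rightarrow> bool" where
  "holomorphy_points \<phi> m w \<longleftrightarrow> (\<forall>i<m. Im (w i) > 0 \<and> \<phi> analytic_on {w i})"

text \<open>Meromorphic functions are represented by their normalized representatives
  (\<^const>\<open>nicely_meromorphic_on\<close>: removable singularities are removed and the value at a pole
  is \<open>0\<close>), so that equality of meromorphic functions is pointwise equality. The values of
  \<open>\<phi>\<close> on the real axis are irrelevant.\<close>

definition gen_nevanlinna :: "nat \<Rightarrow> (complex \<Rightarrow> complex) set" where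
  "gen_nevanlinna \<kappa> = {\<phi>.
     \<phi> nicely_meromorphic_on {z. Im z > 0} \<and>
     (\<forall>z. Im z > 0 \<longrightarrow> \<phi> (cnj z) = cnj (\<phi> z)) \<and>
     (\<forall>m w. holomorphy_points \<phi> m w \<longrightarrow> neg_eigenvalues (kernel_matrix \<phi> m w) \<le> \<kappa>) \<and>
     (\<exists>m w. holomorphy_points \<phi> m w \<and> neg_eigenvalues (kernel_matrix \<phi> m w) = \<kappa>)}"

text \<open>A nontangential limit at infinity is a limit along this filter for every \<open>\<delta> > 0\<close>
  (for \<open>\<delta> \<ge> \<pi>/2\<close> the filter is trivial).\<close>

definition nontangential :: "real \<Rightarrow> complex filter" where
  "nontangential \<delta> = inf at_infinity (principal {z. \<delta> < Arg z \<and> Arg z < pi - \<delta>})"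

text \<open>\<open>gen_nevanlinna_asymp \<kappa> k\<close> is the class \<open>N\<close> with index \<open>\<kappa>, -2k\<close>.\<close>

definition gen_nevanlinna_asymp :: "nat \<Rightarrow> nat \<Rightarrow> (complex \<Rightarrow> complex) set" where
  "gen_nevanlinna_asymp \<kappa> k =
     (if k = 0 then
        {\<phi> \<in> gen_nevanlinna \<kappa>. \<forall>\<delta>>0.
           ((\<lambda>z. \<phi> z / z) \<longlongrightarrow> 0) (nontangential \<delta>) \<and>
           Limsup (nontangential \<delta>) (\<lambda>z. ereal (cmod (z * complex_of_real (Im (\<phi> z))))) < \<infinity>}
      else
        {\<phi> \<in> gen_nevanlinna \<kappa>. \<exists>(\<gamma>::real) (c::nat \<Rightarrow> real). \<forall>\<delta>>0.
           (\<lambda>z. z ^ (2 * k) * (\<phi> z - complex_of_real \<gamma>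
              + (\<Sum>j = 1..2 * k. complex_of_real (c (j - 1)) / z ^ j)))
             \<in> O[nontangential \<delta>](\<lambda>z. 1 / z)})"

definition MP_solution :: "nat \<Rightarrow> (nat \<Rightarrow> real) \<Rightarrow> nat \<Rightarrow> (complex \<Rightarrow> complex) \<Rightarrow> bool" where
  "MP_solution \<kappa> s n \<phi> \<longleftrightarrow>
     \<phi> \<in> gen_nevanlinna_asymp \<kappa> n \<and>
     (\<forall>\<delta>>0. (\<lambda>z. \<phi> z - (\<Sum>j\<le>2 * n. - complex_of_real (s j) / z ^ (j + 1)))
        \<in> o[nontangential \<delta>](\<lambda>z. 1 / z ^ (2 * n + 1)))"

end

theory Submission
  imports Defs
begin

text \<open>
  A solution \<open>\<phi>\<close> of the moment problem makes the Gram matrix of \<open>1, t, \<dots>, t\<^sup>n\<close> and one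
  resolvent \<open>1 / (t - \<omega>)\<close> a limit of congruence transforms of kernel matrices of \<open>\<phi>\<close> at points going to
  infinity. This limit is \<open>S\<^sub>n\<close> bordered by one row and column, and it still has at most
  \<open>\<kappa> = \<nu>\<^sub>-(S\<^sub>n)\<close> negative eigenvalues. But a bordering that does not increase \<open>\<nu>\<^sub>-\<close> must annihilate
  the kernel of \<open>S\<^sub>n\<close>, for an isotropic vector of \<open>S\<^sub>n\<close> that pairs nontrivially with the new vector
  spans a hyperbolic plane. Applied to a kernel vector \<open>u\<close> this reads \<open>\<phi> U + V = 0\<close>, where \<open>U\<close> is the
  polynomial with coefficients \<open>u\<close> and \<open>V\<close> the associated polynomial of the second kind; so \<open>\<phi>\<close> is
  determined, and comparing expansions at infinity gives the recursion for \<open>s\<close>. The same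
  principle applied to \<open>S\<^sub>n\<^sub>+\<^sub>1\<close> handles Hankel extensions.

  Conversely, a recursion with characteristic polynomial \<open>U\<close> of degree \<open>r\<close> and \<open>det S\<^sub>r\<^sub>-\<^sub>1 \<noteq> 0\<close> makes the
  kernel of \<open>-V / U\<close> equal to \<open>\<Sum> p\<^sub>i(\<lambda>) s\<^sub>i\<^sub>+\<^sub>j p\<^sub>j(\<mu>)\<close> with \<open>\<mu>\<close> the conjugate of \<open>\<omega>\<close> and
  \<open>p\<^sub>i(\<lambda>) = d\<^sub>i(\<lambda>) / U(\<lambda>)\<close>, where the \<open>d\<^sub>i(\<lambda>)\<close> are the coefficients of \<open>(U(t) - U(\<lambda>)) / (t - \<lambda>)\<close> in \<open>t\<close>.
  This bounds its number of negative squares by \<open>\<nu>\<^sub>-(S\<^sub>r\<^sub>-\<^sub>1) = \<nu>\<^sub>-(S\<^sub>n)\<close>, and the limit argument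
  above shows that the bound is attained.
\<close>

section \<open>Negative eigenvalues of Hermitian matrices\<close>

text \<open>Kernel matrices at far points tend to 0, so moments become visible only after
  amplification. In each variable the values at n + 1 points \<open>y * node k\<close> are combined
  with Vandermonde weights of size y^(a+1) and y^(b+1), which isolates s (a + b). The amplification
  reaches y^(2n+2), while \<phi> is known only up to o(y^(-2n-1)). The missing power comes from the
  denominator z - w of the kernel: the points lie on one ray and their conjugates on the opposite
  one, so z - w is of exact order y. Expanding in one variable before the other keeps all tails
  within index 2n + 1, where the asymptotics end. Negative squares are always handled through Gram
  matrices \<open>hform A (C p) (C q)\<close> of arbitrary vectors, so congruences may be
  rectangular or singular. Three facts carry the counting: a negative definite family has at most as
  many members as there are negative eigenvalues, a family of that size exists, and negative
  definiteness survives small perturbations.\<close>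

definition adj :: "complex mat \<Rightarrow> complex mat" where
  "adj A = Matrix.mat (dim_col A) (dim_row A) (\<lambda>(i, j). cnj (A $$ (j, i)))"

lemma adj_carrier [simp]: "A \<in> carrier_mat n m \<Longrightarrow> adj A \<in> carrier_mat m n"
  by (auto simp: adj_def)

lemma adj_index: "i < dim_col A \<Longrightarrow> j < dim_row A \<Longrightarrow> adj A $$ (i, j) = cnj (A $$ (j, i))"
  by (simp add: adj_def)

lemma adj_mult:
  assumes "A \<in> carrier_mat n m" "B \<in> carrier_mat m k"
  shows "adj (A * B) = adj B * adj A"
  using assms by (intro eq_matI) (auto simp: adj_def scalar_prod_def mult.commute)

text \<open>The reflection along \<open>c v - e\<^sub>0\<close>, where the phase of \<open>c\<close> is chosen such that \<open>c v\<^sub>0 \<le> 0\<close>; this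
  keeps the reflection vector away from \<open>0\<close>.\<close>

lemma householder:
  fixes v :: "nat \<Rightarrow> complex"
  assumes n: "0 < n" and v0: "\<exists>i<n. v i \<noteq> 0"
  obtains U c where "U \<in> carrier_mat n n" "adj U = U" "U * U = 1\<^sub>m n" "c \<noteq> 0"
    "\<And>i. i < n \<Longrightarrow> U $$ (i, 0) = c * v i"
proof -
  define N where "N = (\<Sum>i<n. (cmod (v i))^2)"
  have Npos: "N > 0"
  proof -
    obtain i where i: "i < n" "v i \<noteq> 0" using v0 by auto
    have "0 < (cmod (v i))^2" using i by simp
    also have "\<dots> \<le> N" unfolding N_def by (rule member_le_sum) (use i in auto)
    finally show ?thesis .
  qed
  define ph where "ph = (if v 0 = 0 then 1 else - cnj (v 0) / cmod (v 0))"
  have ph: "cmod ph = 1" by (auto simp: ph_def norm_divide)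
  have phv: "ph * v 0 = - of_real (cmod (v 0))"
    by (auto simp: ph_def complex_norm_square[symmetric] power2_eq_square mult.commute)
  define c where "c = ph / sqrt N"
  have c0: "c \<noteq> 0" using ph Npos by (auto simp: c_def)
  define t where "t = - cmod (v 0) / sqrt N"
  have t: "c * v 0 = of_real t" using phv by (simp add: c_def t_def)
  have tneg: "t \<le> 0" using Npos by (simp add: t_def)
  have nrm: "(\<Sum>i<n. (c * v i) * cnj (c * v i)) = 1"
  proof -
    have "(\<Sum>i<n. (c * v i) * cnj (c * v i)) = (\<Sum>i<n. of_real ((cmod c)^2 * (cmod (v i))^2))"
      by (intro sum.cong refl) (metis complex_norm_square norm_mult power_mult_distrib)
    also have "\<dots> = of_real ((cmod c)^2 * N)" by (simp add: N_def sum_distrib_left)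
    also have "(cmod c)^2 * N = 1"
      using ph Npos by (simp add: c_def norm_divide power_divide)
    finally show ?thesis by simp
  qed
  define w where "w = (\<lambda>i. c * v i - (if i = 0 then 1 else 0))"
  define \<beta> where "\<beta> = complex_of_real (2 - 2 * t)"
  have b0: "\<beta> \<noteq> 0" using tneg unfolding \<beta>_def of_real_eq_0_iff by linarith
  have wn: "(\<Sum>i<n. w i * cnj (w i)) = \<beta>"
  proof -
    have "(\<Sum>i<n. w i * cnj (w i)) = (\<Sum>i<n. (c * v i) * cnj (c * v i)
             - (if i = 0 then c * v 0 + cnj (c * v 0) - 1 else 0))"
      by (intro sum.cong refl) (auto simp: w_def algebra_simps)
    also have "\<dots> = 1 - (c * v 0 + cnj (c * v 0) - 1)"
      using n by (simp only: sum_subtractf nrm) (simp add: sum.delta)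
    finally show ?thesis by (simp add: t \<beta>_def)
  qed
  define U where "U = Matrix.mat n n (\<lambda>(i, j). (if i = j then 1 else 0) - 2 * w i * cnj (w j) / \<beta>)"
  have UU: "U * U = 1\<^sub>m n"
  proof (rule eq_matI)
    fix i j assume ij: "i < dim_row (1\<^sub>m n :: complex mat)" "j < dim_col (1\<^sub>m n :: complex mat)"
    have "(U * U) $$ (i, j) = (\<Sum>k<n. ((if i = k then 1 else 0) - 2 * w i * cnj (w k) / \<beta>) *
            ((if k = j then 1 else 0) - 2 * w k * cnj (w j) / \<beta>))"
      using ij by (simp add: U_def scalar_prod_def lessThan_atLeast0)
    also have "\<dots> = (\<Sum>k<n. (if k = i then (if i = j then 1 else 0) - 2 * w i * cnj (w j) / \<beta> else 0)
            - (if k = j then 2 * w i * cnj (w j) / \<beta> else 0)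
            + 4 * w i * cnj (w j) / \<beta>^2 * (w k * cnj (w k)))"
      by (intro sum.cong refl) (auto simp: algebra_simps power2_eq_square)
    also have "\<dots> = (if i = j then 1 else 0) - 2 * w i * cnj (w j) / \<beta> - 2 * w i * cnj (w j) / \<beta>
          + 4 * w i * cnj (w j) / \<beta>^2 * \<beta>"
      using ij by (simp only: sum.distrib sum_subtractf sum_distrib_left[symmetric] wn)
        (simp add: sum.delta)
    also have "\<dots> = (1\<^sub>m n) $$ (i, j)"
      using b0 ij by (simp add: field_simps power2_eq_square)
    finally show "(U * U) $$ (i, j) = (1\<^sub>m n) $$ (i, j)" .
  qed (auto simp: U_def)
  have col: "U $$ (i, 0) = c * v i" if "i < n" for i
  proof -
    have "2 * cnj (w 0) / \<beta> = -1" using b0 tneg by (simp add: w_def t \<beta>_def field_simps)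
    then have "2 * w i * cnj (w 0) / \<beta> = - w i" by (metis mult.commute mult.left_commute mult_minus1 times_divide_eq_right)
    then show ?thesis using that n by (simp add: U_def w_def)
  qed
  have "adj U = U"
    by (rule eq_matI) (auto simp: adj_def U_def \<beta>_def mult.commute)
  then show ?thesis using that[of U c] UU col c0 by (auto simp: U_def)
qed

text \<open>Deflation: an eigenvector becomes, up to scaling, the first column of a reflection
  \<open>U\<close>. As \<open>U\<close> is its own adjoint and inverse, \<open>U * A * U\<close> is
  again self-adjoint, so a first column that vanishes below the diagonal forces such a first row.
  The pair \<open>P\<close>, \<open>adj P\<close> records that the diagonalizing matrix is
  unitary.\<close>

lemma hermitian_diagonalization:
  assumes "A \<in> carrier_mat n n" "adj A = A"
  shows "\<exists>P d. P \<in> carrier_mat n n \<and>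
    similar_mat_wit A (Matrix.mat n n (\<lambda>(i, j). if i = j then complex_of_real (d i) else 0)) P (adj P)"
  using assms
proof (induction n arbitrary: A)
  case 0
  then have A: "A = 1\<^sub>m 0" by (intro eq_matI) auto
  have "similar_mat_wit A (Matrix.mat 0 0 (\<lambda>(i, j). if i = j then complex_of_real 0 else 0)) (1\<^sub>m 0) (adj (1\<^sub>m 0))"
    unfolding similar_mat_wit_def A Let_def by (auto intro!: eq_matI simp: adj_def)
  then show ?case by (intro exI[of _ "1\<^sub>m 0"] exI[of _ "\<lambda>_. 0"]) auto
next
  case (Suc n)
  note A = Suc.prems(1)
  obtain as where as: "char_poly A = (\<Prod>a\<leftarrow>as. [:- a, 1:])" "length as = Suc n"
    using char_poly_factorized[OF A] by blast
  then obtain e es where "as = e # es" by (cases as) auto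
  then have "poly (char_poly A) e = 0" using as by simp
  then have "eigenvalue A e" using eigenvalue_root_char_poly[OF A] by simp
  then obtain v where v: "v \<in> carrier_vec (Suc n)" "v \<noteq> 0\<^sub>v (Suc n)" "A *\<^sub>v v = e \<cdot>\<^sub>v v"
    using A unfolding eigenvalue_def eigenvector_def by auto
  have vne: "\<exists>i<Suc n. v $ i \<noteq> 0"
    by (metis carrier_vecD eq_vecI index_zero_vec(1) index_zero_vec(2) v(1) v(2))
  obtain U c where U: "U \<in> carrier_mat (Suc n) (Suc n)" "adj U = U" "U * U = 1\<^sub>m (Suc n)" "c \<noteq> 0"
      and Uc: "\<And>i. i < Suc n \<Longrightarrow> U $$ (i, 0) = c * v $ i"
    using householder[of "Suc n" "\<lambda>i. v $ i"] vne by auto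
  have colU: "col U 0 = c \<cdot>\<^sub>v v"
    by (rule eq_vecI) (use U(1) Uc v(1) in auto)
  define B where "B = U * A * U"
  have B: "B \<in> carrier_mat (Suc n) (Suc n)" using U A by (simp add: B_def)
  have adjB: "adj B = B"
    unfolding B_def using A U Suc.prems(2)
    by (simp add: adj_mult[of _ "Suc n" "Suc n" _ "Suc n"] assoc_mult_mat[of _ "Suc n" "Suc n" _ "Suc n" _ "Suc n"])
  have simAB: "similar_mat_wit A B U U"
  proof (rule similar_mat_witI[OF U(3) U(3) _ A B U(1) U(1)])
    have "U * B * U = (U * U) * A * (U * U)"
      unfolding B_def using A U(1) by (simp add: assoc_mult_mat[of _ "Suc n" "Suc n" _ "Suc n" _ "Suc n"])
    then show "A = U * B * U" using U A by simp
  qed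
  have "col B 0 = (U * A) *\<^sub>v col U 0"
    unfolding B_def using U A by (subst col_mult2[of _ "Suc n" "Suc n" _ "Suc n"]) auto
  also have "\<dots> = U *\<^sub>v (A *\<^sub>v (c \<cdot>\<^sub>v v))"
    unfolding colU using U A v by (intro assoc_mult_mat_vec[of _ "Suc n" "Suc n" _ "Suc n"]) auto
  also have "A *\<^sub>v (c \<cdot>\<^sub>v v) = e \<cdot>\<^sub>v col U 0"
    unfolding colU using A v(1) v(3) by (simp add: mult_mat_vec smult_smult_assoc mult.commute)
  also have "U *\<^sub>v (e \<cdot>\<^sub>v col U 0) = e \<cdot>\<^sub>v (U *\<^sub>v col U 0)"
    by (rule mult_mat_vec[OF U(1)]) (use U(1) in \<open>simp add: carrier_vecI\<close>)
  also have "U *\<^sub>v col U 0 = col (U * U) 0"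
    using U by (subst col_mult2[of _ "Suc n" "Suc n" _ "Suc n"]) auto
  finally have colB: "col B 0 = e \<cdot>\<^sub>v col (1\<^sub>m (Suc n)) 0" using U by simp
  have Bi0: "B $$ (i, 0) = (if i = 0 then e else 0)" if "i < Suc n" for i
  proof -
    have "B $$ (i, 0) = col B 0 $ i" using B that by simp
    then show ?thesis using colB that by simp
  qed
  have Bh: "B $$ (i, j) = cnj (B $$ (j, i))" if "i < Suc n" "j < Suc n" for i j
    using adj_index[of i B j] adjB B that by simp
  have B0j: "B $$ (0, j) = (if j = 0 then e else 0)" if "j < Suc n" for j
    using Bh[OF _ that, of 0] Bi0[OF that] Bi0[of 0] by (cases "j = 0") auto
  have ecnj: "e = cnj e"
    using Bh[of 0 0] Bi0[of 0] by (metis zero_less_Suc)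
  then have er: "e = of_real (Re e)"
    by (metis Reals_cnj_iff of_real_Re)
  define C where "C = Matrix.mat n n (\<lambda>(i, j). B $$ (Suc i, Suc j))"
  have C: "C \<in> carrier_mat n n" by (simp add: C_def)
  have adjC: "adj C = C"
    by (rule eq_matI) (auto simp: adj_def C_def Bh[symmetric])
  obtain P d where P: "P \<in> carrier_mat n n" and
    simC: "similar_mat_wit C (Matrix.mat n n (\<lambda>(i, j). if i = j then complex_of_real (d i) else 0)) P (adj P)"
    using Suc.IH[OF C adjC] by blast
  let ?D = "Matrix.mat n n (\<lambda>(i, j). if i = j then complex_of_real (d i) else 0)"
  let ?e = "Matrix.mat 1 1 (\<lambda>_. e)"
  have Bfb: "B = four_block_mat ?e (0\<^sub>m 1 n) (0\<^sub>m n 1) C"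
    by (rule eq_matI) (use B Bi0 B0j in \<open>auto simp: C_def\<close>)
  define P' where "P' = four_block_mat (1\<^sub>m 1) (0\<^sub>m 1 n) (0\<^sub>m n 1) P"
  have P': "P' \<in> carrier_mat (Suc n) (Suc n)"
    using P four_block_carrier_mat[of "1\<^sub>m 1" 1 1 P n n] unfolding P'_def by simp
  have adjP': "adj P' = four_block_mat (1\<^sub>m 1) (0\<^sub>m 1 n) (0\<^sub>m n 1) (adj P)"
    by (rule eq_matI) (use P in \<open>auto simp: adj_def P'_def\<close>)
  define d' where "d' = (\<lambda>i. if i = 0 then Re e else d (i - 1))"
  have D': "four_block_mat ?e (0\<^sub>m 1 n) (0\<^sub>m n 1) ?D
    = Matrix.mat (Suc n) (Suc n) (\<lambda>(i, j). if i = j then complex_of_real (d' i) else 0)"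
    by (rule eq_matI) (use er in \<open>auto simp: d'_def\<close>)
  have "similar_mat_wit B (four_block_mat ?e (0\<^sub>m 1 n) (0\<^sub>m n 1) ?D) P' (adj P')"
    unfolding Bfb adjP' unfolding P'_def
    by (rule similar_mat_wit_four_block[OF similar_mat_wit_refl simC])
      (use P C in \<open>auto simp: left_mult_zero_mat[OF adj_carrier[OF P]]\<close>)
  from similar_mat_wit_trans[OF simAB this[unfolded D']]
  have "similar_mat_wit A (Matrix.mat (Suc n) (Suc n) (\<lambda>(i, j). if i = j then complex_of_real (d' i) else 0))
      (U * P') (adj P' * U)" .
  moreover have "adj P' * U = adj (U * P')"
    using U P' by (simp add: adj_mult[of _ "Suc n" "Suc n" _ "Suc n"])
  ultimately show ?case using U P' by (intro exI[of _ "U * P'"] exI[of _ d']) auto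
qed

lemma order_prod_linear:
  "Polynomial.order x (\<Prod>a\<leftarrow>as. [:- a, 1:]) = count_list as (x :: 'a :: field)"
proof (induction as)
  case (Cons a as)
  have "(\<Prod>a\<leftarrow>as. [:- a, 1:]) \<noteq> (0 :: 'a poly)"
    by (auto simp: prod_list_zero_iff)
  then have "Polynomial.order x ([:- a, 1:] * (\<Prod>a\<leftarrow>as. [:- a, 1:])) =
      Polynomial.order x [:- a, 1:] + Polynomial.order x (\<Prod>a\<leftarrow>as. [:- a, 1:])"
    by (intro order_mult) (metis mult_eq_0_iff pCons_eq_0_iff one_neq_zero)
  moreover have "Polynomial.order x [:- a, 1:] = (if a = x then 1 else 0)"
    using order_linear'[of "-a" x] by (auto simp: order_0I)
  ultimately show ?case using Cons.IH by auto
qed simp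

text \<open>Row-vector convention: \<open>x\<close> is not conjugated and \<open>y\<close> is, so
  the Gram matrix of rows \<open>C p\<close> is C A C^*. Vectors are plain functions whose values
  beyond the dimension are ignored.\<close>

definition hform :: "complex mat \<Rightarrow> (nat \<Rightarrow> complex) \<Rightarrow> (nat \<Rightarrow> complex) \<Rightarrow> complex" where
  "hform A x y = (\<Sum>i<dim_row A. \<Sum>j<dim_col A. x i * A $$ (i, j) * cnj (y j))"

text \<open>Links root multiplicities summed over distinct eigenvalues to a count of diagonal
  positions: the multiplicity of x is the size of the fibre of \<open>d\<close> over x.\<close>

lemma neg_eigenvalues_real_diagonal:
  fixes d :: "nat \<Rightarrow> real"
  assumes A: "A \<in> carrier_mat n n"
    and sim: "similar_mat_wit A (Matrix.mat n n (\<lambda>(i, j). if i = j then complex_of_real (d i) else 0)) P Q"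
  shows "neg_eigenvalues A = card {i. i < n \<and> d i < 0}"
proof -
  let ?D = "Matrix.mat n n (\<lambda>(i, j). if i = j then complex_of_real (d i) else 0)"
  have cp: "char_poly A = (\<Prod>a\<leftarrow>map (\<lambda>i. complex_of_real (d i)) [0..<n]. [:- a, 1:])"
  proof -
    have "char_poly A = char_poly ?D"
      using sim by (intro char_poly_similar) (auto simp: similar_mat_def)
    also have "\<dots> = (\<Prod>a\<leftarrow>diag_mat ?D. [:- a, 1:])"
      by (rule char_poly_upper_triangular[of _ n]) auto
    also have "diag_mat ?D = map (\<lambda>i. complex_of_real (d i)) [0..<n]"
      by (auto simp: diag_mat_def)
    finally show ?thesis .
  qed
  have ord: "Polynomial.order (complex_of_real x) (char_poly A) = card {i. i < n \<and> d i = x}" for x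
  proof -
    have "Polynomial.order (complex_of_real x) (char_poly A) =
        length (filter (\<lambda>i. x = d i) [0..<n])"
      unfolding cp order_prod_linear by (simp add: count_list_eq_length_filter filter_map o_def)
    also have "\<dots> = card (set (filter (\<lambda>i. x = d i) [0..<n]))"
      by (intro distinct_card[symmetric]) auto
    also have "set (filter (\<lambda>i. x = d i) [0..<n]) = {i. i < n \<and> d i = x}" by auto
    finally show ?thesis .
  qed
  have ev: "eigenvalue A (complex_of_real x) \<longleftrightarrow> (\<exists>i<n. d i = x)" for x
    unfolding eigenvalue_root_char_poly[OF A] cp poly_prod_list
    by (auto simp: prod_list_zero_iff)
  have "neg_eigenvalues A = (\<Sum>x\<in>d ` {i. i < n \<and> d i < 0}. card {i. i < n \<and> d i = x})"
    unfolding neg_eigenvalues_def ord ev by (intro sum.cong) auto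
  also have "\<dots> = (\<Sum>x\<in>d ` {i. i < n \<and> d i < 0}. \<Sum>i | i \<in> {i. i < n \<and> d i < 0} \<and> d i = x. 1)"
    unfolding card_eq_sum by (intro sum.cong) auto
  also have "\<dots> = (\<Sum>i\<in>{i. i < n \<and> d i < 0}. 1)"
    by (rule sum.image_gen[symmetric]) auto
  finally show ?thesis by simp
qed

lemma underdetermined:
  fixes M :: "nat \<Rightarrow> nat \<Rightarrow> 'a :: field"
  assumes "q < k"
  obtains c where "\<exists>a<k. c a \<noteq> 0" "\<And>i. i < q \<Longrightarrow> (\<Sum>a<k. M i a * c a) = 0"
proof -
  \<comment> \<open>A zero row makes the square system singular. Since q < k, the overwritten row k
    - 1 is none of the q equations wanted.\<close>
  define T where "T = mat\<^sub>r k k (\<lambda>i. if i = k - 1 then 0\<^sub>v k else Matrix.vec k (M i))"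
  have T: "T \<in> carrier_mat k k" by (simp add: T_def)
  have "Determinant.det T = 0"
    unfolding T_def using assms by (intro det_row_0) auto
  then obtain v where v: "v \<in> carrier_vec k" "v \<noteq> 0\<^sub>v k" "T *\<^sub>v v = 0\<^sub>v k"
    using det_0_iff_vec_prod_zero_field[OF T] by auto
  have "\<exists>a<k. v $ a \<noteq> 0"
    by (metis carrier_vecD eq_vecI index_zero_vec(1) index_zero_vec(2) v(1) v(2))
  moreover have "(\<Sum>a<k. M i a * v $ a) = 0" if "i < q" for i
  proof -
    have ik: "i \<noteq> k - 1" "i < k" using that assms by auto
    have "(T *\<^sub>v v) $ i = 0" using v ik by simp
    then show ?thesis using v(1) ik by (simp add: T_def scalar_prod_def lessThan_atLeast0)
  qed
  ultimately show ?thesis using that by blast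
qed


section \<open>Sesquilinear forms and bounds on the number of negative squares\<close>

lemma hform_cnj:
  assumes "adj A = A"
  shows "hform A y x = cnj (hform A x y)"
proof -
  have d: "dim_row A = dim_col A" by (metis adj_def assms dim_row_mat(1))
  have e: "A $$ (j, i) = cnj (A $$ (i, j))" if "i < dim_row A" "j < dim_col A" for i j
    using that adj_index[of j A i] assms d by simp
  have "cnj (hform A x y) = (\<Sum>i<dim_row A. \<Sum>j<dim_col A. y j * A $$ (j, i) * cnj (x i))"
    unfolding hform_def cnj_sum by (intro sum.cong refl) (simp add: e)
  also have "\<dots> = (\<Sum>j<dim_col A. \<Sum>i<dim_row A. y j * A $$ (j, i) * cnj (x i))"
    by (rule sum.swap)
  finally show ?thesis unfolding hform_def by (simp only: d)
qed

lemma hform_add_left: "hform A (\<lambda>i. x i + y i) z = hform A x z + hform A y z"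
  unfolding hform_def sum.distrib[symmetric] by (simp add: algebra_simps)

lemma hform_add_right: "hform A z (\<lambda>i. x i + y i) = hform A z x + hform A z y"
  unfolding hform_def sum.distrib[symmetric] by (simp add: algebra_simps)

lemma hform_scale_left: "hform A (\<lambda>i. c * x i) z = c * hform A x z"
  unfolding hform_def by (simp add: sum_distrib_left algebra_simps)

lemma hform_scale_right: "hform A z (\<lambda>i. c * x i) = cnj c * hform A z x"
  unfolding hform_def by (simp add: sum_distrib_left algebra_simps)

lemma hform_sum_left: "hform A (\<lambda>i. \<Sum>p<(m::nat). x p * C p i) z = (\<Sum>p<m. x p * hform A (C p) z)"
proof (induction m)
  case 0
  show ?case by (simp add: hform_def)
next
  case (Suc m)
  then show ?case by (simp add: hform_add_left hform_scale_left)
qed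

lemma hform_sum_right: "hform A z (\<lambda>i. \<Sum>p<(m::nat). x p * C p i) = (\<Sum>p<m. cnj (x p) * hform A z (C p))"
proof (induction m)
  case 0
  show ?case by (simp add: hform_def)
next
  case (Suc m)
  then show ?case by (simp add: hform_add_right hform_scale_right)
qed

lemma hform_diagonal:
  assumes A: "A \<in> carrier_mat n n"
    and sim: "similar_mat_wit A (Matrix.mat n n (\<lambda>(i, j). if i = j then complex_of_real (d i) else 0)) P (adj P)"
  shows "hform A x y = (\<Sum>k<n. of_real (d k) * (\<Sum>i<n. x i * P $$ (i, k)) * cnj (\<Sum>j<n. y j * P $$ (j, k)))"
proof -
  let ?D = "Matrix.mat n n (\<lambda>(i, j). if i = j then complex_of_real (d i) else 0)"
  note P = similar_mat_witD2(6)[OF A sim] and AP = similar_mat_witD2(3)[OF A sim]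
  have e: "A $$ (i, j) = (\<Sum>k<n. of_real (d k) * P $$ (i, k) * cnj (P $$ (j, k)))" if "i < n" "j < n" for i j
  proof -
    define R where "R = P * ?D"
    have R: "R \<in> carrier_mat n n" unfolding R_def using P by simp
    have PD: "R $$ (i, k) = P $$ (i, k) * of_real (d k)" if "k < n" for k
    proof -
      have "R $$ (i, k) = (\<Sum>l<n. P $$ (i, l) * (if l = k then of_real (d l) else 0))"
        unfolding R_def using P that \<open>i < n\<close> by (simp add: scalar_prod_def lessThan_atLeast0)
      also have "\<dots> = (\<Sum>l<n. if l = k then P $$ (i, k) * of_real (d k) else 0)"
        by (intro sum.cong) auto
      finally show ?thesis using that by simp
    qed
    have "A $$ (i, j) = (P * ?D * adj P) $$ (i, j)" using AP by simp
    also have "\<dots> = (\<Sum>k<n. R $$ (i, k) * adj P $$ (k, j))"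
      unfolding R_def[symmetric] using R that adj_carrier[OF P] by (simp add: scalar_prod_def lessThan_atLeast0)
    also have "\<dots> = (\<Sum>k<n. of_real (d k) * P $$ (i, k) * cnj (P $$ (j, k)))"
      using P that by (intro sum.cong refl) (simp add: PD adj_index)
    finally show ?thesis .
  qed
  have "hform A x y = (\<Sum>i<n. \<Sum>j<n. \<Sum>k<n. of_real (d k) * (x i * P $$ (i, k)) * cnj (y j * P $$ (j, k)))"
    unfolding hform_def carrier_matD[OF A]
    by (intro sum.cong refl) (simp add: e sum_distrib_left sum_distrib_right mult_ac)
  also have "\<dots> = (\<Sum>i<n. \<Sum>k<n. \<Sum>j<n. of_real (d k) * (x i * P $$ (i, k)) * cnj (y j * P $$ (j, k)))"
    by (rule sum.cong[OF refl], rule sum.swap)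
  also have "\<dots> = (\<Sum>k<n. \<Sum>i<n. \<Sum>j<n. of_real (d k) * (x i * P $$ (i, k)) * cnj (y j * P $$ (j, k)))"
    by (rule sum.swap)
  also have "\<dots> = (\<Sum>k<n. of_real (d k) * (\<Sum>i<n. x i * P $$ (i, k)) * cnj (\<Sum>j<n. y j * P $$ (j, k)))"
    by (simp add: sum_distrib_left sum_distrib_right mult.assoc) (rule sum.cong[OF refl], rule sum.swap)
  finally show ?thesis .
qed

text \<open>The vectors are conjugated columns of the unitary \<open>P\<close> at negative
  \<open>d\<close>, scaled by 1 / sqrt (- d) to have form value -1; the conjugation is due to the
  row-vector convention of \<open>hform\<close>.\<close>

lemma negative_basis:
  assumes A: "A \<in> carrier_mat n n" and h: "adj A = A"
  obtains X where "\<And>a b. a < neg_eigenvalues A \<Longrightarrow> b < neg_eigenvalues A \<Longrightarrow>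
    hform A (X a) (X b) = (if a = b then -1 else 0)"
proof -
  obtain P d where P: "P \<in> carrier_mat n n" and
    sim: "similar_mat_wit A (Matrix.mat n n (\<lambda>(i, j). if i = j then complex_of_real (d i) else 0)) P (adj P)"
    using hermitian_diagonalization[OF A h] by blast
  let ?S = "{i. i < n \<and> d i < 0}"
  have q: "neg_eigenvalues A = card ?S" by (rule neg_eigenvalues_real_diagonal[OF A sim])
  have "finite ?S" by simp
  then obtain g where g: "bij_betw g {0..<card ?S} ?S" using ex_bij_betw_nat_finite by blast
  have gS: "g a < n" "d (g a) < 0" if "a < card ?S" for a
    using bij_betwE[OF g] that by auto
  have ginj: "g a = g b \<longleftrightarrow> a = b" if "a < card ?S" "b < card ?S" for a b
    using bij_betw_imp_inj_on[OF g] that by (auto simp: inj_on_def)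
  have PP: "(\<Sum>i<n. cnj (P $$ (i, l)) * P $$ (i, k)) = (if l = k then 1 else 0)" if "l < n" "k < n" for l k
  proof -
    have "(adj P * P) $$ (l, k) = (1\<^sub>m n) $$ (l, k)"
      using similar_mat_witD2[OF A sim] by simp
    then show ?thesis using P that by (simp add: scalar_prod_def lessThan_atLeast0 adj_def)
  qed
  define \<sigma> where "\<sigma> = (\<lambda>l. 1 / sqrt (- d l))"
  define X where "X = (\<lambda>a i. of_real (\<sigma> (g a)) * cnj (P $$ (i, g a)))"
  have XP: "(\<Sum>i<n. X a i * P $$ (i, k)) = (if g a = k then of_real (\<sigma> (g a)) else 0)"
    if "a < card ?S" "k < n" for a k
    using PP[OF gS(1)[OF that(1)] that(2)]
    unfolding X_def mult.assoc sum_distrib_left[symmetric] by simp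
  have "hform A (X a) (X b) = (if a = b then -1 else 0)" if a: "a < card ?S" and b: "b < card ?S" for a b
  proof -
    have "hform A (X a) (X b) = (\<Sum>k<n. if g a = k then (if g b = k then
        of_real (d k * \<sigma> k * \<sigma> k) else 0) else 0)"
      unfolding hform_diagonal[OF A sim] by (intro sum.cong refl) (simp add: XP a b)
    also have "\<dots> = (if g b = g a then
        of_real (d (g a) * \<sigma> (g a) * \<sigma> (g a)) else 0)"
      using gS(1)[OF a] by simp
    also have "d (g a) * \<sigma> (g a) * \<sigma> (g a) = -1"
      using gS(2)[OF a] by (simp add: \<sigma>_def field_simps)
    finally show ?thesis using ginj[OF b a] by auto
  qed
  then show ?thesis using that[of X] q by simp
qed

text \<open>Dimension count: with fewer negative eigenvalues than vectors, some nontrivial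
  combination is orthogonal to every eigenvector with negative eigenvalue, and there the
  diagonalized form is nonnegative. Negativity for all nonzero coefficients encodes the independence
  of the \<open>X a\<close>.\<close>

lemma negative_definite_le:
  assumes A: "A \<in> carrier_mat n n" and h: "adj A = A"
    and neg: "\<And>c. \<exists>a<k. c a \<noteq> 0 \<Longrightarrow> Re (\<Sum>a<k. \<Sum>b<k. c a * cnj (c b) * hform A (X a) (X b)) < 0"
  shows "k \<le> neg_eigenvalues A"
proof (rule ccontr)
  obtain P d where P: "P \<in> carrier_mat n n" and
    sim: "similar_mat_wit A (Matrix.mat n n (\<lambda>(i, j). if i = j then complex_of_real (d i) else 0)) P (adj P)"
    using hermitian_diagonalization[OF A h] by blast
  let ?S = "{i. i < n \<and> d i < 0}"
  have q: "neg_eigenvalues A = card ?S" by (rule neg_eigenvalues_real_diagonal[OF A sim])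
  have "finite ?S" by simp
  then obtain g where g: "bij_betw g {0..<card ?S} ?S" using ex_bij_betw_nat_finite by blast
  assume "\<not> k \<le> neg_eigenvalues A"
  then have "card ?S < k" using q by simp
  then obtain c where c: "\<exists>a<k. c a \<noteq> 0"
    "\<And>i. i < card ?S \<Longrightarrow> (\<Sum>a<k. (\<Sum>j<n. X a j * P $$ (j, g i)) * c a) = 0"
    using underdetermined[of "card ?S" k "\<lambda>i a. \<Sum>j<n. X a j * P $$ (j, g i)"] by blast
  define x where "x = (\<lambda>i. \<Sum>a<k. c a * X a i)"
  have "(\<Sum>a<k. \<Sum>b<k. c a * cnj (c b) * hform A (X a) (X b)) = hform A x x"
    unfolding x_def hform_sum_left hform_sum_right by (simp add: sum_distrib_left mult.assoc)
  moreover have "hform A x x = (\<Sum>l<n. of_real (d l * (cmod (\<Sum>i<n. x i * P $$ (i, l)))^2))"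
    unfolding hform_diagonal[OF A sim]
    by (intro sum.cong refl) (simp only: mult.assoc of_real_mult complex_norm_square)
  moreover have "d l * (cmod (\<Sum>i<n. x i * P $$ (i, l)))^2 \<ge> 0" if "l < n" for l
  proof (cases "d l < 0")
    case True
    then have "l \<in> g ` {0..<card ?S}"
      unfolding bij_betw_imp_surj_on[OF g] using that by simp
    then obtain i where i: "i < card ?S" "l = g i" by auto
    have "(\<Sum>j<n. x j * P $$ (j, l)) = (\<Sum>j<n. \<Sum>a<k. X a j * P $$ (j, l) * c a)"
      unfolding x_def sum_distrib_right by (intro sum.cong refl) simp
    also have "\<dots> = (\<Sum>a<k. (\<Sum>j<n. X a j * P $$ (j, l)) * c a)"
      unfolding sum_distrib_right by (rule sum.swap)
    finally show ?thesis using c(2)[OF i(1)] i by simp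
  qed auto
  then have "(\<Sum>l<n. d l * (cmod (\<Sum>i<n. x i * P $$ (i, l)))^2) \<ge> 0"
    by (intro sum_nonneg) simp
  ultimately have "Re (\<Sum>a<k. \<Sum>b<k. c a * cnj (c b) * hform A (X a) (X b)) \<ge> 0"
    by (simp only: of_real_sum[symmetric] Re_complex_of_real)
  then show False using neg[OF c(1)] by simp
qed

lemma diagonal_negative_le:
  assumes "A \<in> carrier_mat n n" "adj A = A"
    and gram: "\<And>a b. a < k \<Longrightarrow> b < k \<Longrightarrow> hform A (X a) (X b) = (if a = b then complex_of_real (g a) else 0)"
    and neg: "\<And>a. a < k \<Longrightarrow> g a < 0"
  shows "k \<le> neg_eigenvalues A"
proof (rule negative_definite_le[OF assms(1,2)])
  fix c :: "nat \<Rightarrow> complex"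
  assume "\<exists>a<k. c a \<noteq> 0"
  then obtain a0 where a0: "a0 < k" "c a0 \<noteq> 0" by auto
  have "(\<Sum>a<k. \<Sum>b<k. c a * cnj (c b) * hform A (X a) (X b))
      = (\<Sum>a<k. \<Sum>b<k. if b = a then c a * cnj (c a) * of_real (g a) else 0)"
    by (intro sum.cong refl) (auto simp: gram)
  also have "\<dots> = (\<Sum>a<k. of_real ((cmod (c a))^2 * g a))"
    by (intro sum.cong refl) (simp add: complex_norm_square del: of_real_power)
  also have "Re \<dots> = (\<Sum>a<k. (cmod (c a))^2 * g a)" by (simp del: of_real_mult of_real_power)
  also have "\<dots> < (\<Sum>a<k. 0)"
  proof (rule sum_strict_mono_ex1)
    show "\<forall>a\<in>{..<k}. (cmod (c a))^2 * g a \<le> 0"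
      using neg by (simp add: mult_nonneg_nonpos less_imp_le)
    show "\<exists>a\<in>{..<k}. (cmod (c a))^2 * g a < 0"
      using a0 neg by (intro bexI[of _ a0] mult_pos_neg) auto
  qed simp
  finally show "Re (\<Sum>a<k. \<Sum>b<k. c a * cnj (c b) * hform A (X a) (X b)) < 0" by simp
qed

text \<open>B = C A C^* is the form of A pulled back along x -> x C, so a negative family for B is
  sent to a family for A with the same Gram matrix.\<close>

lemma neg_eigenvalues_congruence:
  assumes A: "A \<in> carrier_mat n n" "adj A = A" and B: "B \<in> carrier_mat m m"
    and BC: "\<And>p q. p < m \<Longrightarrow> q < m \<Longrightarrow> B $$ (p, q) = hform A (C p) (C q)"
  shows "neg_eigenvalues B \<le> neg_eigenvalues A"
proof -
  have hB: "adj B = B"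
    by (rule eq_matI) (use B in \<open>auto simp: adj_def BC hform_cnj[OF A(2), symmetric]\<close>)
  obtain X where X: "\<And>a b. a < neg_eigenvalues B \<Longrightarrow> b < neg_eigenvalues B \<Longrightarrow>
      hform B (X a) (X b) = (if a = b then -1 else 0)"
    using negative_basis[OF B hB] by blast
  have "hform A (\<lambda>i. \<Sum>p<m. x p * C p i) (\<lambda>i. \<Sum>q<m. y q * C q i) = hform B x y" for x y
    unfolding hform_sum_left hform_sum_right unfolding hform_def[of B] carrier_matD[OF B] sum_distrib_left
    by (intro sum.cong refl) (simp add: BC)
  then show ?thesis
    by (intro diagonal_negative_le[OF A, of _ "\<lambda>a i. \<Sum>p<m. X a p * C p i" "\<lambda>_. -1"]) (simp_all add: X)
qed

text \<open>Lower semicontinuity: negative definiteness is an open condition on the Gram matrix of a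
  maximal negative family of the limit, so that family stays negative for nearby matrices.\<close>

lemma neg_eigenvalues_limit:
  assumes A: "A \<in> carrier_mat n n" "adj A = A" and F: "F \<noteq> bot"
    and M: "\<And>y. M y \<in> carrier_mat n n" "\<And>y. adj (M y) = M y"
    and lim: "\<And>i j. i < n \<Longrightarrow> j < n \<Longrightarrow> ((\<lambda>y. M y $$ (i, j)) \<longlongrightarrow> A $$ (i, j)) F"
    and ev: "\<forall>\<^sub>F y in F. neg_eigenvalues (M y) \<le> k"
  shows "neg_eigenvalues A \<le> k"
proof -
  define q where "q = neg_eigenvalues A"
  obtain X where X: "\<And>a b. a < q \<Longrightarrow> b < q \<Longrightarrow> hform A (X a) (X b) = (if a = b then -1 else 0)"
    using negative_basis[OF A] unfolding q_def by blast
  \<comment> \<open>With Gram matrix -1 plus entrywise errors below \<epsilon>, the form at c is at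
    most (\<epsilon> q - 1) times the squared norm of c, and \<epsilon> q < 1.\<close>
  define \<epsilon> where "\<epsilon> = 1 / (real q + 1)"
  have "((\<lambda>y. hform (M y) (X a) (X b)) \<longlongrightarrow> hform A (X a) (X b)) F" for a b
    unfolding hform_def carrier_matD[OF M(1)] carrier_matD[OF A(1)] by (intro tendsto_intros lim) auto
  then have "\<forall>\<^sub>F y in F. dist (hform (M y) (X a) (X b)) (hform A (X a) (X b)) < \<epsilon>" for a b
    by (rule tendstoD) (simp add: \<epsilon>_def)
  then have "\<forall>\<^sub>F y in F. \<forall>a\<in>{..<q}. \<forall>b\<in>{..<q}. dist (hform (M y) (X a) (X b)) (hform A (X a) (X b)) < \<epsilon>"
    by (intro eventually_ball_finite ballI) auto
  with ev have "\<forall>\<^sub>F y in F. neg_eigenvalues (M y) \<le> k \<and>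
      (\<forall>a\<in>{..<q}. \<forall>b\<in>{..<q}. dist (hform (M y) (X a) (X b)) (hform A (X a) (X b)) < \<epsilon>)"
    by (rule eventually_conj)
  then obtain y where y: "neg_eigenvalues (M y) \<le> k"
    and d: "\<And>a b. a < q \<Longrightarrow> b < q \<Longrightarrow> dist (hform (M y) (X a) (X b)) (hform A (X a) (X b)) < \<epsilon>"
    using eventually_happens'[OF F] by fastforce
  have "q \<le> neg_eigenvalues (M y)"
  proof (rule negative_definite_le[OF M])
    fix c :: "nat \<Rightarrow> complex"
    assume "\<exists>a<q. c a \<noteq> 0"
    then obtain a0 where a0: "a0 < q" "c a0 \<noteq> 0" by auto
    define N where "N = (\<Sum>a<q. (cmod (c a))^2)"
    have "0 < (cmod (c a0))^2" using a0 by simp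
    also have "\<dots> \<le> N" unfolding N_def by (rule member_le_sum) (use a0 in auto)
    finally have N: "N > 0" .
    define E where "E = (\<lambda>a b. hform (M y) (X a) (X b) - hform A (X a) (X b))"
    have "(\<Sum>a<q. \<Sum>b<q. c a * cnj (c b) * hform (M y) (X a) (X b))
        = (\<Sum>a<q. \<Sum>b<q. (if b = a then - (c a * cnj (c a)) else 0) + c a * cnj (c b) * E a b)"
      by (intro sum.cong refl) (auto simp: E_def X algebra_simps)
    also have "\<dots> = - of_real N + (\<Sum>a<q. \<Sum>b<q. c a * cnj (c b) * E a b)"
      unfolding sum.distrib by (simp add: N_def complex_norm_square sum_negf del: of_real_power)
    finally have eq: "Re (\<Sum>a<q. \<Sum>b<q. c a * cnj (c b) * hform (M y) (X a) (X b))
        = - N + Re (\<Sum>a<q. \<Sum>b<q. c a * cnj (c b) * E a b)" by simp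
    have "Re (\<Sum>a<q. \<Sum>b<q. c a * cnj (c b) * E a b) \<le> cmod (\<Sum>a<q. \<Sum>b<q. c a * cnj (c b) * E a b)"
      by (rule complex_Re_le_cmod)
    also have "\<dots> \<le> (\<Sum>a<q. \<Sum>b<q. cmod (c a * cnj (c b) * E a b))"
      by (intro order_trans[OF norm_sum] sum_mono norm_sum)
    also have "\<dots> \<le> (\<Sum>a<q. \<Sum>b<q. ((cmod (c a))^2 + (cmod (c b))^2) / 2 * \<epsilon>)"
    proof (intro sum_mono)
      fix a b assume "a \<in> {..<q}" "b \<in> {..<q}"
      then have E: "cmod (E a b) \<le> \<epsilon>" using d[of a b] by (simp add: E_def dist_norm)
      have "cmod (c a) * cmod (c b) \<le> ((cmod (c a))^2 + (cmod (c b))^2) / 2"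
        using sum_squares_bound[of "cmod (c a)" "cmod (c b)"] by simp
      then have "cmod (c a) * cmod (c b) * cmod (E a b) \<le> ((cmod (c a))^2 + (cmod (c b))^2) / 2 * \<epsilon>"
        using E by (intro mult_mono) auto
      then show "cmod (c a * cnj (c b) * E a b) \<le> ((cmod (c a))^2 + (cmod (c b))^2) / 2 * \<epsilon>"
        by (simp add: norm_mult)
    qed
    also have "\<dots> = \<epsilon> / 2 * (\<Sum>a<q. \<Sum>b<q. (cmod (c a))^2 + (cmod (c b))^2)"
      unfolding sum_distrib_left by (intro sum.cong refl) simp
    also have "\<dots> = \<epsilon> * q * N"
      by (simp add: sum.distrib N_def sum_distrib_left[symmetric] algebra_simps)
    also have "\<dots> < N" using N by (simp add: \<epsilon>_def field_simps)
    finally show "Re (\<Sum>a<q. \<Sum>b<q. c a * cnj (c b) * hform (M y) (X a) (X b)) < 0"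
      using eq by simp
  qed
  then show ?thesis using y q_def by simp
qed

text \<open>If \<open>u\<close> pairs to \<open>c \<noteq> 0\<close> with the last unit vector \<open>e\<close>, then subtracting a large multiple of \<open>u\<close>
  from \<open>e\<close>, made orthogonal to a maximal negative family of \<open>A\<close>, gives one more negative
  vector.\<close>

lemma kernel_of_bordered:
  assumes M: "M \<in> carrier_mat (Suc n) (Suc n)" "adj M = M"
    and A: "A \<in> carrier_mat n n" "\<And>i j. i < n \<Longrightarrow> j < n \<Longrightarrow> A $$ (i, j) = M $$ (i, j)"
    and le: "neg_eigenvalues M \<le> neg_eigenvalues A"
    and u: "\<And>j. j < n \<Longrightarrow> (\<Sum>i<n. u i * M $$ (i, j)) = 0"
  shows "(\<Sum>i<n. u i * M $$ (i, n)) = 0"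
proof (rule ccontr)
  define c where "c = (\<Sum>i<n. u i * M $$ (i, n))"
  assume "(\<Sum>i<n. u i * M $$ (i, n)) \<noteq> 0"
  then have c0: "c \<noteq> 0" by (simp add: c_def)
  have Mh: "M $$ (i, j) = cnj (M $$ (j, i))" if "i < Suc n" "j < Suc n" for i j
    using adj_index[of i M j] M that by simp
  have hA: "adj A = A"
    by (rule eq_matI) (use A in \<open>auto simp: adj_def Mh[symmetric]\<close>)
  define q where "q = neg_eigenvalues A"
  obtain X where X: "\<And>a b. a < q \<Longrightarrow> b < q \<Longrightarrow> hform A (X a) (X b) = (if a = b then -1 else 0)"
    using negative_basis[OF A(1) hA] unfolding q_def by blast
  define ext where "ext = (\<lambda>(x :: nat \<Rightarrow> complex) i. if i < n then x i else 0)"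
  define e where "e = (\<lambda>i. if i = n then 1 else 0 :: complex)"
  let ?h = "hform M"
  have hext: "?h (ext x) (ext y) = (\<Sum>i<n. \<Sum>j<n. x i * M $$ (i, j) * cnj (y j))" for x y
    using M by (simp add: hform_def ext_def)
  have XX: "?h (ext (X a)) (ext (X b)) = (if a = b then -1 else 0)" if "a < q" "b < q" for a b
    unfolding hext X[OF that, symmetric] using A by (simp add: hform_def)
  have ux: "?h (ext u) (ext x) = 0" for x
  proof -
    have "?h (ext u) (ext x) = (\<Sum>j<n. (\<Sum>i<n. u i * M $$ (i, j)) * cnj (x j))"
      unfolding hext sum_distrib_right by (rule sum.swap)
    then show ?thesis using u by simp
  qed
  have ue: "?h (ext u) e = c"
    using M by (simp add: hform_def ext_def e_def c_def if_distrib[of cnj] cong: if_cong)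
  \<comment> \<open>The component of \<open>e\<close> orthogonal to the negative family; the plus
    sign reflects that each \<open>X a\<close> has form value -1.\<close>
  define w where "w = (\<lambda>i. e i + (\<Sum>a<q. ?h e (ext (X a)) * ext (X a) i))"
  have wX: "?h w (ext (X b)) = 0" if "b < q" for b
  proof -
    have "?h w (ext (X b)) = ?h e (ext (X b)) + (\<Sum>a<q. if a = b then - ?h e (ext (X a)) else 0)"
      unfolding w_def hform_add_left hform_sum_left using that
      by (intro arg_cong2[of _ _ _ _ "(+)"] refl sum.cong) (auto simp: XX)
    then show ?thesis using that by simp
  qed
  have uw: "?h (ext u) w = c"
    unfolding w_def hform_add_right hform_sum_right by (simp add: ux ue)
  have wu: "?h w (ext u) = cnj c" using hform_cnj[OF M(2), of w "ext u"] uw by simp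
  define g where "g = Re (?h w w)"
  have g: "?h w w = of_real g"
    using hform_cnj[OF M(2), of w w] by (simp add: g_def complex_eq_iff)
  \<comment> \<open>Chosen so that \<open>\<tau> * c\<close> is -(|g| + 1), which makes the form
    value of \<open>y\<close> equal to g - 2 (|g| + 1) < 0. Adding a multiple of \<open>u\<close>
    preserves orthogonality to the \<open>X a\<close> because \<open>u\<close> is in the kernel of
    \<open>A\<close>.\<close>
  define T where "T = (\<bar>g\<bar> + 1) / (cmod c)^2"
  define \<tau> where "\<tau> = - of_real T * cnj c"
  define y where "y = (\<lambda>i. w i + \<tau> * ext u i)"
  have "?h y y = of_real g + \<tau> * c + cnj (\<tau> * c)"
    unfolding y_def hform_add_left hform_add_right hform_scale_left hform_scale_right
    by (simp add: ux uw wu g algebra_simps)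
  also have "\<tau> * c = - of_real (T * (cmod c)^2)"
    by (simp add: \<tau>_def complex_norm_square mult_ac del: of_real_power)
  also have "T * (cmod c)^2 = \<bar>g\<bar> + 1" using c0 by (simp add: T_def)
  finally have yy: "?h y y = of_real (g - 2 * (\<bar>g\<bar> + 1))" by simp
  have yX: "?h y (ext (X b)) = 0" if "b < q" for b
    unfolding y_def hform_add_left hform_scale_left by (simp add: wX[OF that] ux)
  have Xy: "?h (ext (X b)) y = 0" if "b < q" for b
    using hform_cnj[OF M(2), of "ext (X b)" y] yX[OF that] by simp
  define Z where "Z = (\<lambda>a. if a < q then ext (X a) else y)"
  have "Suc q \<le> neg_eigenvalues M"
  proof (rule diagonal_negative_le[OF M, where X = Z and g = "\<lambda>a. if a < q then -1 else g - 2 * (\<bar>g\<bar> + 1)"])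
    fix a b assume "a < Suc q" "b < Suc q"
    then show "?h (Z a) (Z b) = (if a = b then complex_of_real (if a < q then -1 else g - 2 * (\<bar>g\<bar> + 1)) else 0)"
      using XX[of a b] yX[of b] Xy[of a] yy by (auto simp: Z_def less_Suc_eq)
  qed auto
  then show False using le q_def by simp
qed

section \<open>Hankel matrices and recursions\<close>

text \<open>Unlike in \<^const>\<open>hankel\<close>, the second argument is the size, so that the empty matrix is
  included.\<close>

definition chankel :: "(nat \<Rightarrow> real) \<Rightarrow> nat \<Rightarrow> complex mat" where
  "chankel s m = Matrix.mat m m (\<lambda>(i, j). complex_of_real (s (i + j)))"

lemma chankel_carrier [simp]: "chankel s m \<in> carrier_mat m m"
  by (simp add: chankel_def)

lemma adj_chankel [simp]: "adj (chankel s m) = chankel s m"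
  by (rule eq_matI) (auto simp: adj_def chankel_def add.commute)

lemma neg_eigenvalues_of_real:
  fixes A :: "real mat"
  assumes A: "A \<in> carrier_mat n n"
  shows "neg_eigenvalues (map_mat complex_of_real A) = neg_eigenvalues A"
proof -
  have cp: "char_poly (map_mat complex_of_real A) = map_poly complex_of_real (char_poly A)"
    by (rule of_real_hom.char_poly_hom[OF A])
  interpret map_poly_inj_idom_divide_hom complex_of_real ..
  have A': "map_mat complex_of_real A \<in> carrier_mat n n" using A by simp
  have "eigenvalue (map_mat complex_of_real A) (complex_of_real x) \<longleftrightarrow> eigenvalue A x" for x
    unfolding eigenvalue_root_char_poly[OF A'] eigenvalue_root_char_poly[OF A] cp by simp
  then show ?thesis
    unfolding neg_eigenvalues_def cp by (simp add: order_hom)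
qed

lemma neg_eigenvalues_hankel: "neg_eigenvalues (hankel s k) = neg_eigenvalues (chankel s (k + 1))"
proof -
  have "map_mat complex_of_real (hankel s k) = chankel s (k + 1)"
    by (rule eq_matI) (auto simp: hankel_def chankel_def)
  then show ?thesis
    using neg_eigenvalues_of_real[of "hankel s k" "k + 1"] by (simp add: hankel_def)
qed

lemma chankel_cong: "(\<And>i. i + 2 \<le> 2 * m \<Longrightarrow> s i = s' i) \<Longrightarrow> chankel s m = chankel s' m"
  by (rule eq_matI) (auto simp: chankel_def)

lemma sum_shifted:
  fixes u f :: "nat \<Rightarrow> 'a :: comm_semiring_1"
  assumes "t + r \<le> m"
  shows "(\<Sum>i<m. (if t \<le> i \<and> i < t + r then u (i - t) else 0) * f i) = (\<Sum>i<r. u i * f (i + t))"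
proof -
  have "(\<Sum>i<m. (if t \<le> i \<and> i < t + r then u (i - t) else 0) * f i)
      = (\<Sum>i\<in>{0 + t..<r + t}. u (i - t) * f i)"
    using assms by (intro sum.mono_neutral_cong_right) auto
  also have "\<dots> = (\<Sum>i\<in>{0..<r}. u (i + t - t) * f (i + t))"
    by (rule sum.shift_bounds_nat_ivl)
  finally show ?thesis by (simp add: lessThan_atLeast0)
qed

text \<open>The recursion writes the last row as a combination of earlier ones, so the larger matrix
  is E S E^T with S the smaller one; as S is a principal submatrix, the converse inequality holds
  too. The range k + r \<le> 2 m is what reaches the corner entry s (2 m).\<close>

lemma neg_eigenvalues_chankel_Suc:
  assumes "r \<le> m" "u r = 1"
    and rec: "\<And>k. k + r \<le> 2 * m \<Longrightarrow> (\<Sum>i\<le>r. u i * s (i + k)) = 0"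
  shows "neg_eigenvalues (chankel s (Suc m)) = neg_eigenvalues (chankel s m)"
proof (rule antisym)
  define E :: "nat \<Rightarrow> nat \<Rightarrow> complex" where
    "E = (\<lambda>p i. if p < m then (if i = p then 1 else 0)
        else (if m - r \<le> i \<and> i < m - r + r then - of_real (u (i - (m - r))) else 0))"
  have Es: "(\<Sum>i<m. E p i * of_real (s (i + l))) = of_real (s (p + l))" if "p \<le> m" "l \<le> m" for p l
  proof (cases "p < m")
    case True
    then have "(\<Sum>i<m. E p i * of_real (s (i + l))) = (\<Sum>i<m. if i = p then of_real (s (p + l)) else 0)"
      by (intro sum.cong) (auto simp: E_def)
    then show ?thesis using True by simp
  next
    case False
    then have p: "p = m" using that by simp
    have "(\<Sum>i<m. E p i * of_real (s (i + l))) = (\<Sum>i<r. - of_real (u i) * of_real (s (i + (m - r) + l)))"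
      unfolding E_def p using sum_shifted[of "m - r" r m "\<lambda>i. - complex_of_real (u i)" "\<lambda>i. of_real (s (i + l))"] assms(1)
      by simp
    also have "\<dots> = of_real (- (\<Sum>i<r. u i * s (i + (m - r + l))))"
      by (simp add: sum_negf add.assoc)
    also have "- (\<Sum>i<r. u i * s (i + (m - r + l))) = s (p + l)"
      using rec[of "m - r + l"] that assms(1,2) by (simp add: p lessThan_Suc_atMost[symmetric])
    finally show ?thesis .
  qed
  show "neg_eigenvalues (chankel s (Suc m)) \<le> neg_eigenvalues (chankel s m)"
  proof (rule neg_eigenvalues_congruence[where C = E and n = m])
    fix p q assume pq: "p < Suc m" "q < Suc m"
    have cE: "cnj (E q j) = E q j" for j by (simp add: E_def)
    have "hform (chankel s m) (E p) (E q) = (\<Sum>i<m. \<Sum>j<m. E p i * of_real (s (i + j)) * E q j)"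
      by (simp add: hform_def chankel_def cE)
    also have "\<dots> = (\<Sum>j<m. (\<Sum>i<m. E p i * of_real (s (i + j))) * E q j)"
      unfolding sum_distrib_right by (rule sum.swap)
    also have "\<dots> = (\<Sum>j<m. E q j * of_real (s (j + p)))"
      using pq Es[of p] by (intro sum.cong refl) (simp add: mult.commute add.commute)
    also have "\<dots> = of_real (s (q + p))" using Es[of q p] pq by simp
    finally show "chankel s (Suc m) $$ (p, q) = hform (chankel s m) (E p) (E q)"
      using pq by (simp add: chankel_def add.commute)
  qed auto
  show "neg_eigenvalues (chankel s m) \<le> neg_eigenvalues (chankel s (Suc m))"
  proof (rule neg_eigenvalues_congruence[where C = "\<lambda>p i. if i = p then 1 else 0" and n = "Suc m"])
    fix p q assume "p < m" "q < m"
    moreover have "hform (chankel s (Suc m)) (\<lambda>i. if i = p then 1 else 0) (\<lambda>i. if i = q then 1 else 0)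
       = (\<Sum>i<Suc m. \<Sum>j<Suc m. if i = p then (if j = q then of_real (s (p + q)) else 0) else 0)"
      unfolding hform_def carrier_matD[OF chankel_carrier]
      by (intro sum.cong refl) (auto simp: chankel_def)
    moreover have "\<dots> = (\<Sum>i<Suc m. if i = p then (\<Sum>j<Suc m. if j = q then of_real (s (p + q)) else 0) else 0)"
      by (intro sum.cong refl) auto
    ultimately show "chankel s m $$ (p, q)
        = hform (chankel s (Suc m)) (\<lambda>i. if i = p then 1 else 0) (\<lambda>i. if i = q then 1 else 0)"
      by (simp add: chankel_def)
  qed auto
qed

lemma neg_eigenvalues_chankel_recursive:
  assumes "r \<le> m" "u r = 1"
    and rec: "\<And>k. k + r + 2 \<le> 2 * m \<Longrightarrow> (\<Sum>i\<le>r. u i * s (i + k)) = 0"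
  shows "neg_eigenvalues (chankel s m) = neg_eigenvalues (chankel s r)"
  using assms(1) rec
proof (induction m rule: dec_induct)
  case (step m)
  have "neg_eigenvalues (chankel s (Suc m)) = neg_eigenvalues (chankel s m)"
    by (rule neg_eigenvalues_chankel_Suc[where u = u, OF step.hyps(1) assms(2)]) (simp add: step.prems)
  with step show ?case by simp
qed simp

lemma neg_eigenvalues_flat_extension:
  assumes "r \<le> n" "u r = 1"
    and rec: "\<And>k. k + r \<le> 2 * n \<Longrightarrow> (\<Sum>i\<le>r. u i * s (i + k)) = 0"
  shows "\<exists>a b. neg_eigenvalues (hankel (s(2 * n + 1 := a, 2 * n + 2 := b)) (n + 1)) = neg_eigenvalues (hankel s n)"
proof -
  \<comment> \<open>Both new moments continue the recursion; \<open>b\<close> is computed with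
    \<open>a\<close> already in place, since s (2 n + 1) enters its sum once r > 0.\<close>
  define a where "a = - (\<Sum>i<r. u i * s (i + (2 * n + 1 - r)))"
  define b where "b = - (\<Sum>i<r. u i * (s(2 * n + 1 := a)) (i + (2 * n + 2 - r)))"
  define s' where "s' = s(2 * n + 1 := a, 2 * n + 2 := b)"
  have rec': "(\<Sum>i\<le>r. u i * s' (i + k)) = 0" if k: "k + r \<le> 2 * n + 2" for k
  proof -
    consider "k + r \<le> 2 * n" | "k + r = 2 * n + 1" | "k + r = 2 * n + 2" using k by linarith
    then show ?thesis
    proof cases
      case 1
      then have "(\<Sum>i\<le>r. u i * s' (i + k)) = (\<Sum>i\<le>r. u i * s (i + k))"
        by (intro sum.cong) (auto simp: s'_def)
      then show ?thesis using rec 1 by simp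
    next
      case 2
      then have k': "k = 2 * n + 1 - r" by simp
      have "(\<Sum>i<r. u i * s' (i + k)) = (\<Sum>i<r. u i * s (i + (2 * n + 1 - r)))"
        using 2 by (intro sum.cong) (auto simp: s'_def k')
      moreover have "s' (r + k) = a" using 2 by (simp add: s'_def add.commute)
      ultimately show ?thesis using assms(2) by (simp add: lessThan_Suc_atMost[symmetric] a_def)
    next
      case 3
      then have k': "k = 2 * n + 2 - r" by simp
      have "(\<Sum>i<r. u i * s' (i + k)) = (\<Sum>i<r. u i * (s(2 * n + 1 := a)) (i + (2 * n + 2 - r)))"
        using 3 by (intro sum.cong) (auto simp: s'_def k')
      moreover have "s' (r + k) = b" using 3 by (simp add: s'_def add.commute)
      ultimately show ?thesis using assms(2) by (simp add: lessThan_Suc_atMost[symmetric] b_def)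
    qed
  qed
  have "neg_eigenvalues (chankel s' (n + 2)) = neg_eigenvalues (chankel s' r)"
    using assms(1,2) rec' by (intro neg_eigenvalues_chankel_recursive[where u = u]) auto
  moreover have "neg_eigenvalues (chankel s' (n + 1)) = neg_eigenvalues (chankel s' r)"
    using assms(1,2) rec' by (intro neg_eigenvalues_chankel_recursive[where u = u]) auto
  moreover have "chankel s' (n + 1) = chankel s (n + 1)"
    by (rule chankel_cong) (auto simp: s'_def)
  ultimately have "neg_eigenvalues (hankel s' (n + 1)) = neg_eigenvalues (hankel s n)"
    unfolding neg_eigenvalues_hankel by simp
  then show ?thesis unfolding s'_def by blast
qed

text \<open>If \<open>u\<close> is in the kernel of \<open>S\<^sub>n\<close>, then its shift satisfies all equations of the kernel but the
  last one, which is the one supplied by the assumption on \<open>s'\<close>.\<close>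

lemma recursive_of_kernel_shift:
  fixes u s :: "nat \<Rightarrow> real"
  assumes "r \<le> n" and u: "\<And>k. k \<le> n \<Longrightarrow> (\<Sum>i\<le>r. u i * s (i + k)) = 0"
    and ker: "\<And>v. (\<And>k. k \<le> n \<Longrightarrow> (\<Sum>i\<le>n. v i * s (i + k)) = 0) \<Longrightarrow> (\<Sum>i\<le>n. v i * s' (i + (n + 1))) = 0"
    and s': "\<And>i. i \<le> 2 * n \<Longrightarrow> s' i = s i"
    and k: "k + r \<le> 2 * n"
  shows "(\<Sum>i\<le>r. u i * s (i + k)) = 0"
proof -
  have *: "\<forall>k\<le>n. (\<Sum>i\<le>r. u i * s (i + (t + k))) = 0" if "t + r \<le> n" for t
    using that
  proof (induction t)
    case 0
    then show ?case using u by simp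
  next
    case (Suc t)
    define v where "v = (\<lambda>i. if t \<le> i \<and> i < t + Suc r then u (i - t) else 0)"
    have v: "(\<Sum>i\<le>n. v i * f i) = (\<Sum>i\<le>r. u i * f (i + t))" for f
      using sum_shifted[of t "Suc r" "Suc n" u f] Suc.prems by (simp add: v_def lessThan_Suc_atMost)
    have IH: "(\<Sum>i\<le>r. u i * s (i + (t + k))) = 0" if "k \<le> n" for k
      using Suc.IH Suc.prems that by simp
    have "(\<Sum>i\<le>n. v i * s' (i + (n + 1))) = 0"
      by (rule ker) (simp add: v IH add.assoc)
    then have last: "(\<Sum>i\<le>r. u i * s' (i + t + (n + 1))) = 0" by (simp only: v)
    show ?case
    proof (intro allI impI)
      fix k assume k: "k \<le> n"
      show "(\<Sum>i\<le>r. u i * s (i + (Suc t + k))) = 0"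
      proof (cases "k = n")
        case False
        then show ?thesis using IH[of "Suc k"] k by simp
      next
        case True
        have "(\<Sum>i\<le>r. u i * s (i + (Suc t + k))) = (\<Sum>i\<le>r. u i * s' (i + t + (n + 1)))"
          using Suc.prems True by (intro sum.cong refl) (simp add: s' add.assoc)
        then show ?thesis using last by simp
      qed
    qed
  qed
  \<comment> \<open>Shifts up to n - r combined with rows up to n cover every k up to 2 n -
    r.\<close>
  show ?thesis
  proof (cases "k \<le> n - r")
    case True
    then show ?thesis using *[of k] assms(1) by force
  next
    case False
    then have k': "k = (n - r) + (k - (n - r))" "k - (n - r) \<le> n" using k assms(1) by auto
    have "(\<Sum>i\<le>r. u i * s (i + ((n - r) + (k - (n - r))))) = 0"
      using *[of "n - r"] k'(2) le_add_diff_inverse2[OF assms(1)] by (metis order_refl)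
    then show ?thesis using k'(1) by simp
  qed
qed

lemma recursive_of_extension:
  fixes u s :: "nat \<Rightarrow> real"
  assumes "r \<le> n" and u: "\<And>k. k \<le> n \<Longrightarrow> (\<Sum>i\<le>r. u i * s (i + k)) = 0"
    and ext: "neg_eigenvalues (hankel (s(2 * n + 1 := a, 2 * n + 2 := b)) (n + 1)) = neg_eigenvalues (hankel s n)"
    and k: "k + r \<le> 2 * n"
  shows "(\<Sum>i\<le>r. u i * s (i + k)) = 0"
proof (rule recursive_of_kernel_shift[OF assms(1) u _ _ k])
  let ?s = "s(2 * n + 1 := a, 2 * n + 2 := b)"
  show "?s i = s i" if "i \<le> 2 * n" for i using that by simp
  fix v :: "nat \<Rightarrow> real"
  assume v: "\<And>k. k \<le> n \<Longrightarrow> (\<Sum>i\<le>n. v i * s (i + k)) = 0"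
  have "(\<Sum>i<Suc n. complex_of_real (v i) * chankel ?s (Suc (Suc n)) $$ (i, Suc n)) = 0"
  proof (rule kernel_of_bordered[where A = "chankel s (Suc n)"])
    show "neg_eigenvalues (chankel ?s (Suc (Suc n))) \<le> neg_eigenvalues (chankel s (Suc n))"
      using ext unfolding neg_eigenvalues_hankel by simp
    show "chankel s (Suc n) $$ (i, j) = chankel ?s (Suc (Suc n)) $$ (i, j)" if "i < Suc n" "j < Suc n" for i j
      using that by (auto simp: chankel_def)
    show "(\<Sum>i<Suc n. complex_of_real (v i) * chankel ?s (Suc (Suc n)) $$ (i, j)) = 0" if "j < Suc n" for j
    proof -
      have "(\<Sum>i<Suc n. complex_of_real (v i) * chankel ?s (Suc (Suc n)) $$ (i, j))
        = (\<Sum>i\<le>n. of_real (v i * s (i + j)))"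
        using that unfolding lessThan_Suc_atMost by (intro sum.cong refl) (auto simp: chankel_def)
      also have "\<dots> = of_real (\<Sum>i\<le>n. v i * s (i + j))" by simp
      finally show ?thesis using v[of j] that by simp
    qed
  qed auto
  moreover have "(\<Sum>i<Suc n. complex_of_real (v i) * chankel ?s (Suc (Suc n)) $$ (i, Suc n))
      = (\<Sum>i\<le>n. of_real (v i * ?s (i + (n + 1))))"
    unfolding lessThan_Suc_atMost by (intro sum.cong refl) (auto simp: chankel_def)
  moreover have "\<dots> = of_real (\<Sum>i\<le>n. v i * ?s (i + (n + 1)))"
    by (simp only: of_real_sum)
  ultimately show "(\<Sum>i\<le>n. v i * ?s (i + (n + 1))) = 0"
    by (simp only: of_real_eq_0_iff)
qed

section \<open>Column spans, independence and rank\<close>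

abbreviation col_span :: "(nat \<Rightarrow> real) \<Rightarrow> nat \<Rightarrow> nat \<Rightarrow> real Matrix.vec set" where
  "col_span s n r \<equiv> LinearCombinations.module.span class_ring (module_vec TYPE(real) (n + 1))
     (col (hankel s n) ` {..<r})"

lemma hankel_carrier [simp]: "hankel s n \<in> carrier_mat (n + 1) (n + 1)"
  by (simp add: hankel_def)

lemma hankel_col: "i \<le> n \<Longrightarrow> col (hankel s n) i = Matrix.vec (n + 1) (\<lambda>k. s (i + k))"
  by (rule eq_vecI) (auto simp: hankel_def add.commute)

lemma hankel_col_carrier: "col (hankel s n) i \<in> carrier_vec (n + 1)"
  by (rule carrier_vecI) (simp add: hankel_def)

lemma set_cols_hankel: "set (cols (hankel s n)) = col (hankel s n) ` {..n}"
proof -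
  have "set [0..<n + 1] = {..n}" by auto
  then show ?thesis unfolding cols_def set_map carrier_matD(2)[OF hankel_carrier] by (rule arg_cong)
qed

lemma in_col_span_iff:
  assumes "v \<in> carrier_vec (n + 1)" "r \<le> n + 1"
  shows "v \<in> col_span s n r \<longleftrightarrow> (\<exists>\<alpha>. \<forall>k\<le>n. v $ k = (\<Sum>i<r. \<alpha> i * s (i + k)))"
proof -
  interpret vec_space "TYPE(real)" "n + 1" .
  let ?c = "col (hankel s n)"
  have cc: "?c ` {..<r} \<subseteq> carrier_vec (n + 1)"
    using hankel_col_carrier by blast
  have ck: "?c i $ k = s (i + k)" if "i < r" "k \<le> n" for i k
    using that assms(2) by (simp add: hankel_col)
  show ?thesis
  proof
    assume "v \<in> span (?c ` {..<r})"
    then obtain a A where v: "v = lincomb a A" and A: "A \<subseteq> ?c ` {..<r}"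
      using in_spanE by blast
    \<comment> \<open>Different positions may carry equal columns; one position is selected for each
      vector of \<open>A\<close>, and the others get coefficient 0.\<close>
    obtain I where I: "I \<subseteq> {..<r}" "inj_on ?c I" "A = ?c ` I"
      using A unfolding subset_image_inj by blast
    have "v $ k = (\<Sum>i<r. (if i \<in> I then a (?c i) else 0) * s (i + k))" if "k \<le> n" for k
    proof -
      have "v $ k = (\<Sum>x\<in>A. a x * x $ k)"
        unfolding v using that A cc by (intro lincomb_index) auto
      also have "\<dots> = (\<Sum>i\<in>I. a (?c i) * ?c i $ k)"
        unfolding I(3) by (simp add: sum.reindex[OF I(2)])
      also have "\<dots> = (\<Sum>i<r. (if i \<in> I then a (?c i) else 0) * s (i + k))"
        using I(1) that by (intro sum.mono_neutral_cong_left) (auto simp: ck subset_iff)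
      finally show ?thesis .
    qed
    then show "\<exists>\<alpha>. \<forall>k\<le>n. v $ k = (\<Sum>i<r. \<alpha> i * s (i + k))"
      by (intro exI[of _ "\<lambda>i. if i \<in> I then a (?c i) else 0"]) simp
  next
    assume "\<exists>\<alpha>. \<forall>k\<le>n. v $ k = (\<Sum>i<r. \<alpha> i * s (i + k))"
    then obtain \<alpha> where \<alpha>: "\<And>k. k \<le> n \<Longrightarrow> v $ k = (\<Sum>i<r. \<alpha> i * s (i + k))" by blast
    have "Matrix.vec (n + 1) (\<lambda>k. \<Sum>i<m. \<alpha> i * s (i + k)) \<in> span (?c ` {..<r})" if "m \<le> r" for m
      using that
    proof (induction m)
      case 0
      have "0\<^sub>v (n + 1) \<in> span {}" using span_empty by blast
      then have "0\<^sub>v (n + 1) \<in> span (?c ` {..<r})"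
        by (rule subsetD[OF span_is_monotone, rotated]) simp
      moreover have "Matrix.vec (n + 1) (\<lambda>k. \<Sum>i<0. \<alpha> i * s (i + k)) = 0\<^sub>v (n + 1)"
        by (rule eq_vecI) auto
      ultimately show ?case by simp
    next
      case (Suc m)
      have "\<alpha> m \<cdot>\<^sub>v ?c m \<in> span (?c ` {..<r})"
        using Suc.prems by (intro smult_in_span span_mem cc) auto
      then have "Matrix.vec (n + 1) (\<lambda>k. \<Sum>i<m. \<alpha> i * s (i + k)) + \<alpha> m \<cdot>\<^sub>v ?c m \<in> span (?c ` {..<r})"
        using Suc by (intro span_add1[OF cc]) auto
      also have "Matrix.vec (n + 1) (\<lambda>k. \<Sum>i<m. \<alpha> i * s (i + k)) + \<alpha> m \<cdot>\<^sub>v ?c m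
          = Matrix.vec (n + 1) (\<lambda>k. \<Sum>i<Suc m. \<alpha> i * s (i + k))"
        using Suc.prems assms(2) by (intro eq_vecI) (auto simp: hankel_col)
      finally show ?case .
    qed
    moreover have "v = Matrix.vec (n + 1) (\<lambda>k. \<Sum>i<r. \<alpha> i * s (i + k))"
      using assms(1) \<alpha> by (intro eq_vecI) auto
    ultimately show "v \<in> span (?c ` {..<r})" by simp
  qed
qed

lemma col_in_col_span_iff:
  assumes "j \<le> n" "r \<le> n + 1"
  shows "col (hankel s n) j \<in> col_span s n r \<longleftrightarrow> (\<exists>\<alpha>. \<forall>k\<le>n. s (j + k) = (\<Sum>i<r. \<alpha> i * s (i + k)))"
  using assms by (subst in_col_span_iff) (simp_all add: hankel_col)

text \<open>Indexed by its size, so that \<open>0\<close>, whose determinant is \<open>1\<close>, behaves like a normal index.\<close>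

definition sq_hankel :: "(nat \<Rightarrow> real) \<Rightarrow> nat \<Rightarrow> real mat" where
  "sq_hankel s m = Matrix.mat m m (\<lambda>(i, j). s (i + j))"

lemma sq_hankel_carrier [simp]: "sq_hankel s m \<in> carrier_mat m m"
  by (simp add: sq_hankel_def)

lemma hankel_eq_sq_hankel: "hankel s k = sq_hankel s (k + 1)"
  by (simp add: hankel_def sq_hankel_def)

lemma det_sq_hankel_eq_0_iff:
  "Determinant.det (sq_hankel s m) = 0 \<longleftrightarrow>
    (\<exists>v. (\<exists>i<m. v i \<noteq> 0) \<and> (\<forall>k<m. (\<Sum>i<m. v i * s (i + k)) = 0))"
proof -
  have idx: "(sq_hankel s m *\<^sub>v w) $ k = (\<Sum>i<m. w $ i * s (i + k))" if "k < m" "w \<in> carrier_vec m" for k w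
    using that by (simp add: sq_hankel_def scalar_prod_def lessThan_atLeast0 mult.commute add.commute)
  show ?thesis
    unfolding det_0_iff_vec_prod_zero_field[OF sq_hankel_carrier]
  proof safe
    fix w assume w: "w \<in> carrier_vec m" "w \<noteq> 0\<^sub>v m" "sq_hankel s m *\<^sub>v w = 0\<^sub>v m"
    have "\<exists>i<m. w $ i \<noteq> 0"
      by (metis carrier_vecD eq_vecI index_zero_vec(1) index_zero_vec(2) w(1) w(2))
    moreover have "\<forall>k<m. (\<Sum>i<m. w $ i * s (i + k)) = 0"
      using idx[OF _ w(1)] w(3) by (metis index_zero_vec(1))
    ultimately show "\<exists>v. (\<exists>i<m. v i \<noteq> 0) \<and> (\<forall>k<m. (\<Sum>i<m. v i * s (i + k)) = 0)" by blast
  next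
    fix v i assume v: "i < m" "v i \<noteq> 0" "\<forall>k<m. (\<Sum>i<m. v i * s (i + k)) = 0"
    let ?w = "Matrix.vec m v"
    have "sq_hankel s m *\<^sub>v ?w = 0\<^sub>v m"
    proof (rule eq_vecI)
      fix k assume "k < dim_vec (0\<^sub>v m :: real Matrix.vec)"
      then have k: "k < m" by simp
      have "(sq_hankel s m *\<^sub>v ?w) $ k = (\<Sum>i<m. v i * s (i + k))"
        using idx[OF k, of ?w] by simp
      then show "(sq_hankel s m *\<^sub>v ?w) $ k = 0\<^sub>v m $ k" using v(3) k by simp
    qed (simp add: sq_hankel_def)
    moreover have "?w \<noteq> 0\<^sub>v m"
      using v by (metis index_vec index_zero_vec(1))
    ultimately show "\<exists>w. w \<in> carrier_vec m \<and> w \<noteq> 0\<^sub>v m \<and> sq_hankel s m *\<^sub>v w = 0\<^sub>v m"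
      by (intro exI[of _ ?w]) auto
  qed
qed

lemma independent_cols_of_det:
  assumes "Determinant.det (sq_hankel s r) \<noteq> 0" "r \<le> n + 1" "j < r"
  shows "col (hankel s n) j \<notin> col_span s n j"
proof
  assume "col (hankel s n) j \<in> col_span s n j"
  moreover have "j \<le> n" "j \<le> n + 1" using assms by auto
  ultimately obtain \<alpha> where \<alpha>: "\<And>k. k \<le> n \<Longrightarrow> s (j + k) = (\<Sum>i<j. \<alpha> i * s (i + k))"
    using col_in_col_span_iff by blast
  define v where "v = (\<lambda>i. if i < j then - \<alpha> i else if i = j then 1 else 0)"
  have "(\<Sum>i<r. v i * s (i + k)) = 0" if "k < r" for k
  proof -
    have "(\<Sum>i<r. v i * s (i + k)) = (\<Sum>i<Suc j. v i * s (i + k))"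
      using assms(3) by (intro sum.mono_neutral_right) (auto simp: v_def)
    also have "\<dots> = - (\<Sum>i<j. \<alpha> i * s (i + k)) + s (j + k)"
      by (simp add: v_def sum_negf)
    finally show ?thesis using \<alpha>[of k] that assms(2) by simp
  qed
  moreover have "v j \<noteq> 0" by (simp add: v_def)
  ultimately show False using assms(1,3) unfolding det_sq_hankel_eq_0_iff by blast
qed

text \<open>Independence is phrased through predecessors, the form that minimality of the Hankel
  rank supplies. The cardinality matters because the rank counts columns as a set, where equal ones
  would collapse.\<close>

lemma independent_cols:
  assumes "r \<le> n + 1" and ind: "\<And>j. j < r \<Longrightarrow> col (hankel s n) j \<notin> col_span s n j"
  shows "\<not> module.lin_dep class_ring (module_vec TYPE(real) (n + 1)) (col (hankel s n) ` {..<r})"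
    and "card (col (hankel s n) ` {..<r}) = r"
proof -
  interpret vec_space "TYPE(real)" "n + 1" .
  let ?c = "col (hankel s n)"
  have cc: "?c ` {..<r} \<subseteq> carrier_vec (n + 1)" for r
    using hankel_col_carrier by blast
  have "lin_indpt (?c ` {..<r}) \<and> card (?c ` {..<r}) = r"
    using assms
  proof (induction r)
    case 0
    have "lin_indpt {}" unfolding lin_dep_def by blast
    then show ?case by simp
  next
    case (Suc r)
    have IH: "lin_indpt (?c ` {..<r})" "card (?c ` {..<r}) = r" using Suc by auto
    have ns: "?c r \<notin> span (?c ` {..<r})" using Suc.prems(2)[of r] by simp
    then have nm: "?c r \<notin> ?c ` {..<r}" using span_mem[OF cc] by blast
    have "?c r \<in> carrier_vec (n + 1)"
    using hankel_col_carrier by blast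
    then have "lin_indpt (?c ` {..<r} \<union> {?c r})"
      using lin_dep_iff_in_span[OF cc IH(1) _ nm] ns by blast
    moreover have "?c ` {..<Suc r} = ?c ` {..<r} \<union> {?c r}" by (auto simp: lessThan_Suc)
    moreover have "card (?c ` {..<r} \<union> {?c r}) = Suc r" using nm IH(2) by simp
    ultimately show ?case by simp
  qed
  then show "lin_indpt (?c ` {..<r})" "card (?c ` {..<r}) = r" by auto
qed

lemma rank_ge_of_independent:
  assumes "r \<le> n + 1" "\<And>j. j < r \<Longrightarrow> col (hankel s n) j \<notin> col_span s n j"
  shows "r \<le> vec_space.rank (n + 1) (hankel s n)"
proof -
  interpret vec_space "TYPE(real)" "n + 1" .
  have "col (hankel s n) ` {..<r} \<subseteq> set (cols (hankel s n))"
    unfolding set_cols_hankel using assms(1) by auto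
  then show ?thesis
    using rank_ge_card_indpt[OF hankel_carrier] independent_cols[OF assms] by metis
qed

lemma cols_in_col_span_of_rank:
  assumes "r \<le> n + 1" "\<And>j. j < r \<Longrightarrow> col (hankel s n) j \<notin> col_span s n j"
    and "vec_space.rank (n + 1) (hankel s n) = r" "j \<le> n"
  shows "col (hankel s n) j \<in> col_span s n r"
proof (rule ccontr)
  interpret vec_space "TYPE(real)" "n + 1" .
  let ?c = "col (hankel s n)"
  have cc: "?c ` {..<r} \<subseteq> carrier_vec (n + 1)"
    using hankel_col_carrier by blast
  assume ns: "?c j \<notin> span (?c ` {..<r})"
  then have nm: "?c j \<notin> ?c ` {..<r}" using span_mem[OF cc] by blast
  have "?c j \<in> carrier_vec (n + 1)"
    using hankel_col_carrier by blast
  then have "lin_indpt (?c ` {..<r} \<union> {?c j})"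
    using lin_dep_iff_in_span[OF cc independent_cols(1)[OF assms(1,2)] _ nm] ns by blast
  moreover have "?c ` {..<r} \<union> {?c j} \<subseteq> set (cols (hankel s n))"
    unfolding set_cols_hankel using assms(1,4) by auto
  ultimately have "card (?c ` {..<r} \<union> {?c j}) \<le> r"
    using rank_ge_card_indpt[OF hankel_carrier] assms(3) by metis
  then show False using nm independent_cols(2)[OF assms(1,2)] by simp
qed

text \<open>The first r columns form a maximal independent subset: adjoining any further column
  makes it dependent.\<close>

lemma rank_of_cols_in_col_span:
  assumes "r \<le> n + 1" "\<And>j. j < r \<Longrightarrow> col (hankel s n) j \<notin> col_span s n j"
    and sp: "\<And>j. j \<le> n \<Longrightarrow> col (hankel s n) j \<in> col_span s n r"
  shows "vec_space.rank (n + 1) (hankel s n) = r"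
proof -
  interpret vec_space "TYPE(real)" "n + 1" .
  let ?c = "col (hankel s n)"
  have cc: "?c ` {..<r} \<subseteq> carrier_vec (n + 1)"
    using hankel_col_carrier by blast
  have cols: "set (cols (hankel s n)) = ?c ` {..n}"
    by (rule set_cols_hankel)
  have "maximal (?c ` {..<r}) (\<lambda>T. T \<subseteq> set (cols (hankel s n)) \<and> lin_indpt T)"
    unfolding maximal_def
  proof (intro conjI allI impI)
    show "?c ` {..<r} \<subseteq> set (cols (hankel s n))" unfolding cols using assms(1) by auto
    show "lin_indpt (?c ` {..<r})" by (rule independent_cols(1)[OF assms(1,2)])
    fix T assume T: "?c ` {..<r} \<subseteq> T \<and> T \<subseteq> set (cols (hankel s n)) \<and> lin_indpt T"
    have "T \<subseteq> ?c ` {..<r}"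
    proof
      fix x assume x: "x \<in> T"
      show "x \<in> ?c ` {..<r}"
      proof (rule ccontr)
        assume nx: "x \<notin> ?c ` {..<r}"
        obtain j where j: "j \<le> n" "x = ?c j" using x T cols by auto
        have xc: "x \<in> carrier_vec (n + 1)" using j hankel_col_carrier by blast
        have "lin_dep (?c ` {..<r} \<union> {x})"
          using lin_dep_iff_in_span[OF cc independent_cols(1)[OF assms(1,2)] xc nx] sp[OF j(1)] j(2) by blast
        then show False using subset_li_is_li[of T "?c ` {..<r} \<union> {x}"] T x by blast
      qed
    qed
    then show "T = ?c ` {..<r}" using T by blast
  qed
  then have "rank (hankel s n) = card (?c ` {..<r})"
    by (rule rank_card_indpt[OF hankel_carrier])
  also have "\<dots> = r" by (rule independent_cols(2)[OF assms(1,2)])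
  finally show ?thesis .
qed

section \<open>Normal indices, monic recursions and the rank condition\<close>

lemma det_last_normal_index: "Determinant.det (sq_hankel s (last_normal_index s n)) \<noteq> 0"
proof (cases "normal_indices s n = {}")
  case True
  then show ?thesis by (simp add: last_normal_index_def sq_hankel_def det_dim_zero)
next
  case False
  have "finite (normal_indices s n)" by (simp add: normal_indices_def)
  then have "last_normal_index s n \<in> normal_indices s n"
    using False by (simp add: last_normal_index_def)
  then show ?thesis
    by (cases "last_normal_index s n") (simp_all add: normal_indices_def hankel_eq_sq_hankel)
qed

lemma last_normal_index_le: "last_normal_index s n \<le> n + 1"
proof (cases "normal_indices s n = {}")
  case False
  have "finite (normal_indices s n)" by (simp add: normal_indices_def)
  then have "last_normal_index s n \<in> normal_indices s n"
    using False by (simp add: last_normal_index_def)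
  then show ?thesis by (simp add: normal_indices_def)
qed (simp add: last_normal_index_def)

lemma last_normal_index_ge:
  assumes "Determinant.det (sq_hankel s m) \<noteq> 0" "m \<le> n + 1"
  shows "m \<le> last_normal_index s n"
proof (cases "m = 0")
  case False
  have "finite (normal_indices s n)" by (simp add: normal_indices_def)
  moreover have "m \<in> normal_indices s n"
    using False assms by (simp add: normal_indices_def hankel_eq_sq_hankel)
  ultimately show ?thesis by (auto simp: last_normal_index_def)
qed simp

text \<open>The coefficients \<open>u\<close> are those of the monic characteristic polynomial, so \<open>u\<^sub>i = - \<alpha>\<^sub>i\<close> for
  \<open>i < r\<close>.\<close>

definition recursion :: "(nat \<Rightarrow> real) \<Rightarrow> nat \<Rightarrow> nat \<Rightarrow> (nat \<Rightarrow> real) \<Rightarrow> bool" where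
  "recursion s n r u \<longleftrightarrow> r \<le> n \<and> Determinant.det (sq_hankel s r) \<noteq> 0 \<and> u r = 1 \<and>
     (\<forall>k. k + r \<le> 2 * n \<longrightarrow> (\<Sum>i\<le>r. u i * s (i + k)) = 0)"

text \<open>\<open>P\<close> is the range of validity: k \<le> n for a relation of columns, k + r
  \<le> 2 n for a full recursion.\<close>

lemma monic_of_dependent:
  fixes s :: "nat \<Rightarrow> real"
  assumes "\<And>k. P k \<Longrightarrow> s (r + k) = (\<Sum>i<r. \<alpha> i * s (i + k))"
  obtains u where "u r = 1" "\<And>k. P k \<Longrightarrow> (\<Sum>i\<le>r. u i * s (i + k)) = 0"
proof
  let ?u = "\<lambda>i. if i = r then 1 else - \<alpha> i"
  show "(\<Sum>i\<le>r. ?u i * s (i + k)) = 0" if "P k" for k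
    using assms[OF that] by (simp add: lessThan_Suc_atMost[symmetric] sum_negf)
qed simp

text \<open>The minimum in the definition of the Hankel rank exists: n + 1 columns, each outside the
  span of its predecessors, would give full rank.\<close>

lemma hankel_rank_degenerate:
  assumes "Determinant.det (hankel s n) = 0"
  obtains u where "hankel_rank s n \<le> n" "u (hankel_rank s n) = 1"
    "\<And>k. k \<le> n \<Longrightarrow> (\<Sum>i\<le>hankel_rank s n. u i * s (i + k)) = 0"
    "\<And>j. j < hankel_rank s n \<Longrightarrow> col (hankel s n) j \<notin> col_span s n j"
proof -
  define Q where "Q = (\<lambda>r. r \<le> n \<and> col (hankel s n) r \<in> col_span s n r)"
  have rk: "hankel_rank s n = (LEAST r. Q r)"
    using assms by (simp add: hankel_rank_def Q_def)
  have "\<exists>r. Q r"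
  proof (rule ccontr)
    assume "\<nexists>r. Q r"
    then have "n + 1 \<le> vec_space.rank (n + 1) (hankel s n)"
      by (intro rank_ge_of_independent) (auto simp: Q_def)
    then show False using vec_space.det_zero_low_rank[OF hankel_carrier assms] by simp
  qed
  then have Q: "Q (hankel_rank s n)" unfolding rk by (rule LeastI_ex)
  let ?r = "hankel_rank s n"
  have min: "col (hankel s n) j \<notin> col_span s n j" if "j < ?r" for j
    using not_less_Least[OF that[unfolded rk]] that Q by (auto simp: Q_def)
  from Q have r: "?r \<le> n" "col (hankel s n) ?r \<in> col_span s n ?r" by (auto simp: Q_def)
  then obtain \<alpha> where \<alpha>: "\<And>k. k \<le> n \<Longrightarrow> s (?r + k) = (\<Sum>i<?r. \<alpha> i * s (i + k))"
    using col_in_col_span_iff[of ?r n ?r s] by auto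
  then obtain u where "u ?r = 1" "\<And>k. k \<le> n \<Longrightarrow> (\<Sum>i\<le>?r. u i * s (i + k)) = 0"
    using monic_of_dependent[of "\<lambda>k. k \<le> n" s ?r \<alpha>] by blast
  then show ?thesis using that r min by blast
qed

text \<open>A kernel vector of \<open>sq_hankel s r\<close> is a relation of the first r columns in
  rows k < r. The recursion expresses each later row through the r preceding ones, so the relation
  extends to all n + 1 rows, and its last nonzero coefficient puts a column into the span of its
  predecessors.\<close>

lemma det_of_recursion:
  fixes u s :: "nat \<Rightarrow> real"
  assumes "r \<le> n" "u r = 1" and rec: "\<And>k. k + r \<le> 2 * n \<Longrightarrow> (\<Sum>i\<le>r. u i * s (i + k)) = 0"
    and ind: "\<And>j. j < r \<Longrightarrow> col (hankel s n) j \<notin> col_span s n j"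
  shows "Determinant.det (sq_hankel s r) \<noteq> 0"
proof
  assume "Determinant.det (sq_hankel s r) = 0"
  then obtain v where v: "\<exists>i<r. v i \<noteq> 0" "\<And>k. k < r \<Longrightarrow> (\<Sum>i<r. v i * s (i + k)) = 0"
    unfolding det_sq_hankel_eq_0_iff by blast
  have all: "(\<Sum>i<r. v i * s (i + k)) = 0" if "k \<le> n" for k
    using that
  proof (induction k rule: less_induct)
    case (less k)
    show ?case
    proof (cases "k < r")
      case False
      have "s (i + k) = - (\<Sum>l<r. u l * s (l + (i + k - r)))" if "i < r" for i
        using rec[of "i + k - r"] False that less.prems assms(1,2)
        by (simp add: lessThan_Suc_atMost[symmetric])
      then have "(\<Sum>i<r. v i * s (i + k)) = (\<Sum>i<r. \<Sum>l<r. - (u l * (v i * s (i + (l + k - r)))))"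
        using False by (intro sum.cong refl) (simp add: sum_distrib_left sum_negf mult_ac add_ac)
      also have "\<dots> = (\<Sum>l<r. - (u l * (\<Sum>i<r. v i * s (i + (l + k - r)))))"
        by (subst sum.swap) (simp add: sum_distrib_left sum_negf)
      also have "\<dots> = 0"
      proof (intro sum.neutral ballI)
        fix l assume "l \<in> {..<r}"
        then have "l + k - r < k" "l + k - r \<le> n" using False less.prems by auto
        from less.IH[OF this] show "- (u l * (\<Sum>i<r. v i * s (i + (l + k - r)))) = 0"
          by (simp only: mult_zero_right minus_zero)
      qed
      finally show ?thesis .
    qed (use v in simp)
  qed
  define m where "m = Max {i. i < r \<and> v i \<noteq> 0}"
  have ne: "{i. i < r \<and> v i \<noteq> 0} \<noteq> {}" using v(1) by auto
  have m: "m < r" "v m \<noteq> 0" using Max_in[OF _ ne] by (auto simp: m_def)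
  have gt: "v i = 0" if "m < i" "i < r" for i
  proof (rule ccontr)
    assume "v i \<noteq> 0"
    then have "i \<le> m" unfolding m_def using that(2) by (intro Max_ge) auto
    then show False using that(1) by simp
  qed
  have "s (m + k) = (\<Sum>i<m. (- v i / v m) * s (i + k))" if "k \<le> n" for k
  proof -
    have "0 = (\<Sum>i<r. v i * s (i + k))" using all[OF that] by simp
    also have "\<dots> = (\<Sum>i<Suc m. v i * s (i + k))"
      using m(1) gt by (intro sum.mono_neutral_right) auto
    finally have "v m * s (m + k) = - (\<Sum>i<m. v i * s (i + k))" by simp
    then have "s (m + k) = - (\<Sum>i<m. v i * s (i + k)) / v m"
      using m(2) by (simp add: field_simps)
    then show ?thesis by (simp add: sum_divide_distrib sum_negf)
  qed
  then have "\<exists>\<alpha>. \<forall>k\<le>n. s (m + k) = (\<Sum>i<m. \<alpha> i * s (i + k))"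
    by (intro exI[of _ "\<lambda>i. - v i / v m"]) blast
  moreover have "m \<le> n" "m \<le> n + 1" using m(1) assms(1) by auto
  ultimately have "col (hankel s n) m \<in> col_span s n m"
    using col_in_col_span_iff by blast
  then show False using ind m(1) by blast
qed

lemma recursion_cols:
  assumes "recursion s n r u" "j \<le> n"
  shows "col (hankel s n) j \<in> col_span s n r"
proof -
  have r: "r \<le> n" "u r = 1" and rec: "\<And>k. k + r \<le> 2 * n \<Longrightarrow> (\<Sum>i\<le>r. u i * s (i + k)) = 0"
    using assms(1) by (auto simp: recursion_def)
  have "\<exists>\<alpha>. \<forall>k\<le>n. s (j + k) = (\<Sum>i<r. \<alpha> i * s (i + k))"
    using assms(2)
  proof (induction j rule: less_induct)
    case (less j)
    show ?case
    proof (cases "j < r")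
      case True
      have "s (j + k) = (\<Sum>i<r. (if i = j then 1 else 0) * s (i + k))" for k
      proof -
        have "(\<Sum>i<r. (if i = j then 1 else 0) * s (i + k)) = (\<Sum>i<r. if i = j then s (j + k) else 0)"
          by (intro sum.cong) auto
        then show ?thesis using True by simp
      qed
      then show ?thesis by (intro exI[of _ "\<lambda>i. if i = j then 1 else 0"]) blast
    next
      case False
      have "\<forall>l\<in>{..<r}. \<exists>\<alpha>. \<forall>k\<le>n. s (l + (j - r) + k) = (\<Sum>i<r. \<alpha> i * s (i + k))"
      proof
        fix l assume "l \<in> {..<r}"
        then have "l + (j - r) < j" "l + (j - r) \<le> n" using False less.prems by auto
        then show "\<exists>\<alpha>. \<forall>k\<le>n. s (l + (j - r) + k) = (\<Sum>i<r. \<alpha> i * s (i + k))"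
          by (rule less.IH)
      qed
      then obtain \<alpha> where \<alpha>: "\<And>l k. l < r \<Longrightarrow> k \<le> n \<Longrightarrow> s (l + (j - r) + k) = (\<Sum>i<r. \<alpha> l i * s (i + k))"
        by (metis lessThan_iff)
      have "s (j + k) = (\<Sum>i<r. (\<Sum>l<r. - u l * \<alpha> l i) * s (i + k))" if k: "k \<le> n" for k
      proof -
        have "s (j + k) = - (\<Sum>l<r. u l * s (l + (j - r) + k))"
          using rec[of "j - r + k"] r False k less.prems
          by (simp add: lessThan_Suc_atMost[symmetric] add.assoc)
        also have "\<dots> = (\<Sum>l<r. \<Sum>i<r. - u l * \<alpha> l i * s (i + k))"
          using k by (simp add: \<alpha> sum_distrib_left sum_negf mult.assoc)
        also have "\<dots> = (\<Sum>i<r. \<Sum>l<r. - u l * \<alpha> l i * s (i + k))" by (rule sum.swap)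
        finally show ?thesis by (simp add: sum_distrib_right)
      qed
      then show ?thesis by (intro exI[of _ "\<lambda>i. \<Sum>l<r. - u l * \<alpha> l i"]) blast
    qed
  qed
  then show ?thesis using assms(2) r by (subst col_in_col_span_iff) auto
qed

text \<open>A nonzero leading minor of size m makes the first m columns independent, so the last
  normal index is at most the rank, which the recursion pins to r; conversely the minor of size r is
  nonzero.\<close>

lemma recursion_rank:
  assumes "recursion s n r u"
  shows "vec_space.rank (n + 1) (hankel s n) = r" "last_normal_index s n = r"
proof -
  have r: "r \<le> n + 1" "Determinant.det (sq_hankel s r) \<noteq> 0" using assms by (auto simp: recursion_def)
  show rk: "vec_space.rank (n + 1) (hankel s n) = r"
    by (rule rank_of_cols_in_col_span[OF r(1) independent_cols_of_det[OF r(2,1)] recursion_cols[OF assms]])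
  have "last_normal_index s n \<le> vec_space.rank (n + 1) (hankel s n)"
    by (rule rank_ge_of_independent[OF last_normal_index_le
          independent_cols_of_det[OF det_last_normal_index last_normal_index_le]])
  then show "last_normal_index s n = r"
    using last_normal_index_ge[OF r(2,1)] rk by simp
qed

lemma recursively_generated_of_recursion:
  assumes "recursion s n r u" and deg: "Determinant.det (hankel s n) = 0"
  shows "recursively_generated s n"
proof -
  have r: "r \<le> n" "Determinant.det (sq_hankel s r) \<noteq> 0" "u r = 1"
    and rec: "\<And>k. k + r \<le> 2 * n \<Longrightarrow> (\<Sum>i\<le>r. u i * s (i + k)) = 0"
    using assms(1) by (auto simp: recursion_def)
  have "hankel_rank s n = (LEAST r. r \<le> n \<and> col (hankel s n) r \<in> col_span s n r)"
    using deg by (simp add: hankel_rank_def)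
  also have "\<dots> = r"
  proof (rule Least_equality)
    show "r \<le> n \<and> col (hankel s n) r \<in> col_span s n r"
      using r(1) recursion_cols[OF assms(1) r(1)] by blast
    fix j assume "j \<le> n \<and> col (hankel s n) j \<in> col_span s n j"
    then show "r \<le> j"
      using independent_cols_of_det[OF r(2), of n j] r(1) by (cases "j < r") auto
  qed
  finally have eq: "hankel_rank s n = r" .
  have "s j = (\<Sum>i<r. - u i * s (j - r + i))" if "r \<le> j" "j \<le> 2 * n" for j
    using rec[of "j - r"] that r(3) by (simp add: lessThan_Suc_atMost[symmetric] sum_negf add.commute)
  then show ?thesis unfolding recursively_generated_def eq Let_def
    by (intro exI[of _ "\<lambda>i. - u i"]) blast
qed

lemma recursion_of_recursively_generated:
  assumes "recursively_generated s n" and deg: "Determinant.det (hankel s n) = 0"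
  shows "\<exists>r u. recursion s n r u"
proof -
  let ?r = "hankel_rank s n"
  from hankel_rank_degenerate[OF deg] have r: "?r \<le> n"
    and min: "\<And>j. j < ?r \<Longrightarrow> col (hankel s n) j \<notin> col_span s n j" by metis+
  obtain \<alpha> where \<alpha>: "\<And>j. ?r \<le> j \<Longrightarrow> j \<le> 2 * n \<Longrightarrow> s j = (\<Sum>i<?r. \<alpha> i * s (j - ?r + i))"
    using assms(1) unfolding recursively_generated_def Let_def by blast
  have "s (?r + k) = (\<Sum>i<?r. \<alpha> i * s (i + k))" if "k + ?r \<le> 2 * n" for k
    using \<alpha>[of "?r + k"] that by (simp add: add.commute)
  then obtain u where u: "u ?r = 1" "\<And>k. k + ?r \<le> 2 * n \<Longrightarrow> (\<Sum>i\<le>?r. u i * s (i + k)) = 0"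
    using monic_of_dependent[of "\<lambda>k. k + ?r \<le> 2 * n" s ?r \<alpha>] by blast
  have "Determinant.det (sq_hankel s ?r) \<noteq> 0"
    by (rule det_of_recursion[where u = u, OF r u(1) u(2) min])
  then show ?thesis using r u unfolding recursion_def by blast
qed

text \<open>Rank r gives a relation among columns, valid in rows k \<le> n only. Its shift by one
  column is a combination \<open>g\<close> of the first r columns; by the unshifted relation it
  vanishes in rows k < r, and the nonzero minor forces \<open>g\<close> = 0. Iterated shifts produce
  the whole recursion.\<close>

lemma recursion_of_rank:
  assumes rk: "vec_space.rank (n + 1) (hankel s n) = last_normal_index s n"
    and deg: "Determinant.det (hankel s n) = 0"
  shows "\<exists>r u. recursion s n r u"
proof -
  define r where "r = last_normal_index s n"
  have d: "Determinant.det (sq_hankel s r) \<noteq> 0" unfolding r_def by (rule det_last_normal_index)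
  have rn: "r \<le> n"
    using d deg last_normal_index_le[of s n] unfolding hankel_eq_sq_hankel r_def[symmetric]
    by (cases "r = n + 1") auto
  have sp: "col (hankel s n) j \<in> col_span s n r" if "j \<le> n" for j
    using rk rn that
    by (intro cols_in_col_span_of_rank independent_cols_of_det[OF d]) (auto simp: r_def)
  have "\<forall>j\<in>{..n}. \<exists>\<alpha>. \<forall>k\<le>n. s (j + k) = (\<Sum>i<r. \<alpha> i * s (i + k))"
    using sp col_in_col_span_iff[of _ n r s] rn by auto
  then obtain \<alpha> where \<alpha>: "\<And>j k. j \<le> n \<Longrightarrow> k \<le> n \<Longrightarrow> s (j + k) = (\<Sum>i<r. \<alpha> j i * s (i + k))"
    by (metis atMost_iff)
  obtain u where u: "u r = 1" "\<And>k. k \<le> n \<Longrightarrow> (\<Sum>i\<le>r. u i * s (i + k)) = 0"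
    using monic_of_dependent[of "\<lambda>k. k \<le> n" s r "\<alpha> r"] \<alpha>[OF rn] by blast
  have shift: "\<forall>k\<le>n. (\<Sum>i\<le>r. u i * s (i + t + k)) = 0" if "t + r \<le> n" for t
    using that
  proof (induction t)
    case (Suc t)
    define g where "g = (\<lambda>i. \<Sum>j\<le>r. u j * \<alpha> (j + Suc t) i)"
    have g: "(\<Sum>j\<le>r. u j * s (j + Suc t + k)) = (\<Sum>i<r. g i * s (i + k))" if "k \<le> n" for k
    proof -
      have "(\<Sum>j\<le>r. u j * s (j + Suc t + k)) = (\<Sum>j\<le>r. \<Sum>i<r. u j * \<alpha> (j + Suc t) i * s (i + k))"
      proof (intro sum.cong refl)
        fix j assume "j \<in> {..r}"
        then have "j + Suc t \<le> n" using Suc.prems by simp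
        from \<alpha>[OF this that]
        show "u j * s (j + Suc t + k) = (\<Sum>i<r. u j * \<alpha> (j + Suc t) i * s (i + k))"
          by (simp only: sum_distrib_left mult.assoc)
      qed
      also have "\<dots> = (\<Sum>i<r. \<Sum>j\<le>r. u j * \<alpha> (j + Suc t) i * s (i + k))" by (rule sum.swap)
      finally show ?thesis by (simp add: g_def sum_distrib_right)
    qed
    have "(\<Sum>i<r. g i * s (i + k)) = 0" if "k < r" for k
    proof -
      have "\<forall>k\<le>n. (\<Sum>j\<le>r. u j * s (j + t + k)) = 0" using Suc by simp
      moreover have "Suc k \<le> n" using that rn by simp
      ultimately have "(\<Sum>j\<le>r. u j * s (j + t + Suc k)) = 0" by blast
      then show ?thesis using g[of k] that rn by simp
    qed
    then have "g i = 0" if "i < r" for i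
      using d that unfolding det_sq_hankel_eq_0_iff by blast
    then show ?case using g by simp
  qed (use u in simp)
  have "(\<Sum>i\<le>r. u i * s (i + k)) = 0" if k: "k + r \<le> 2 * n" for k
  proof (cases "k \<le> n - r")
    case True
    then have "(\<Sum>i\<le>r. u i * s (i + k + 0)) = 0" using shift[of k] rn by force
    then show ?thesis by simp
  next
    case False
    have "(\<Sum>i\<le>r. u i * s (i + (n - r) + (k - (n - r)))) = 0"
      using shift[of "n - r"] rn k by force
    then show ?thesis using False by simp
  qed
  then show ?thesis using rn d u(1) unfolding recursion_def by blast
qed

section \<open>Expansions at infinity\<close>

text \<open>The value is \<open>z\<^sup>m (f + s\<^sub>0 / z + \<dots> + s\<^sub>m\<^sub>-\<^sub>1 / z\<^sup>m)\<close>, the rescaled remainder of the expansion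
  of \<open>f\<close> at infinity.\<close>

primrec tail :: "(nat \<Rightarrow> complex) \<Rightarrow> complex \<Rightarrow> complex \<Rightarrow> nat \<Rightarrow> complex" where
  "tail s f z 0 = f"
| "tail s f z (Suc m) = z * tail s f z m + s m"

text \<open>The coefficients in \<open>t\<close> of \<open>(U(t) - U(z)) / (t - z)\<close>, for the polynomial \<open>U\<close> with coefficients
  \<open>u\<close>; consequently \<open>qeval\<close> is its polynomial of the second kind.\<close>

definition quot :: "(nat \<Rightarrow> complex) \<Rightarrow> nat \<Rightarrow> complex \<Rightarrow> nat \<Rightarrow> complex" where
  "quot u r z i = (\<Sum>a<r - i. u (a + i + 1) * z ^ a)"

definition peval :: "(nat \<Rightarrow> complex) \<Rightarrow> nat \<Rightarrow> complex \<Rightarrow> complex" where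
  "peval u r z = (\<Sum>a\<le>r. u a * z ^ a)"

definition qeval :: "(nat \<Rightarrow> complex) \<Rightarrow> (nat \<Rightarrow> complex) \<Rightarrow> nat \<Rightarrow> complex \<Rightarrow> complex" where
  "qeval u s r z = (\<Sum>i<r. quot u r z i * s i)"

lemma quot_rec: "i < r \<Longrightarrow> quot u r z i = u (i + 1) + z * quot u r z (i + 1)"
proof -
  assume "i < r"
  then obtain k where k: "r - i = Suc k" "r - (i + 1) = k" by (metis Suc_diff_Suc Suc_eq_plus1)
  show ?thesis
    unfolding quot_def k by (simp add: sum.lessThan_Suc_shift sum_distrib_left mult_ac del: sum.lessThan_Suc)
qed

lemma quot_top [simp]: "quot u r z r = 0"
  by (simp add: quot_def)

lemma peval_quot: "peval u r z = u 0 + z * quot u r z 0"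
  unfolding peval_def quot_def lessThan_Suc_atMost[symmetric]
  by (simp add: sum.lessThan_Suc_shift sum_distrib_left mult_ac del: sum.lessThan_Suc)

text \<open>This is the linear functional t^j -> \<open>g j\<close> applied to (t - z) D(t) = U(t) -
  U(z), where D has the coefficients \<open>quot u r z\<close>.\<close>

lemma quot_shift:
  "(\<Sum>j<r. z * quot u r z j * g j) =
    peval u r z * g 0 + (\<Sum>j<r. quot u r z j * g (j + 1)) - (\<Sum>j\<le>r. u j * g j)"
proof -
  have "(\<Sum>j<r. z * quot u r z j * g j) = (\<Sum>j<Suc r. z * quot u r z j * g j)" by simp
  also have "\<dots> = z * quot u r z 0 * g 0 + (\<Sum>j<r. z * quot u r z (j + 1) * g (j + 1))"
    by (simp add: sum.lessThan_Suc_shift del: sum.lessThan_Suc)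
  also have "(\<Sum>j<r. z * quot u r z (j + 1) * g (j + 1)) = (\<Sum>j<r. quot u r z j * g (j + 1) - u (j + 1) * g (j + 1))"
    by (intro sum.cong refl) (simp add: quot_rec algebra_simps)
  also have "(\<Sum>j\<le>r. u j * g j) = u 0 * g 0 + (\<Sum>j<r. u (j + 1) * g (j + 1))"
    unfolding lessThan_Suc_atMost[symmetric] by (simp add: sum.lessThan_Suc_shift del: sum.lessThan_Suc)
  ultimately show ?thesis
    by (simp add: peval_quot sum_subtractf algebra_simps)
qed

text \<open>Formally \<open>tail s f z j\<close> is the moment of t^j / (t - z), so the left side is
  the moment of U(t) / (t - z) = U(z) / (t - z) + D(t).\<close>

lemma sum_tail: "(\<Sum>j\<le>r. u j * tail s f z j) = f * peval u r z + qeval u s r z"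
proof -
  have "(\<Sum>j<r. z * quot u r z j * tail s f z j) = (\<Sum>j<r. quot u r z j * tail s f z (j + 1)) - qeval u s r z"
    unfolding qeval_def sum_subtractf[symmetric] by (intro sum.cong refl) (simp add: algebra_simps)
  then show ?thesis using quot_shift[of z u r "tail s f z"] by (simp add: algebra_simps)
qed

lemma sum_tail_shift_Suc:
  "(\<Sum>a\<le>r. u a * tail s f z (a + Suc k)) = z * (\<Sum>a\<le>r. u a * tail s f z (a + k)) + (\<Sum>a\<le>r. u a * s (a + k))"
  by (simp add: sum_distrib_left sum.distrib algebra_simps)

lemma sum_tail_shift:
  assumes "f * peval u r z + qeval u s r z = 0" "\<And>j. j < k \<Longrightarrow> (\<Sum>a\<le>r. u a * s (a + j)) = 0"
  shows "(\<Sum>a\<le>r. u a * tail s f z (a + k)) = 0"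
  using assms(2)
proof (induction k)
  case 0
  then show ?case using assms(1) sum_tail[of u s f z r] by simp
next
  case (Suc k)
  then show ?case by (simp only: sum_tail_shift_Suc) simp
qed

lemma tail_expand:
  assumes "z \<noteq> 0"
  shows "tail s f z m = tail s f z (m + i) / z ^ i - (\<Sum>l<i. s (m + l) / z ^ (l + 1))"
proof (induction i)
  case (Suc i)
  have "tail s f z (m + Suc i) / z ^ Suc i = tail s f z (m + i) / z ^ i + s (m + i) / z ^ (i + 1)"
    using assms by (simp add: field_simps)
  then show ?case using Suc by simp
qed simp

lemma tail_cnj: "cnj (tail s f z m) = tail (\<lambda>i. cnj (s i)) (cnj f) (cnj z) m"
  by (induction m) auto

text \<open>Once the earlier relations hold, the combination of tails shifted by k is 0 and the one
  shifted by k + 1 equals the constant in question; the latter also tends to 0, as its tails have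
  index at most M + 1.\<close>

lemma recursion_of_tail:
  assumes F: "F \<noteq> bot" and zero: "\<forall>\<^sub>F y in F. f y * peval u r (\<zeta> y) + qeval u s r (\<zeta> y) = 0"
    and lim: "\<And>m. m \<le> M \<Longrightarrow> ((\<lambda>y. tail s (f y) (\<zeta> y) (Suc m)) \<longlongrightarrow> 0) F"
    and k: "k + r \<le> M"
  shows "(\<Sum>a\<le>r. u a * s (a + k)) = 0"
  using k
proof (induction k rule: less_induct)
  case (less k)
  have "\<forall>\<^sub>F y in F. (\<Sum>a\<le>r. u a * tail s (f y) (\<zeta> y) (a + Suc k)) = (\<Sum>a\<le>r. u a * s (a + k))"
    using zero
  proof eventually_elim
    case (elim y)
    have "(\<Sum>a\<le>r. u a * tail s (f y) (\<zeta> y) (a + k)) = 0"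
      by (rule sum_tail_shift[OF elim]) (use less in auto)
    then show ?case by (simp only: sum_tail_shift_Suc) simp
  qed
  moreover have "((\<lambda>y. \<Sum>a\<le>r. u a * tail s (f y) (\<zeta> y) (a + Suc k)) \<longlongrightarrow> (\<Sum>a\<le>r. u a * 0)) F"
    using less.prems lim by (intro tendsto_intros) simp
  ultimately have "((\<lambda>y. \<Sum>a\<le>r. u a * s (a + k)) \<longlongrightarrow> 0) F"
    by (simp add: tendsto_cong)
  then show ?case using tendsto_unique[OF F, of "\<lambda>y. \<Sum>a\<le>r. u a * s (a + k)"] by (metis tendsto_const)
qed

text \<open>By the recursion, \<open>\<Sum> u\<^sub>a T\<^sub>k\<^sub>+\<^sub>a = 0\<close> for the tails \<open>T\<close>. Expressing all of them through
  \<open>T\<^sub>k\<^sub>+\<^sub>r\<close> turns this into \<open>T\<^sub>k\<^sub>+\<^sub>r D = E\<close> with \<open>D \<rightarrow> 1\<close> and \<open>E \<rightarrow> 0\<close>.\<close>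

lemma tail_tendsto_0:
  assumes "u r = 1" and zero: "\<forall>\<^sub>F z in at_infinity. f z * peval u r z + qeval u s r z = 0"
    and rec: "\<And>j. j < k \<Longrightarrow> (\<Sum>a\<le>r. u a * s (a + j)) = 0"
  shows "((\<lambda>z. tail s (f z) z (k + r)) \<longlongrightarrow> 0) at_infinity"
proof -
  define D where "D = (\<lambda>z :: complex. \<Sum>a\<le>r. u a * (1 / z ^ (r - a)))"
  define E where "E = (\<lambda>z :: complex. \<Sum>a\<le>r. u a * (\<Sum>l<r - a. s (a + k + l) * (1 / z ^ (l + 1))))"
  have inv: "((\<lambda>z :: complex. 1 / z ^ (m + 1)) \<longlongrightarrow> 0) at_infinity" for m
    by (intro tendsto_divide_0[OF tendsto_const] filterlim_power_at_infinity filterlim_ident) auto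
  have "(D \<longlongrightarrow> (\<Sum>a\<le>r. u a * (if a = r then 1 else 0))) at_infinity"
    unfolding D_def
  proof (intro tendsto_sum tendsto_mult tendsto_const)
    fix a assume "a \<in> {..r}"
    show "((\<lambda>z :: complex. 1 / z ^ (r - a)) \<longlongrightarrow> (if a = r then 1 else 0)) at_infinity"
    proof (cases "a = r")
      case False
      then have "r - a - 1 + 1 = r - a" using \<open>a \<in> {..r}\<close> by simp
      then show ?thesis using inv[of "r - a - 1"] False by (simp only: if_False)
    qed simp
  qed
  moreover have "(\<Sum>a\<le>r. u a * (if a = r then 1 else 0)) = (\<Sum>a\<le>r. if a = r then u r else 0)"
    by (intro sum.cong) auto
  ultimately have D: "(D \<longlongrightarrow> 1) at_infinity" using assms(1) by simp
  have "(E \<longlongrightarrow> (\<Sum>a\<le>r. u a * (\<Sum>l<r - a. s (a + k + l) * 0))) at_infinity"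
    unfolding E_def by (intro tendsto_intros inv)
  then have E: "(E \<longlongrightarrow> 0) at_infinity" by simp
  have "((\<lambda>z. E z / D z) \<longlongrightarrow> 0 / 1) at_infinity"
    by (intro tendsto_divide D E) simp
  moreover have "\<forall>\<^sub>F z in at_infinity. E z / D z = tail s (f z) z (k + r)"
    using zero tendsto_imp_eventually_ne[OF D one_neq_zero] eventually_not_equal_at_infinity[of "0 :: complex"]
  proof eventually_elim
    case (elim z)
    have "0 = (\<Sum>a\<le>r. u a * tail s (f z) z (a + k))"
      using sum_tail_shift[OF elim(1)] rec by simp
    also have "\<dots> = (\<Sum>a\<le>r. u a * (tail s (f z) z (k + r) * (1 / z ^ (r - a))
        - (\<Sum>l<r - a. s (a + k + l) * (1 / z ^ (l + 1)))))"
    proof (intro sum.cong refl arg_cong2[of _ _ _ _ "(*)"])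
      fix a assume "a \<in> {..r}"
      then have "a + k + (r - a) = k + r" by simp
      then show "tail s (f z) z (a + k) = tail s (f z) z (k + r) * (1 / z ^ (r - a))
        - (\<Sum>l<r - a. s (a + k + l) * (1 / z ^ (l + 1)))"
        using tail_expand[of z s "f z" "a + k" "r - a"] elim(3) by simp
    qed
    also have "\<dots> = tail s (f z) z (k + r) * D z - E z"
      unfolding D_def E_def by (simp add: right_diff_distrib sum_subtractf sum_distrib_left mult_ac)
    finally show ?case using elim(2) by (simp add: field_simps)
  qed
  ultimately show ?thesis by (simp add: tendsto_cong)
qed

text \<open>A Christoffel-Darboux identity. With L(t^j) = \<open>s j\<close> and D_z(t) = (U(t) -
  U(z)) / (t - z), the double sum is L(D_z D_w), and (z - w) D_z D_w = D_z (U(t) - U(w)) - D_w (U(t)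
  - U(z)). The recursion makes L vanish on U times polynomials of degree below r.\<close>

lemma quot_bezout:
  assumes rec: "\<And>k. k < r \<Longrightarrow> (\<Sum>j\<le>r. u j * s (j + k)) = 0"
  shows "(z - w) * (\<Sum>j<r. (\<Sum>i<r. quot u r z i * s (i + j)) * quot u r w j)
    = qeval u s r w * peval u r z - qeval u s r z * peval u r w"
proof -
  define G where "G = (\<lambda>j. \<Sum>i<r. quot u r z i * s (i + j))"
  have G: "z * G j = peval u r z * s j + G (j + 1)" if "j < r" for j
    using quot_shift[of z u r "\<lambda>i. s (i + j)"] rec[OF that]
    by (simp add: G_def sum_distrib_left mult.assoc)
  have uG: "(\<Sum>j\<le>r. u j * G j) = 0"
  proof -
    have "(\<Sum>j\<le>r. u j * G j) = (\<Sum>i<r. \<Sum>j\<le>r. u j * (quot u r z i * s (i + j)))"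
      unfolding G_def sum_distrib_left by (rule sum.swap)
    also have "\<dots> = (\<Sum>i<r. quot u r z i * (\<Sum>j\<le>r. u j * s (j + i)))"
      by (simp add: sum_distrib_left mult_ac add.commute)
    finally show ?thesis using rec by simp
  qed
  have "z * (\<Sum>j<r. G j * quot u r w j) = (\<Sum>j<r. z * G j * quot u r w j)"
    by (simp add: sum_distrib_left mult.assoc)
  also have "\<dots> = (\<Sum>j<r. peval u r z * (quot u r w j * s j) + quot u r w j * G (j + 1))"
    by (intro sum.cong refl) (simp add: G algebra_simps)
  also have "\<dots> = peval u r z * qeval u s r w + (\<Sum>j<r. quot u r w j * G (j + 1))"
    by (simp add: sum.distrib qeval_def sum_distrib_left)
  finally have 1: "z * (\<Sum>j<r. G j * quot u r w j) =
      peval u r z * qeval u s r w + (\<Sum>j<r. quot u r w j * G (j + 1))" .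
  have "w * (\<Sum>j<r. G j * quot u r w j) = (\<Sum>j<r. w * quot u r w j * G j)"
    by (simp add: sum_distrib_left mult_ac)
  also have "\<dots> = peval u r w * G 0 + (\<Sum>j<r. quot u r w j * G (j + 1))"
    unfolding quot_shift uG by simp
  also have "G 0 = qeval u s r z" by (simp add: G_def qeval_def)
  finally have 2: "w * (\<Sum>j<r. G j * quot u r w j) =
      peval u r w * qeval u s r z + (\<Sum>j<r. quot u r w j * G (j + 1))" .
  have Gj: "(\<Sum>i<r. quot u r z i * s (i + j)) = G j" for j by (simp add: G_def)
  show ?thesis unfolding Gj left_diff_distrib 1 2 by (simp add: mult.commute)
qed

text \<open>At a zero of U one has U(t) = (t - z) D(t), and U is orthogonal to t^k, so t^(k+1) D and
  z t^k D have the same moment. The first of these moments is the value of the second-kind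
  polynomial. This serves to show that the two polynomials have no common zero.\<close>

lemma common_zero_kernel:
  assumes rec: "\<And>k. k < r \<Longrightarrow> (\<Sum>j\<le>r. u j * s (j + k)) = 0"
    and zero: "peval u r z = 0" "qeval u s r z = 0" and "k < r"
  shows "(\<Sum>i<r. quot u r z i * s (i + k)) = 0"
  using assms(4)
proof (induction k)
  case 0
  then show ?case using zero by (simp add: qeval_def)
next
  case (Suc k)
  then have "z * (\<Sum>i<r. quot u r z i * s (i + k)) = 0" by simp
  moreover have "z * (\<Sum>i<r. quot u r z i * s (i + k)) = (\<Sum>i<r. quot u r z i * s (i + Suc k))"
    using quot_shift[of z u r "\<lambda>i. s (i + k)"] rec[of k] Suc.prems zero
    by (simp add: sum_distrib_left mult.assoc)
  ultimately show ?case by simp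
qed

section \<open>Kernel matrices at points going to infinity\<close>

text \<open>Formally the moment of t^m / ((t - z) (t - w)); for m = 0 and conjugate data at w it is
  an entry of a kernel matrix.\<close>

definition tail_quotient :: "(nat \<Rightarrow> complex) \<Rightarrow> complex \<Rightarrow> complex \<Rightarrow> complex \<Rightarrow> complex \<Rightarrow> nat \<Rightarrow> complex" where
  "tail_quotient s f z g w m = (tail s f z m - tail s g w m) / (z - w)"

lemma tail_quotient_Suc:
  assumes "z \<noteq> w"
  shows "tail_quotient s f z g w (Suc m) = z * tail_quotient s f z g w m + tail s g w m"
    and "tail_quotient s f z g w (Suc m) = w * tail_quotient s f z g w m + tail s f z m"
  using assms by (auto simp: tail_quotient_def field_simps)

lemma tail_quotient_expand_left:
  assumes "z \<noteq> w" "z \<noteq> 0"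
  shows "tail_quotient s f z g w p =
    (1 / z) ^ m * tail_quotient s f z g w (p + m) - (\<Sum>a<m. tail s g w (p + a) * (1 / z) ^ (a + 1))"
proof (induction m)
  case (Suc m)
  have "(1 / z) ^ Suc m * tail_quotient s f z g w (p + Suc m)
      = (1 / z) ^ m * tail_quotient s f z g w (p + m) + tail s g w (p + m) * (1 / z) ^ (m + 1)"
    using assms by (simp add: tail_quotient_Suc(1) field_simps)
  then show ?case using Suc by simp
qed simp

lemma tail_quotient_expand_right:
  assumes "z \<noteq> w" "w \<noteq> 0"
  shows "tail_quotient s f z g w p =
    (1 / w) ^ m * tail_quotient s f z g w (p + m) - (\<Sum>a<m. tail s f z (p + a) * (1 / w) ^ (a + 1))"
proof (induction m)
  case (Suc m)
  have "(1 / w) ^ Suc m * tail_quotient s f z g w (p + Suc m)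
      = (1 / w) ^ m * tail_quotient s f z g w (p + m) + tail s f z (p + m) * (1 / w) ^ (m + 1)"
    using assms by (simp add: tail_quotient_Suc(2) field_simps)
  then show ?case using Suc by simp
qed simp

section \<open>Extraction of coefficients at infinity\<close>

lemma vandermonde_left_inverse:
  fixes \<rho> :: "nat \<Rightarrow> complex"
  assumes inj: "inj_on \<rho> {..n}" and nz: "\<And>k. k \<le> n \<Longrightarrow> \<rho> k \<noteq> 0"
  obtains W where "\<And>a b. a \<le> n \<Longrightarrow> b \<le> n \<Longrightarrow> (\<Sum>k\<le>n. W a k * \<rho> k ^ (b + 1)) = (if a = b then 1 else 0)"
proof -
  \<comment> \<open>The exponents start at 1 because expansions at infinity start at 1 / z; this is
    why the nodes have to be nonzero besides being distinct.\<close>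
  define V where "V = Matrix.mat (Suc n) (Suc n) (\<lambda>(k, b). \<rho> k ^ (b + 1))"
  have V: "V \<in> carrier_mat (Suc n) (Suc n)" by (simp add: V_def)
  have "Determinant.det V \<noteq> 0"
  proof
    assume "Determinant.det V = 0"
    then obtain v where v: "v \<in> carrier_vec (Suc n)" "v \<noteq> 0\<^sub>v (Suc n)" "V *\<^sub>v v = 0\<^sub>v (Suc n)"
      using det_0_iff_vec_prod_zero_field[OF V] by auto
    define p where "p = (\<Sum>b\<le>n. monom (v $ b) b)"
    have cp: "coeff p b = v $ b" if "b \<le> n" for b
      using that by (simp add: p_def coeff_sum)
    have "poly p (\<rho> k) = 0" if k: "k \<le> n" for k
    proof -
      have "0 = (V *\<^sub>v v) $ k" using v(3) k by simp
      also have "\<dots> = (\<Sum>b<Suc n. \<rho> k ^ (b + 1) * v $ b)"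
        using v(1) k by (simp add: V_def scalar_prod_def lessThan_atLeast0 del: sum.lessThan_Suc sum.atLeast0_lessThan_Suc)
      also have "\<dots> = \<rho> k * poly p (\<rho> k)"
        by (simp add: p_def poly_sum poly_monom lessThan_Suc_atMost sum_distrib_left mult_ac del: sum.lessThan_Suc)
      finally show ?thesis using nz[OF k] by simp
    qed
    then have sub: "\<rho> ` {..n} \<subseteq> {x. poly p x = 0}" by auto
    have "p = 0"
    proof (rule ccontr)
      assume p0: "p \<noteq> 0"
      have "card (\<rho> ` {..n}) \<le> card {x. poly p x = 0}"
        by (rule card_mono[OF poly_roots_finite[OF p0] sub])
      also have "\<dots> \<le> degree p" by (rule card_poly_roots_bound[OF p0])
      also have "\<dots> \<le> n" unfolding p_def by (intro degree_sum_le) (auto intro: order_trans[OF degree_monom_le])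
      finally show False using card_image[OF inj] by simp
    qed
    then have "v $ b = 0" if "b \<le> n" for b using cp[OF that] by simp
    then have "v = 0\<^sub>v (Suc n)" using v(1) by (intro eq_vecI) auto
    then show False using v(2) by simp
  qed
  then have "V \<in> Units (ring_mat TYPE(complex) (Suc n) ())"
    by (rule det_non_zero_imp_unit[OF V])
  then obtain B where B: "B \<in> carrier_mat (Suc n) (Suc n)" "B * V = 1\<^sub>m (Suc n)"
    by (auto simp: Units_def ring_mat_def)
  have "(\<Sum>k\<le>n. B $$ (a, k) * \<rho> k ^ (b + 1)) = (if a = b then 1 else 0)" if "a \<le> n" "b \<le> n" for a b
  proof -
    have "(B * V) $$ (a, b) = (\<Sum>k<Suc n. B $$ (a, k) * \<rho> k ^ (b + 1))"
      using B(1) that by (simp add: V_def scalar_prod_def lessThan_atLeast0 del: sum.lessThan_Suc sum.atLeast0_lessThan_Suc)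
    then show ?thesis using B(2) that by (simp add: lessThan_Suc_atMost del: sum.lessThan_Suc)
  qed
  then show ?thesis using that[of "\<lambda>a k. B $$ (a, k)"] by blast
qed

text \<open>For \<open>W\<close> as above this recovers the coefficient of \<open>1 / z\<^sup>a\<^sup>+\<^sup>1\<close> from the values \<open>g k\<close> at the points
  \<open>z = y / \<rho> k\<close>.\<close>

definition extract_coeff :: "(nat \<Rightarrow> nat \<Rightarrow> complex) \<Rightarrow> nat \<Rightarrow> nat \<Rightarrow> real \<Rightarrow> (nat \<Rightarrow> complex) \<Rightarrow> complex" where
  "extract_coeff W n a y g = (\<Sum>k\<le>n. W a k * of_real y ^ (a + 1) * g k)"

lemma extract_coeff_diff: "extract_coeff W n a y (\<lambda>k. g k - h k) = extract_coeff W n a y g - extract_coeff W n a y h"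
  by (simp add: extract_coeff_def algebra_simps sum_subtractf)

lemma extract_expansion:
  assumes W: "\<And>a b. a \<le> n \<Longrightarrow> b \<le> n \<Longrightarrow> (\<Sum>k\<le>n. W a k * \<rho> k ^ (b + 1)) = (if a = b then 1 else 0)"
    and "a \<le> n" "y \<noteq> 0"
  shows "extract_coeff W n a y (\<lambda>k. \<Sum>b<Suc n. c b * (\<rho> k / of_real y) ^ (b + 1)) = c a"
proof -
  have "extract_coeff W n a y (\<lambda>k. \<Sum>b<Suc n. c b * (\<rho> k / of_real y) ^ (b + 1))
      = (\<Sum>k\<le>n. \<Sum>b<Suc n. c b * of_real y ^ (a + 1) / of_real y ^ (b + 1) * (W a k * \<rho> k ^ (b + 1)))"
    unfolding extract_coeff_def sum_distrib_left by (intro sum.cong refl) (simp add: power_divide)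
  also have "\<dots> = (\<Sum>b<Suc n. \<Sum>k\<le>n. c b * of_real y ^ (a + 1) / of_real y ^ (b + 1) * (W a k * \<rho> k ^ (b + 1)))"
    by (rule sum.swap)
  also have "\<dots> = (\<Sum>b<Suc n. if b = a then c a else 0)"
    unfolding sum_distrib_left[symmetric]
  proof (intro sum.cong refl)
    fix b assume "b \<in> {..<Suc n}"
    then have "b \<le> n" by simp
    show "c b * of_real y ^ (a + 1) / of_real y ^ (b + 1) * (\<Sum>k\<le>n. W a k * \<rho> k ^ (b + 1)) = (if b = a then c a else 0)"
      unfolding W[OF assms(2) \<open>b \<le> n\<close>] using assms(3) by simp
  qed
  finally show ?thesis using assms(2) by simp
qed

text \<open>The weight grows like y^(a+1) with a \<le> n, which the factor of order y^(-n-1)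
  compensates.\<close>

lemma extract_remainder:
  assumes "a \<le> n" and g: "\<And>k. k \<le> n \<Longrightarrow> ((\<lambda>y. g y k) \<longlongrightarrow> 0) at_top"
  shows "((\<lambda>y. extract_coeff W n a y (\<lambda>k. (\<rho> k / of_real y) ^ (n + 1) * g y k)) \<longlongrightarrow> 0) at_top"
proof -
  have "((\<lambda>y. W a k * of_real y ^ (a + 1) * ((\<rho> k / of_real y) ^ (n + 1) * g y k)) \<longlongrightarrow> 0) at_top"
    if k: "k \<le> n" for k
  proof (rule Lim_null_comparison)
    show "\<forall>\<^sub>F y in at_top. norm (W a k * of_real y ^ (a + 1) * ((\<rho> k / of_real y) ^ (n + 1) * g y k))
        \<le> cmod (W a k * \<rho> k ^ (n + 1)) * cmod (g y k)"
      using eventually_ge_at_top[of "1 :: real"]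
    proof eventually_elim
      case (elim y)
      have "y ^ (a + 1) / y ^ (n + 1) \<le> 1"
        using elim assms(1) by (simp add: divide_le_eq power_increasing)
      then have "y ^ (a + 1) / y ^ (n + 1) * (cmod (W a k * \<rho> k ^ (n + 1)) * cmod (g y k))
          \<le> 1 * (cmod (W a k * \<rho> k ^ (n + 1)) * cmod (g y k))"
        by (intro mult_right_mono) auto
      moreover have "norm (W a k * of_real y ^ (a + 1) * ((\<rho> k / of_real y) ^ (n + 1) * g y k))
          = y ^ (a + 1) / y ^ (n + 1) * (cmod (W a k * \<rho> k ^ (n + 1)) * cmod (g y k))"
        using elim by (simp add: norm_mult norm_power norm_divide power_divide)
      ultimately show ?case by simp
    qed
    show "((\<lambda>y. cmod (W a k * \<rho> k ^ (n + 1)) * cmod (g y k)) \<longlongrightarrow> 0) at_top"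
      by (intro tendsto_mult_right_zero tendsto_norm_zero g k)
  qed
  then have "((\<lambda>y. extract_coeff W n a y (\<lambda>k. (\<rho> k / of_real y) ^ (n + 1) * g y k)) \<longlongrightarrow> (\<Sum>k\<le>n. 0)) at_top"
    unfolding extract_coeff_def by (intro tendsto_sum) auto
  then show ?thesis by simp
qed

lemma extract_coeff_swap:
  "extract_coeff W' n b y (\<lambda>l. extract_coeff W n a y (\<lambda>k. c k * h k l))
    = extract_coeff W n a y (\<lambda>k. c k * extract_coeff W' n b y (\<lambda>l. h k l))"
proof -
  have "extract_coeff W' n b y (\<lambda>l. extract_coeff W n a y (\<lambda>k. c k * h k l))
     = (\<Sum>l\<le>n. \<Sum>k\<le>n. W' b l * of_real y ^ (b + 1) * (W a k * of_real y ^ (a + 1) * (c k * h k l)))"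
    by (simp add: extract_coeff_def sum_distrib_left)
  also have "\<dots> = (\<Sum>k\<le>n. \<Sum>l\<le>n. W' b l * of_real y ^ (b + 1) * (W a k * of_real y ^ (a + 1) * (c k * h k l)))"
    by (rule sum.swap)
  also have "\<dots> = extract_coeff W n a y (\<lambda>k. c k * extract_coeff W' n b y (\<lambda>l. h k l))"
    by (simp add: extract_coeff_def sum_distrib_left mult_ac)
  finally show ?thesis .
qed

text \<open>On the imaginary axis the points stay in a nontangential sector, and
  \<open>y * node k - cnj (y * node l)\<close> is a nonzero multiple of y. The successor keeps 0
  out.\<close>

definition node :: "nat \<Rightarrow> complex" where
  "node k = \<i> * of_nat (Suc k)"

lemma node_nz [simp]: "node k \<noteq> 0"
  by (simp add: node_def del: of_nat_Suc)

lemma node_eq_iff [simp]: "node k = node l \<longleftrightarrow> k = l"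
  by (simp add: node_def)

lemma Im_node: "Im (node k) = real (Suc k)"
  by (simp add: node_def)

text \<open>Records only the behaviour along the rays through the nodes, so that it fits both a
  given solution and the constructed one.\<close>

locale moment_asymptotics =
  fixes \<phi> :: "complex \<Rightarrow> complex" and s :: "nat \<Rightarrow> real" and n :: nat and W :: "nat \<Rightarrow> nat \<Rightarrow> complex"
  assumes W: "\<And>a b. a \<le> n \<Longrightarrow> b \<le> n \<Longrightarrow> (\<Sum>k\<le>n. W a k * (1 / node k) ^ (b + 1)) = (if a = b then 1 else 0)"
    and tail_lim: "\<And>m k. m \<le> 2 * n \<Longrightarrow>
      ((\<lambda>y. tail (\<lambda>i. of_real (s i)) (\<phi> (of_real y * node k)) (of_real y * node k) (Suc m)) \<longlongrightarrow> 0) at_top"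
begin

abbreviation "S \<equiv> \<lambda>i. complex_of_real (s i)"
abbreviation "pt y k \<equiv> complex_of_real y * node k"
abbreviation "T y k \<equiv> tail S (\<phi> (pt y k)) (pt y k)"
abbreviation "cT y k \<equiv> tail S (cnj (\<phi> (pt y k))) (cnj (pt y k))"
abbreviation "W' \<equiv> \<lambda>b l. cnj (W b l)"

lemma pt_inverse: "1 / pt y k = 1 / node k / of_real y"
  by (simp add: field_simps)

lemma cnj_pt_inverse: "1 / cnj (pt y k) = cnj (1 / node k) / of_real y"
  by (simp add: field_simps)

lemma W': "a \<le> n \<Longrightarrow> b \<le> n \<Longrightarrow> (\<Sum>k\<le>n. W' a k * cnj (1 / node k) ^ (b + 1)) = (if a = b then 1 else 0)"
  using arg_cong[OF W[of a b], of cnj] by (simp del: power_Suc)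

lemma cT_eq: "cT y k m = cnj (T y k m)"
  by (simp add: tail_cnj)

lemma cT_lim: "m \<le> 2 * n \<Longrightarrow> ((\<lambda>y. cT y k (Suc m)) \<longlongrightarrow> 0) at_top"
  unfolding cT_eq using tendsto_cnj[OF tail_lim[of m k]] by simp

lemma extract_quotient:
  assumes "a \<le> n" "y > 0" "\<And>k. k \<le> n \<Longrightarrow> pt y k \<noteq> w"
  shows "extract_coeff W n a y (\<lambda>k. tail_quotient S (\<phi> (pt y k)) (pt y k) g w 0)
     = extract_coeff W n a y (\<lambda>k. (1 / node k / of_real y) ^ (n + 1) *
         tail_quotient S (\<phi> (pt y k)) (pt y k) g w (n + 1)) - tail S g w a"
proof -
  have "extract_coeff W n a y (\<lambda>k. tail_quotient S (\<phi> (pt y k)) (pt y k) g w 0)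
    = extract_coeff W n a y (\<lambda>k. (1 / node k / of_real y) ^ (n + 1) *
         tail_quotient S (\<phi> (pt y k)) (pt y k) g w (n + 1)
         - (\<Sum>b<Suc n. tail S g w b * (1 / node k / of_real y) ^ (b + 1)))"
    unfolding extract_coeff_def
  proof (intro sum.cong refl arg_cong2[of _ _ _ _ "(*)"])
    fix k assume "k \<in> {..n}"
    then have "pt y k \<noteq> w" "pt y k \<noteq> 0" using assms by auto
    from tail_quotient_expand_left[OF this, of S "\<phi> (pt y k)" g 0 "Suc n"]
    show "tail_quotient S (\<phi> (pt y k)) (pt y k) g w 0 = (1 / node k / of_real y) ^ (n + 1) *
         tail_quotient S (\<phi> (pt y k)) (pt y k) g w (n + 1)
         - (\<Sum>b<Suc n. tail S g w b * (1 / node k / of_real y) ^ (b + 1))"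
      unfolding pt_inverse by (simp only: add_0 Suc_eq_plus1)
  qed
  also have "\<dots> = extract_coeff W n a y (\<lambda>k. (1 / node k / of_real y) ^ (n + 1) *
         tail_quotient S (\<phi> (pt y k)) (pt y k) g w (n + 1)) - tail S g w a"
    unfolding extract_coeff_diff using assms(1,2) by (subst extract_expansion[OF W]) auto
  finally show ?thesis .
qed

text \<open>For fixed w the quotient of index n + 1 tends to 0, its numerator being bounded and its
  denominator not; what survives the extraction is the tail at the fixed point.\<close>

lemma extract_quotient_lim:
  assumes "a \<le> n" "Im w < 0"
  shows "((\<lambda>y. extract_coeff W n a y (\<lambda>k. tail_quotient S (\<phi> (pt y k)) (pt y k) g w 0))
    \<longlongrightarrow> - tail S g w a) at_top"
proof -
  have "((\<lambda>y. tail_quotient S (\<phi> (pt y k)) (pt y k) g w (n + 1)) \<longlongrightarrow> 0) at_top" for k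
  proof -
    have "filterlim (\<lambda>y. of_real y * node k) at_infinity at_top"
      by (intro tendsto_mult_filterlim_at_infinity[of "\<lambda>_. node k" "node k" at_top complex_of_real, simplified mult.commute]
          filterlim_of_real_at_infinity) auto
    then have "filterlim (\<lambda>y. - w + pt y k) at_infinity at_top"
      by (rule tendsto_add_filterlim_at_infinity[OF tendsto_const])
    then have inf: "filterlim (\<lambda>y. pt y k - w) at_infinity at_top" by simp
    have "((\<lambda>y. T y k (n + 1) - tail S g w (n + 1)) \<longlongrightarrow> 0 - tail S g w (n + 1)) at_top"
      using tail_lim[of n k] by (intro tendsto_diff tendsto_const) simp
    then show ?thesis
      unfolding tail_quotient_def by (rule tendsto_divide_0) (rule inf)
  qed
  then have "((\<lambda>y. extract_coeff W n a y (\<lambda>k. (1 / node k / of_real y) ^ (n + 1) *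
         tail_quotient S (\<phi> (pt y k)) (pt y k) g w (n + 1)) - tail S g w a) \<longlongrightarrow> 0 - tail S g w a) at_top"
    by (intro tendsto_diff tendsto_const extract_remainder assms)
  moreover have "\<forall>\<^sub>F y in at_top. extract_coeff W n a y (\<lambda>k. (1 / node k / of_real y) ^ (n + 1) *
         tail_quotient S (\<phi> (pt y k)) (pt y k) g w (n + 1)) - tail S g w a
       = extract_coeff W n a y (\<lambda>k. tail_quotient S (\<phi> (pt y k)) (pt y k) g w 0)"
    using eventually_gt_at_top[of "0 :: real"]
  proof eventually_elim
    case (elim y)
    have "pt y k \<noteq> w" for k
      using assms(2) elim by (auto simp: Im_node mult_less_0_iff)
    then show ?case using extract_quotient[OF assms(1) elim, of w g] by simp
  qed
  ultimately show ?thesis by (simp only: tendsto_cong diff_0)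
qed

lemma pt_ne_cnj: "y > 0 \<Longrightarrow> pt y k \<noteq> cnj (pt y l)"
proof
  assume "y > 0" "pt y k = cnj (pt y l)"
  then have "Im (pt y k) = Im (cnj (pt y l))" by simp
  then have "y * real (Suc k) = - (y * real (Suc l))" by (simp add: Im_node del: of_nat_Suc)
  moreover have "y * real (Suc k) > 0" "y * real (Suc l) > 0" using \<open>y > 0\<close> by auto
  ultimately show False by linarith
qed

text \<open>Tails are known to be small only up to index 2 n + 1, so the expansion in the second
  variable stops after n steps, at the quotient of that index.\<close>

lemma extract_inner_lim:
  assumes "b \<le> n"
  shows "((\<lambda>y. extract_coeff W' n b y (\<lambda>l. tail_quotient S (\<phi> (pt y k)) (pt y k)
      (cnj (\<phi> (pt y l))) (cnj (pt y l)) (n + 1))) \<longlongrightarrow> 0) at_top"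
proof -
  \<comment> \<open>Padded by 0 at index n: the expansion has n terms, while the weights invert n +
    1 powers.\<close>
  define c where "c = (\<lambda>y b. if b < n then T y k (n + 1 + b) else 0)"
  \<comment> \<open>The extra factor raises the power of 1 / \<open>cnj (pt y l)\<close> from n to n
    + 1, as \<open>extract_remainder\<close> demands. It is harmless, since the denominator of the
    quotient has the same order y.\<close>
  define R where "R = (\<lambda>y l. cnj (pt y l) * tail_quotient S (\<phi> (pt y k)) (pt y k)
      (cnj (\<phi> (pt y l))) (cnj (pt y l)) (2 * n + 1))"
  have "((\<lambda>y. R y l) \<longlongrightarrow> 0) at_top" for l
  proof -
    have "((\<lambda>y. (T y k (Suc (2 * n)) - cT y l (Suc (2 * n))) * (cnj (node l) / (node k - cnj (node l))))
        \<longlongrightarrow> (0 - 0) * (cnj (node l) / (node k - cnj (node l)))) at_top"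
      by (intro tendsto_mult tendsto_diff tendsto_const tail_lim cT_lim) auto
    moreover have "\<forall>\<^sub>F y in at_top. (T y k (Suc (2 * n)) - cT y l (Suc (2 * n))) * (cnj (node l) / (node k - cnj (node l))) = R y l"
      using eventually_gt_at_top[of "0 :: real"]
    proof eventually_elim
      case (elim y)
      have "pt y k - cnj (pt y l) = of_real y * (node k - cnj (node l))" by (simp add: algebra_simps)
      then show ?case
        unfolding R_def tail_quotient_def using elim by simp
    qed
    ultimately show ?thesis by (simp add: tendsto_cong)
  qed
  then have "((\<lambda>y. extract_coeff W' n b y (\<lambda>l. (cnj (1 / node l) / of_real y) ^ (n + 1) * R y l)) \<longlongrightarrow> 0) at_top"
    by (intro extract_remainder assms)
  moreover have "((\<lambda>y. c y b) \<longlongrightarrow> 0) at_top"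
    using tail_lim[of "n + b" k] assms by (cases "b < n") (simp_all add: c_def)
  ultimately have "((\<lambda>y. extract_coeff W' n b y (\<lambda>l. (cnj (1 / node l) / of_real y) ^ (n + 1) * R y l) - c y b)
      \<longlongrightarrow> 0 - 0) at_top" by (rule tendsto_diff)
  moreover have "\<forall>\<^sub>F y in at_top. extract_coeff W' n b y (\<lambda>l. (cnj (1 / node l) / of_real y) ^ (n + 1) * R y l) - c y b
     = extract_coeff W' n b y (\<lambda>l. tail_quotient S (\<phi> (pt y k)) (pt y k)
      (cnj (\<phi> (pt y l))) (cnj (pt y l)) (n + 1))"
    using eventually_gt_at_top[of "0 :: real"]
  proof eventually_elim
    case (elim y)
    have "extract_coeff W' n b y (\<lambda>l. tail_quotient S (\<phi> (pt y k)) (pt y k)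
        (cnj (\<phi> (pt y l))) (cnj (pt y l)) (n + 1))
      = extract_coeff W' n b y (\<lambda>l. (cnj (1 / node l) / of_real y) ^ (n + 1) * R y l
         - (\<Sum>b<Suc n. c y b * (cnj (1 / node l) / of_real y) ^ (b + 1)))"
      unfolding extract_coeff_def
    proof (intro sum.cong refl arg_cong2[of _ _ _ _ "(*)"])
      fix l
      have nz: "cnj (pt y l) \<noteq> 0" using elim by simp
      have "tail_quotient S (\<phi> (pt y k)) (pt y k) (cnj (\<phi> (pt y l))) (cnj (pt y l)) (n + 1)
        = (1 / cnj (pt y l)) ^ n * tail_quotient S (\<phi> (pt y k)) (pt y k) (cnj (\<phi> (pt y l))) (cnj (pt y l)) (n + 1 + n)
          - (\<Sum>a<n. T y k (n + 1 + a) * (1 / cnj (pt y l)) ^ (a + 1))"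
        by (rule tail_quotient_expand_right[OF pt_ne_cnj[OF elim] nz])
      also have "(\<Sum>a<n. T y k (n + 1 + a) * (1 / cnj (pt y l)) ^ (a + 1))
          = (\<Sum>b<Suc n. c y b * (1 / cnj (pt y l)) ^ (b + 1))"
        by (simp add: c_def del: complex_cnj_mult power_Suc)
      also have "(1 / cnj (pt y l)) ^ n * tail_quotient S (\<phi> (pt y k)) (pt y k) (cnj (\<phi> (pt y l))) (cnj (pt y l)) (n + 1 + n)
          = (1 / cnj (pt y l)) ^ (n + 1) * R y l"
      proof -
        have "n + 1 + n = 2 * n + 1" by simp
        show ?thesis unfolding R_def \<open>n + 1 + n = 2 * n + 1\<close> using nz by (simp del: complex_cnj_mult)
      qed
      finally show "tail_quotient S (\<phi> (pt y k)) (pt y k) (cnj (\<phi> (pt y l))) (cnj (pt y l)) (n + 1)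
        = (cnj (1 / node l) / of_real y) ^ (n + 1) * R y l
         - (\<Sum>b<Suc n. c y b * (cnj (1 / node l) / of_real y) ^ (b + 1))"
        unfolding cnj_pt_inverse .
    qed
    also have "\<dots> = extract_coeff W' n b y (\<lambda>l. (cnj (1 / node l) / of_real y) ^ (n + 1) * R y l) - c y b"
      unfolding extract_coeff_diff using elim by (subst extract_expansion[OF W' assms]) auto
    finally show ?case by simp
  qed
  ultimately show ?thesis by (simp add: tendsto_cong)
qed

text \<open>Expanding in the first variable leaves - \<open>cT y l a\<close>, whose expansion in the
  second variable has the coefficients - s (a + b); the two signs cancel.\<close>

lemma extract_double_lim:
  assumes "a \<le> n" "b \<le> n"
  shows "((\<lambda>y. extract_coeff W' n b y (\<lambda>l. extract_coeff W n a y (\<lambda>k.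
      tail_quotient S (\<phi> (pt y k)) (pt y k) (cnj (\<phi> (pt y l))) (cnj (pt y l)) 0))) \<longlongrightarrow> S (a + b)) at_top"
proof -
  let ?Q = "\<lambda>y k l. tail_quotient S (\<phi> (pt y k)) (pt y k) (cnj (\<phi> (pt y l))) (cnj (pt y l))"
  have "((\<lambda>y. extract_coeff W n a y (\<lambda>k. (1 / node k / of_real y) ^ (n + 1) *
      extract_coeff W' n b y (\<lambda>l. ?Q y k l (n + 1)))) \<longlongrightarrow> 0) at_top"
    by (intro extract_remainder assms extract_inner_lim)
  moreover have "((\<lambda>y. extract_coeff W' n b y (\<lambda>l. (cnj (1 / node l) / of_real y) ^ (n + 1) * cT y l (Suc (a + n))))
      \<longlongrightarrow> 0) at_top"
    using assms by (intro extract_remainder cT_lim) auto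
  ultimately have "((\<lambda>y. extract_coeff W n a y (\<lambda>k. (1 / node k / of_real y) ^ (n + 1) *
      extract_coeff W' n b y (\<lambda>l. ?Q y k l (n + 1)))
      - (extract_coeff W' n b y (\<lambda>l. (cnj (1 / node l) / of_real y) ^ (n + 1) * cT y l (Suc (a + n))) - S (a + b)))
      \<longlongrightarrow> 0 - (0 - S (a + b))) at_top"
    by (intro tendsto_diff tendsto_const)
  moreover have "\<forall>\<^sub>F y in at_top. extract_coeff W n a y (\<lambda>k. (1 / node k / of_real y) ^ (n + 1) *
      extract_coeff W' n b y (\<lambda>l. ?Q y k l (n + 1)))
      - (extract_coeff W' n b y (\<lambda>l. (cnj (1 / node l) / of_real y) ^ (n + 1) * cT y l (Suc (a + n))) - S (a + b))
      = extract_coeff W' n b y (\<lambda>l. extract_coeff W n a y (\<lambda>k. ?Q y k l 0))"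
    using eventually_gt_at_top[of "0 :: real"]
  proof eventually_elim
    case (elim y)
    have "extract_coeff W' n b y (\<lambda>l. extract_coeff W n a y (\<lambda>k. ?Q y k l 0))
      = extract_coeff W' n b y (\<lambda>l. extract_coeff W n a y (\<lambda>k. (1 / node k / of_real y) ^ (n + 1) * ?Q y k l (n + 1))
          - cT y l a)"
      unfolding extract_quotient[OF assms(1) elim pt_ne_cnj[OF elim]] ..
    also have "\<dots> = extract_coeff W n a y (\<lambda>k. (1 / node k / of_real y) ^ (n + 1) *
      extract_coeff W' n b y (\<lambda>l. ?Q y k l (n + 1))) - extract_coeff W' n b y (\<lambda>l. cT y l a)"
      unfolding extract_coeff_diff extract_coeff_swap ..
    also have "(\<lambda>l. cT y l a) = (\<lambda>l. (cnj (1 / node l) / of_real y) ^ (n + 1) * cT y l (Suc (a + n))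
        - (\<Sum>b<Suc n. S (a + b) * (cnj (1 / node l) / of_real y) ^ (b + 1)))"
    proof
      fix l
      have "cnj (pt y l) \<noteq> 0" using elim by simp
      from tail_expand[OF this, of S "cnj (\<phi> (pt y l))" a "Suc n"]
      have "cT y l a = (1 / cnj (pt y l)) ^ Suc n * cT y l (a + Suc n) - (\<Sum>b<Suc n. S (a + b) * (1 / cnj (pt y l)) ^ (b + 1))"
        by (simp add: power_divide del: complex_cnj_mult power_Suc)
      then show "cT y l a = (cnj (1 / node l) / of_real y) ^ (n + 1) * cT y l (Suc (a + n))
        - (\<Sum>b<Suc n. S (a + b) * (cnj (1 / node l) / of_real y) ^ (b + 1))"
        unfolding cnj_pt_inverse by (simp only: add_Suc_right Suc_eq_plus1 add.assoc)
    qed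
    also have "extract_coeff W' n b y \<dots> = extract_coeff W' n b y (\<lambda>l. (cnj (1 / node l) / of_real y) ^ (n + 1) * cT y l (Suc (a + n))) - S (a + b)"
      unfolding extract_coeff_diff using elim by (subst extract_expansion[OF W' assms(2)]) auto
    finally show ?case by simp
  qed
  ultimately show ?thesis by (simp add: tendsto_cong)
qed

end

section \<open>The bordered Hankel matrix as a limit\<close>

lemma divide_diff_swap: "(a - b) / (c - d) = (b - a) / (d - c :: 'a :: field)"
  by (metis minus_diff_eq minus_divide_left minus_divide_right minus_minus)

lemma double_sum_Suc:
  fixes f :: "nat \<Rightarrow> nat \<Rightarrow> 'a :: comm_monoid_add"
  shows "(\<Sum>i<Suc N. \<Sum>j<Suc N. f i j)
    = (\<Sum>j<N. \<Sum>i<N. f i j) + (\<Sum>i<N. f i N) + (\<Sum>j<N. f N j) + f N N"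
proof -
  have "(\<Sum>j<N. \<Sum>i<N. f i j) = (\<Sum>i<N. \<Sum>j<N. f i j)" by (rule sum.swap)
  then show ?thesis by (simp add: sum.distrib add_ac)
qed

lemma kernel_matrix_carrier [simp]: "kernel_matrix \<phi> m w \<in> carrier_mat m m"
  by (simp add: kernel_matrix_def)

lemma adj_kernel_matrix [simp]: "adj (kernel_matrix \<phi> m w) = kernel_matrix \<phi> m w"
proof (rule eq_matI)
  fix i j assume "i < dim_row (kernel_matrix \<phi> m w)" "j < dim_col (kernel_matrix \<phi> m w)"
  then have "i < m" "j < m" by (auto simp: kernel_matrix_def)
  then show "adj (kernel_matrix \<phi> m w) $$ (i, j) = kernel_matrix \<phi> m w $$ (i, j)"
    by (simp add: kernel_matrix_def adj_def divide_diff_swap[of "\<phi> (w i)"])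
qed (auto simp: adj_def kernel_matrix_def)

text \<open>The Gram matrix of \<open>1, t, \<dots>, t\<^sup>n\<close> and \<open>1 / (t - \<omega>)\<close> when \<open>f = \<phi> \<omega>\<close> and \<open>\<phi>\<close> has moments \<open>s\<close>, up to the sign of
  the last vector.\<close>

definition bordered_hankel :: "(nat \<Rightarrow> real) \<Rightarrow> nat \<Rightarrow> complex \<Rightarrow> complex \<Rightarrow> complex mat" where
  "bordered_hankel s n f \<omega> = Matrix.mat (Suc (Suc n)) (Suc (Suc n)) (\<lambda>(i, j).
     if i \<le> n then if j \<le> n then of_real (s (i + j)) else - tail (\<lambda>i. of_real (s i)) (cnj f) (cnj \<omega>) i
     else if j \<le> n then - tail (\<lambda>i. of_real (s i)) f \<omega> j else (f - cnj f) / (\<omega> - cnj \<omega>))"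

lemma bordered_hankel_carrier [simp]: "bordered_hankel s n f \<omega> \<in> carrier_mat (Suc (Suc n)) (Suc (Suc n))"
  by (simp add: bordered_hankel_def)

lemma adj_bordered_hankel [simp]: "adj (bordered_hankel s n f \<omega>) = bordered_hankel s n f \<omega>"
proof (rule eq_matI)
  fix i j assume "i < dim_row (bordered_hankel s n f \<omega>)" "j < dim_col (bordered_hankel s n f \<omega>)"
  then have "i < Suc (Suc n)" "j < Suc (Suc n)" by (auto simp: bordered_hankel_def)
  then show "adj (bordered_hankel s n f \<omega>) $$ (i, j) = bordered_hankel s n f \<omega> $$ (i, j)"
    by (auto simp: bordered_hankel_def adj_def tail_cnj add.commute divide_diff_swap[of f "cnj f"])
qed (auto simp: adj_def bordered_hankel_def)

context moment_asymptotics
begin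

lemma neg_eigenvalues_bordered_le:
  assumes neg: "\<And>m w. holomorphy_points \<phi> m w \<Longrightarrow> neg_eigenvalues (kernel_matrix \<phi> m w) \<le> \<kappa>"
    and an: "\<And>k. \<forall>\<^sub>F y in at_top. \<phi> analytic_on {pt y k}"
    and \<omega>: "Im \<omega> > 0" "\<phi> analytic_on {\<omega>}"
  shows "neg_eigenvalues (bordered_hankel s n (\<phi> \<omega>) \<omega>) \<le> \<kappa>"
proof -
  define w where "w = (\<lambda>y i. if i \<le> n then pt y i else \<omega>)"
  define K where "K = (\<lambda>y. kernel_matrix \<phi> (Suc (Suc n)) (w y))"
  have K: "K y \<in> carrier_mat (Suc (Suc n)) (Suc (Suc n))" "adj (K y) = K y" for y
    by (simp_all add: K_def)
  \<comment> \<open>Rows a \<le> n carry the extraction weights on the moving points, and the last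
    row selects the fixed point \<omega>.\<close>
  define C where "C = (\<lambda>y a i. if a \<le> n then (if i \<le> n then W a i * complex_of_real y ^ (a + 1) else 0)
      else (if i = Suc n then 1 else 0))"
  define M where "M = (\<lambda>y. Matrix.mat (Suc (Suc n)) (Suc (Suc n)) (\<lambda>(a, b). hform (K y) (C y a) (C y b)))"
  have M: "M y \<in> carrier_mat (Suc (Suc n)) (Suc (Suc n))" for y by (simp add: M_def)
  have adjM: "adj (M y) = M y" for y
    by (rule eq_matI) (auto simp: adj_def M_def hform_cnj[OF K(2), symmetric])
  have entry: "K y $$ (i, j) = tail_quotient S (\<phi> (w y i)) (w y i) (cnj (\<phi> (w y j))) (cnj (w y j)) 0"
    if "i < Suc (Suc n)" "j < Suc (Suc n)" for y i j
    using that by (simp add: K_def kernel_matrix_def tail_quotient_def)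
  have hK: "hform (K y) x z = (\<Sum>j\<le>n. (\<Sum>i\<le>n. x i * K y $$ (i, j) * cnj (z j))) + (\<Sum>i\<le>n. x i * K y $$ (i, Suc n) * cnj (z (Suc n)))
      + (\<Sum>j\<le>n. x (Suc n) * K y $$ (Suc n, j) * cnj (z j)) + x (Suc n) * K y $$ (Suc n, Suc n) * cnj (z (Suc n))" for x z y
    unfolding hform_def carrier_matD[OF K(1)] by (subst double_sum_Suc) (simp only: lessThan_Suc_atMost)
  have lim: "((\<lambda>y. M y $$ (a, b)) \<longlongrightarrow> bordered_hankel s n (\<phi> \<omega>) \<omega> $$ (a, b)) at_top"
    if a: "a < Suc (Suc n)" and b: "b < Suc (Suc n)" for a b
  proof -
    have mixed: "((\<lambda>y. hform (K y) (C y a) (C y (Suc n))) \<longlongrightarrow> - tail S (cnj (\<phi> \<omega>)) (cnj \<omega>) a) at_top"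
      if "a \<le> n" for a
    proof -
      have "hform (K y) (C y a) (C y (Suc n)) =
          extract_coeff W n a y (\<lambda>k. tail_quotient S (\<phi> (pt y k)) (pt y k) (cnj (\<phi> \<omega>)) (cnj \<omega>) 0)" for y
        using that by (simp add: hK C_def extract_coeff_def entry w_def)
      then show ?thesis using extract_quotient_lim[OF that, of "cnj \<omega>" "cnj (\<phi> \<omega>)"] \<omega>(1) by simp
    qed
    consider "a \<le> n" "b \<le> n" | "a \<le> n" "b = Suc n" | "a = Suc n" "b \<le> n" | "a = Suc n" "b = Suc n"
      using a b by linarith
    then show ?thesis
    proof cases
      case 1
      have "M y $$ (a, b) = extract_coeff W' n b y (\<lambda>l. extract_coeff W n a y (\<lambda>k.
          tail_quotient S (\<phi> (pt y k)) (pt y k) (cnj (\<phi> (pt y l))) (cnj (pt y l)) 0))" for y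
        using 1 by (simp add: M_def hK C_def extract_coeff_def entry w_def sum_distrib_left mult_ac)
      then show ?thesis using extract_double_lim[OF 1] 1 by (simp add: bordered_hankel_def)
    next
      case 2
      then show ?thesis using mixed[of a] by (simp add: M_def bordered_hankel_def)
    next
      case 3
      have "M y $$ (a, b) = cnj (hform (K y) (C y b) (C y (Suc n)))" for y
        using 3 by (simp add: M_def hform_cnj[OF K(2), symmetric])
      then show ?thesis using tendsto_cnj[OF mixed[of b]] 3
        by (simp add: bordered_hankel_def tail_cnj)
    next
      case 4
      then have "M y $$ (a, b) = bordered_hankel s n (\<phi> \<omega>) \<omega> $$ (a, b)" for y
        by (simp add: M_def hK C_def entry w_def tail_quotient_def bordered_hankel_def)
      then show ?thesis by simp
    qed
  qed
  have "\<forall>\<^sub>F y in at_top. \<forall>k\<in>{..n}. \<phi> analytic_on {pt y k}"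
    by (intro eventually_ball_finite ballI an) auto
  then have ev: "\<forall>\<^sub>F y in at_top. neg_eigenvalues (M y) \<le> \<kappa>"
    using eventually_gt_at_top[of "0 :: real"]
  proof eventually_elim
    case (elim y)
    have "holomorphy_points \<phi> (Suc (Suc n)) (w y)"
      using elim \<omega> by (auto simp: holomorphy_points_def w_def Im_node)
    then have "neg_eigenvalues (K y) \<le> \<kappa>" unfolding K_def by (rule neg)
    moreover have "neg_eigenvalues (M y) \<le> neg_eigenvalues (K y)"
      by (rule neg_eigenvalues_congruence[OF K M, of y _ "C y"]) (simp add: M_def)
    ultimately show ?case by simp
  qed
  show ?thesis
    by (rule neg_eigenvalues_limit[OF bordered_hankel_carrier adj_bordered_hankel _ M adjM lim ev]) auto
qed

text \<open>The Hankel matrix is a principal submatrix of the bordered one, whichever analytic point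
  is adjoined. For the constructed solution this gives the lower bound on the number of negative
  squares.\<close>

lemma neg_eigenvalues_hankel_le:
  assumes "\<And>m w. holomorphy_points \<phi> m w \<Longrightarrow> neg_eigenvalues (kernel_matrix \<phi> m w) \<le> \<kappa>"
    and "\<And>k. \<forall>\<^sub>F y in at_top. \<phi> analytic_on {pt y k}"
  shows "neg_eigenvalues (hankel s n) \<le> \<kappa>"
proof -
  have "\<forall>\<^sub>F y in at_top. \<phi> analytic_on {pt y 0} \<and> y > 0"
    using assms(2)[of 0] eventually_gt_at_top[of "0 :: real"] by (rule eventually_conj)
  then obtain y where y: "\<phi> analytic_on {pt y 0}" "y > 0"
    using eventually_happens'[OF trivial_limit_at_top_linorder] by blast
  let ?B = "bordered_hankel s n (\<phi> (pt y 0)) (pt y 0)"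
  have "neg_eigenvalues (chankel s (n + 1)) \<le> neg_eigenvalues ?B"
  proof (rule neg_eigenvalues_congruence[where C = "\<lambda>p i. if i = p then 1 else 0" and n = "Suc (Suc n)"])
    fix p q assume pq: "p < n + 1" "q < n + 1"
    have "hform ?B (\<lambda>i. if i = p then 1 else 0) (\<lambda>i. if i = q then 1 else 0)
       = (\<Sum>i<Suc (Suc n). \<Sum>j<Suc (Suc n). if i = p then (if j = q then of_real (s (p + q)) else 0) else 0)"
      unfolding hform_def carrier_matD[OF bordered_hankel_carrier]
      using pq by (intro sum.cong refl) (auto simp: bordered_hankel_def)
    also have "\<dots> = (\<Sum>i<Suc (Suc n). if i = p then (\<Sum>j<Suc (Suc n). if j = q then of_real (s (p + q)) else 0) else 0)"
      by (intro sum.cong refl) auto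
    also have "\<dots> = of_real (s (p + q))" using pq by (simp add: sum.delta del: sum.lessThan_Suc)
    finally show "chankel s (n + 1) $$ (p, q) = hform ?B (\<lambda>i. if i = p then 1 else 0) (\<lambda>i. if i = q then 1 else 0)"
      using pq by (simp add: chankel_def)
  qed auto
  also have "\<dots> \<le> \<kappa>"
    by (rule neg_eigenvalues_bordered_le) (use assms y in \<open>auto simp: Im_node\<close>)
  finally show ?thesis by (simp add: neg_eigenvalues_hankel)
qed

lemma kernel_of_solution:
  assumes neg: "\<And>m w. holomorphy_points \<phi> m w \<Longrightarrow> neg_eigenvalues (kernel_matrix \<phi> m w) \<le> neg_eigenvalues (hankel s n)"
    and an: "\<And>k. \<forall>\<^sub>F y in at_top. \<phi> analytic_on {pt y k}"
    and \<omega>: "Im \<omega> > 0" "\<phi> analytic_on {\<omega>}"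
    and u: "r \<le> n" "\<And>k. k \<le> n \<Longrightarrow> (\<Sum>i\<le>r. u i * s (i + k)) = 0"
  shows "\<phi> \<omega> * peval (\<lambda>i. of_real (u i)) r \<omega> + qeval (\<lambda>i. of_real (u i)) S r \<omega> = 0"
proof -
  let ?M = "bordered_hankel s n (\<phi> \<omega>) \<omega>"
  define v where "v = (\<lambda>i. if i \<le> r then complex_of_real (u i) else 0)"
  have vsum: "(\<Sum>i<Suc n. v i * f i) = (\<Sum>i\<le>r. of_real (u i) * f i)" for f
    using u(1) by (intro sum.mono_neutral_cong_right) (auto simp: v_def)
  have "(\<Sum>i<Suc n. v i * ?M $$ (i, Suc n)) = 0"
  proof (rule kernel_of_bordered[where A = "chankel s (Suc n)"])
    show "neg_eigenvalues ?M \<le> neg_eigenvalues (chankel s (Suc n))"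
      using neg_eigenvalues_bordered_le[OF neg an \<omega>] by (simp add: neg_eigenvalues_hankel)
    show "chankel s (Suc n) $$ (i, j) = ?M $$ (i, j)" if "i < Suc n" "j < Suc n" for i j
      using that by (simp add: chankel_def bordered_hankel_def)
    show "(\<Sum>i<Suc n. v i * ?M $$ (i, j)) = 0" if "j < Suc n" for j
    proof -
      have "(\<Sum>i<Suc n. v i * ?M $$ (i, j)) = (\<Sum>i\<le>r. of_real (u i * s (i + j)))"
        unfolding vsum using that u(1) by (intro sum.cong refl) (simp add: bordered_hankel_def)
      also have "\<dots> = of_real (\<Sum>i\<le>r. u i * s (i + j))" by simp
      finally show ?thesis using u(2)[of j] that by simp
    qed
  qed auto
  then have "(\<Sum>i\<le>r. of_real (u i) * ?M $$ (i, Suc n)) = 0" by (simp only: vsum)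
  \<comment> \<open>The border column consists of negated conjugate tails; as \<open>u\<close> is
    real, the conjugation can be taken out of the sum.\<close>
  moreover have "(\<Sum>i\<le>r. of_real (u i) * ?M $$ (i, Suc n)) = - cnj (\<Sum>i\<le>r. of_real (u i) * tail S (\<phi> \<omega>) \<omega> i)"
    unfolding cnj_sum sum_negf[symmetric] using u(1)
    by (intro sum.cong refl) (simp add: bordered_hankel_def tail_cnj)
  ultimately have "(\<Sum>i\<le>r. of_real (u i) * tail S (\<phi> \<omega>) \<omega> i) = 0"
    by (metis complex_cnj_zero_iff neg_equal_0_iff_equal)
  then show ?thesis by (simp add: sum_tail)
qed

end

section \<open>Solutions of the moment problem\<close>

lemma tail_eq_quotient:
  assumes "z \<noteq> 0"
  shows "tail s f z (Suc m) = (f - (\<Sum>j\<le>m. - s j / z ^ (j + 1))) / (1 / z ^ (m + 1))"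
  using tail_expand[OF assms, of s f 0 "Suc m"] assms
  by (simp add: sum_negf lessThan_Suc_atMost field_simps del: sum.lessThan_Suc)

lemma tail_lim_lower:
  assumes \<zeta>: "filterlim \<zeta> at_infinity F" and top: "((\<lambda>y. tail s (f y) (\<zeta> y) (Suc M)) \<longlongrightarrow> 0) F"
    and "m \<le> M"
  shows "((\<lambda>y. tail s (f y) (\<zeta> y) (Suc m)) \<longlongrightarrow> 0) F"
proof -
  have inv: "((\<lambda>y. 1 / \<zeta> y) \<longlongrightarrow> 0) F"
    by (rule tendsto_divide_0[OF tendsto_const \<zeta>])
  have "((\<lambda>y. tail s (f y) (\<zeta> y) (Suc M) * (1 / \<zeta> y) ^ (M - m) - (\<Sum>l<M - m. s (Suc m + l) * (1 / \<zeta> y) ^ (l + 1)))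
     \<longlongrightarrow> 0 * 0 ^ (M - m) - (\<Sum>l<M - m. s (Suc m + l) * 0 ^ (l + 1))) F"
    by (intro tendsto_intros top inv)
  moreover have "\<forall>\<^sub>F y in F. \<zeta> y \<noteq> 0"
    using \<zeta> by (simp add: filterlim_at_infinity_imp_eventually_ne)
  then have "\<forall>\<^sub>F y in F. tail s (f y) (\<zeta> y) (Suc M) * (1 / \<zeta> y) ^ (M - m) - (\<Sum>l<M - m. s (Suc m + l) * (1 / \<zeta> y) ^ (l + 1))
     = tail s (f y) (\<zeta> y) (Suc m)"
  proof eventually_elim
    case (elim y)
    have "Suc m + (M - m) = Suc M" using assms(3) by simp
    then show ?case using tail_expand[OF elim, of s "f y" "Suc m" "M - m"] by (simp add: power_divide)
  qed
  ultimately show ?thesis by (simp add: tendsto_cong)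
qed

lemma nontangential_le: "nontangential \<delta> \<le> at_infinity"
  by (simp add: nontangential_def)

lemma filterlim_ray_at_infinity:
  "filterlim (\<lambda>y. complex_of_real y * node k) at_infinity at_top"
  by (intro tendsto_mult_filterlim_at_infinity[of "\<lambda>_. node k" "node k" at_top complex_of_real, simplified mult.commute]
          filterlim_of_real_at_infinity) auto

lemma Arg_node [simp]: "Arg (node k) = pi / 2"
proof -
  have "node k = complex_of_real (real (Suc k)) * \<i>"
    by (simp add: node_def mult_ac)
  then show ?thesis by (simp only: Arg_times_of_real Arg_ii of_nat_0_less_iff zero_less_Suc)
qed

lemma filterlim_ray_nontangential:
  "filterlim (\<lambda>y. complex_of_real y * node k) (nontangential 1) at_top"
proof -
  have "\<forall>\<^sub>F y in at_top. complex_of_real y * node k \<in> {z. 1 < Arg z \<and> Arg z < pi - 1}"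
    using eventually_gt_at_top[of "0 :: real"] by eventually_elim (use pi_gt3 in \<open>simp\<close>)
  then show ?thesis
    unfolding nontangential_def filterlim_inf filterlim_principal
    using filterlim_ray_at_infinity by blast
qed

lemma tail_nontangential:
  assumes "(\<lambda>z. \<phi> z - (\<Sum>j\<le>M. - complex_of_real (s j) / z ^ (j + 1))) \<in> o[nontangential \<delta>](\<lambda>z. 1 / z ^ (M + 1))"
  shows "((\<lambda>z. tail (\<lambda>i. of_real (s i)) (\<phi> z) z (Suc M)) \<longlongrightarrow> 0) (nontangential \<delta>)"
proof -
  have "\<forall>\<^sub>F z in nontangential \<delta>. z \<noteq> (0 :: complex)"
    by (rule filter_leD[OF nontangential_le]) (rule eventually_not_equal_at_infinity)
  then have "\<forall>\<^sub>F z in nontangential \<delta>. (\<phi> z - (\<Sum>j\<le>M. - complex_of_real (s j) / z ^ (j + 1))) / (1 / z ^ (M + 1))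
      = tail (\<lambda>i. of_real (s i)) (\<phi> z) z (Suc M)"
    by eventually_elim (rule tail_eq_quotient[symmetric])
  then show ?thesis using smalloD_tendsto[OF assms] by (simp only: tendsto_cong)
qed

text \<open>A meromorphic \<phi> may have poles, but the expansion bounds it on the far part of an
  open sector, hence on a punctured neighbourhood of every far point of the ray.\<close>

lemma eventually_analytic_on_ray:
  assumes mero: "\<phi> nicely_meromorphic_on {z. Im z > 0}"
    and lim: "((\<lambda>z. tail s (\<phi> z) z M) \<longlongrightarrow> 0) (nontangential 1)"
  shows "\<forall>\<^sub>F y in at_top. \<phi> analytic_on {complex_of_real y * node k}"
proof -
  have "\<forall>\<^sub>F z in nontangential 1. norm (tail s (\<phi> z) z M) < 1"
    using tendstoD[OF lim, of 1] by simp
  then have "\<forall>\<^sub>F z in at_infinity. 1 < Arg z \<and> Arg z < pi - 1 \<longrightarrow> norm (tail s (\<phi> z) z M) < 1"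
    unfolding nontangential_def eventually_inf_principal by simp
  then obtain R where R: "\<And>z. R \<le> norm z \<Longrightarrow> 1 < Arg z \<and> Arg z < pi - 1 \<Longrightarrow> norm (tail s (\<phi> z) z M) < 1"
    unfolding eventually_at_infinity by blast
  have "\<forall>\<^sub>F y in at_top. y > 0 \<and> R < y"
    using eventually_gt_at_top[of "0 :: real"] eventually_gt_at_top[of R] by (rule eventually_conj)
  then show ?thesis
  proof eventually_elim
    case (elim y)
    define z where "z = complex_of_real y * node k"
    have y1: "y \<le> norm z"
      using elim by (simp add: z_def node_def norm_mult del: of_nat_Suc)
    have Argz: "Arg z = pi / 2" using elim by (simp add: z_def)
    have Imz: "Im z > 0" using elim by (simp add: z_def Im_node)
    have z0: "z \<noteq> 0" using Imz by auto
    have "z \<notin> \<real>\<^sub>\<le>\<^sub>0" using Imz by (auto simp: complex_nonpos_Reals_iff)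
    then have "isCont Arg z" by (rule continuous_at_Arg)
    then have "Arg \<midarrow>z\<rightarrow> pi / 2" unfolding isCont_def Argz .
    then have ev1: "\<forall>\<^sub>F x in at z. 1 < Arg x" "\<forall>\<^sub>F x in at z. Arg x < pi - 1"
      using pi_gt3 by (auto intro!: order_tendstoD)
    have "((\<lambda>x. norm x) \<longlongrightarrow> norm z) (at z)" by (intro tendsto_intros)
    then have ev2: "\<forall>\<^sub>F x in at z. R < norm x" using y1 elim by (intro order_tendstoD) auto
    have zlim: "(\<lambda>x. x) \<midarrow>z\<rightarrow> z" by (rule tendsto_ident_at)
    have "((\<lambda>x. norm (\<Sum>l<M. s (0 + l) / x ^ (l + 1)) + norm (1 / x ^ M))
        \<longlongrightarrow> norm (\<Sum>l<M. s (0 + l) / z ^ (l + 1)) + norm (1 / z ^ M)) (at z)"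
      using z0 by (intro tendsto_intros) auto
    define B where "B = norm (\<Sum>l<M. s (0 + l) / z ^ (l + 1)) + norm (1 / z ^ M) + 1"
    have ev3: "\<forall>\<^sub>F x in at z. norm (\<Sum>l<M. s (0 + l) / x ^ (l + 1)) + norm (1 / x ^ M) < B"
      using order_tendstoD(2)[OF \<open>((\<lambda>x. norm (\<Sum>l<M. s (0 + l) / x ^ (l + 1)) + norm (1 / x ^ M))
        \<longlongrightarrow> norm (\<Sum>l<M. s (0 + l) / z ^ (l + 1)) + norm (1 / z ^ M)) (at z)\<close>, of B] by (simp add: B_def)
    have ev4: "\<forall>\<^sub>F x in at z. x \<noteq> 0"
      using tendsto_imp_eventually_ne[OF zlim z0] .
    have bound: "\<forall>\<^sub>F x in at z. norm (\<phi> x) \<le> B"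
      using ev1 ev2 ev3 ev4
    proof eventually_elim
      case (elim x)
      have "norm (tail s (\<phi> x) x M) < 1" using R[of x] elim by simp
      then have "norm (tail s (\<phi> x) x M / x ^ M) \<le> norm (1 / x ^ M)"
        by (simp add: norm_divide divide_right_mono)
      moreover have "\<phi> x = tail s (\<phi> x) x M / x ^ M - (\<Sum>l<M. s (0 + l) / x ^ (l + 1))"
        using tail_expand[OF elim(5), of s "\<phi> x" 0 M] by simp
      then have "norm (\<phi> x) \<le> norm (tail s (\<phi> x) x M / x ^ M) + norm (\<Sum>l<M. s (0 + l) / x ^ (l + 1))"
        by (metis norm_triangle_ineq4)
      ultimately show ?case using elim(4) by linarith
    qed
    have "\<not> is_pole \<phi> z"
    proof
      assume "is_pole \<phi> z"
      then have "\<forall>r>0. \<forall>\<^sub>F x in at z. norm (\<phi> x) \<ge> r"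
        unfolding is_pole_def filterlim_at_infinity[OF order_refl] .
      moreover have "B + 1 > 0" unfolding B_def by (intro add_nonneg_pos add_nonneg_nonneg norm_ge_zero) auto
      ultimately have "\<forall>\<^sub>F x in at z. norm (\<phi> x) \<ge> B + 1" by blast
      with bound have "\<forall>\<^sub>F x in at z. False" by eventually_elim simp
      then show False by simp
    qed
    then show ?case
      using nicely_meromorphic_on_imp_analytic_at[OF mero, of z] Imz by (simp add: z_def)
  qed
qed

lemma moment_asymptotics_exists:
  assumes "\<And>k. ((\<lambda>y. tail (\<lambda>i. of_real (s i)) (\<phi> (of_real y * node k)) (of_real y * node k) (Suc (2 * n)))
    \<longlongrightarrow> 0) at_top"
  obtains W where "moment_asymptotics \<phi> s n W"
proof -
  have "inj_on (\<lambda>k. 1 / node k) {..n}"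
    by (auto simp: inj_on_def)
  then obtain W where W: "\<And>a b. a \<le> n \<Longrightarrow> b \<le> n \<Longrightarrow>
      (\<Sum>k\<le>n. W a k * (1 / node k) ^ (b + 1)) = (if a = b then 1 else 0)"
    using vandermonde_left_inverse[of "\<lambda>k. 1 / node k" n] by (auto simp del: power_Suc)
  have "moment_asymptotics \<phi> s n W"
  proof
    fix m k :: nat assume "m \<le> 2 * n"
    then show "((\<lambda>y. tail (\<lambda>i. of_real (s i)) (\<phi> (of_real y * node k)) (of_real y * node k) (Suc m)) \<longlongrightarrow> 0) at_top"
      by (intro tail_lim_lower[OF filterlim_ray_at_infinity assms])
  qed (rule W)
  then show ?thesis using that by blast
qed

lemma MP_solution_asymptotics:
  assumes "MP_solution \<kappa> s n \<phi>"
  obtains W where "moment_asymptotics \<phi> s n W"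
    and "\<And>k. \<forall>\<^sub>F y in at_top. \<phi> analytic_on {complex_of_real y * node k}"
    and "\<phi> \<in> gen_nevanlinna \<kappa>"
proof -
  have gn: "\<phi> \<in> gen_nevanlinna \<kappa>"
    using assms by (auto simp: MP_solution_def gen_nevanlinna_asymp_def split: if_splits)
  then have mero: "\<phi> nicely_meromorphic_on {z. Im z > 0}" by (simp add: gen_nevanlinna_def)
  have lim: "((\<lambda>z. tail (\<lambda>i. of_real (s i)) (\<phi> z) z (Suc (2 * n))) \<longlongrightarrow> 0) (nontangential 1)"
    using assms by (intro tail_nontangential) (simp add: MP_solution_def)
  have an: "\<forall>\<^sub>F y in at_top. \<phi> analytic_on {complex_of_real y * node k}" for k
    by (rule eventually_analytic_on_ray[OF mero lim])
  obtain W where "moment_asymptotics \<phi> s n W"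
    using moment_asymptotics_exists[OF filterlim_compose[OF lim filterlim_ray_nontangential]] .
  then show ?thesis using that an gn by blast
qed

lemma MP_solution_recursion:
  assumes sol: "MP_solution (neg_eigenvalues (hankel s n)) s n \<phi>"
    and u: "r \<le> n" "\<And>k. k \<le> n \<Longrightarrow> (\<Sum>i\<le>r. u i * s (i + k)) = 0"
  shows "Im \<omega> > 0 \<Longrightarrow> \<phi> analytic_on {\<omega>} \<Longrightarrow>
      \<phi> \<omega> * peval (\<lambda>i. of_real (u i)) r \<omega> + qeval (\<lambda>i. of_real (u i)) (\<lambda>i. of_real (s i)) r \<omega> = 0"
    and "k + r \<le> 2 * n \<Longrightarrow> (\<Sum>i\<le>r. u i * s (i + k)) = 0"
proof -
  obtain W where W: "moment_asymptotics \<phi> s n W"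
    and an: "\<And>k. \<forall>\<^sub>F y in at_top. \<phi> analytic_on {complex_of_real y * node k}"
    and gn: "\<phi> \<in> gen_nevanlinna (neg_eigenvalues (hankel s n))"
    using MP_solution_asymptotics[OF sol] by blast
  interpret moment_asymptotics \<phi> s n W by (rule W)
  have neg: "neg_eigenvalues (kernel_matrix \<phi> m w) \<le> neg_eigenvalues (hankel s n)" if "holomorphy_points \<phi> m w" for m w
    using gn that by (simp add: gen_nevanlinna_def)
  show *: "\<phi> \<omega> * peval (\<lambda>i. of_real (u i)) r \<omega> + qeval (\<lambda>i. of_real (u i)) S r \<omega> = 0"
    if "Im \<omega> > 0" "\<phi> analytic_on {\<omega>}" for \<omega>
    by (rule kernel_of_solution[OF neg an that u])
  assume k: "k + r \<le> 2 * n"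
  have "\<forall>\<^sub>F y in at_top. \<phi> (pt y 0) * peval (\<lambda>i. of_real (u i)) r (pt y 0)
      + qeval (\<lambda>i. of_real (u i)) S r (pt y 0) = 0"
    using an[of 0] eventually_gt_at_top[of "0 :: real"]
    by eventually_elim (rule *, simp_all add: Im_node)
  from recursion_of_tail[OF _ this tail_lim k]
  have "(\<Sum>a\<le>r. complex_of_real (u a) * S (a + k)) = 0" by simp
  then have "complex_of_real (\<Sum>a\<le>r. u a * s (a + k)) = 0" by simp
  then show "(\<Sum>i\<le>r. u i * s (i + k)) = 0" by (simp only: of_real_eq_0_iff)
qed

section \<open>The constructed solution: membership in the class, asymptotics, uniqueness\<close>

lemma cnj_peval: "cnj (peval (\<lambda>i. of_real (u i)) r z) = peval (\<lambda>i. of_real (u i)) r (cnj z)"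
  by (simp add: peval_def)

lemma cnj_quot: "cnj (quot (\<lambda>i. of_real (u i)) r z i) = quot (\<lambda>i. of_real (u i)) r (cnj z) i"
  by (simp add: quot_def)

lemma cnj_qeval: "cnj (qeval (\<lambda>i. of_real (u i)) (\<lambda>i. of_real (s i)) r z)
    = qeval (\<lambda>i. of_real (u i)) (\<lambda>i. of_real (s i)) r (cnj z)"
  by (simp add: qeval_def cnj_quot)

lemma peval_analytic: "peval u r analytic_on A"
  unfolding peval_def by (intro analytic_intros)

lemma qeval_analytic: "qeval u s r analytic_on A"
  unfolding qeval_def quot_def by (intro analytic_intros)

lemma finite_zeros_peval:
  assumes "u r = 1"
  shows "finite {z. peval u r z = 0}"
proof -
  define p where "p = (\<Sum>a\<le>r. monom (u a) a)"
  have "poly p z = peval u r z" for z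
    by (simp add: p_def peval_def poly_sum poly_monom)
  moreover have "coeff p r = 1" using assms by (simp add: p_def coeff_sum)
  then have "p \<noteq> 0" by auto
  then have "finite {z. poly p z = 0}" by (rule poly_roots_finite)
  ultimately show ?thesis by simp
qed

lemma eventually_peval_nz:
  assumes "u r = 1"
  shows "\<forall>\<^sub>F z in at w. peval u r z \<noteq> 0"
  using islimpt_finite[OF finite_zeros_peval[where u = u and r = r, OF assms]] by (simp add: islimpt_iff_eventually)

lemma eventually_peval_nz_at_infinity:
  assumes "u r = 1"
  shows "\<forall>\<^sub>F z in at_infinity. peval u r z \<noteq> 0"
proof -
  obtain B where "\<And>z. peval u r z = 0 \<Longrightarrow> norm z \<le> B"
    using finite_imp_bounded[OF finite_zeros_peval[where u = u and r = r, OF assms]] unfolding bounded_iff by auto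
  then have "\<And>z. norm z \<ge> B + 1 \<Longrightarrow> peval u r z \<noteq> 0" by fastforce
  then show ?thesis unfolding eventually_at_infinity by blast
qed

locale hankel_recursion =
  fixes s :: "nat \<Rightarrow> real" and n r :: nat and u :: "nat \<Rightarrow> real"
  assumes recursion: "recursion s n r u"
begin

abbreviation "S \<equiv> \<lambda>i. complex_of_real (s i)"
abbreviation "P \<equiv> peval (\<lambda>i. complex_of_real (u i)) r"
abbreviation "Q \<equiv> qeval (\<lambda>i. complex_of_real (u i)) S r"
abbreviation "D \<equiv> quot (\<lambda>i. complex_of_real (u i)) r"

text \<open>At the zeros of \<open>P\<close>, which are its poles, the value is \<open>0\<close> by \<open>x / 0 = 0\<close>, as required by
  \<^const>\<open>nicely_meromorphic_on\<close>.\<close>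

definition sol :: "complex \<Rightarrow> complex" where "sol z = - Q z / P z"

lemma r_le: "r \<le> n" and det: "Determinant.det (sq_hankel s r) \<noteq> 0" and monic: "u r = 1"
  and rec: "k + r \<le> 2 * n \<Longrightarrow> (\<Sum>i\<le>r. u i * s (i + k)) = 0"
  using recursion by (auto simp: recursion_def)

lemma rec_complex: "k + r \<le> 2 * n \<Longrightarrow> (\<Sum>i\<le>r. complex_of_real (u i) * S (i + k)) = 0"
  using arg_cong[OF rec[of k], of complex_of_real] by simp

lemma Q_nz:
  assumes "P z = 0"
  shows "Q z \<noteq> 0"
proof
  assume Q: "Q z = 0"
  show False
  proof (cases r)
    case 0
    then show False using assms monic by (simp add: peval_def)
  next
    case (Suc q)
    \<comment> \<open>Since \<open>s\<close> is real, the real parts of a complex kernel vector form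
      a real one. Its last entry is the leading coefficient \<open>u r\<close> = 1, so it is
      nonzero.\<close>
    define v where "v = (\<lambda>i. Re (D z i))"
    have "(\<Sum>i<r. v i * s (i + k)) = 0" if "k < r" for k
    proof -
      have "(\<Sum>i<r. D z i * S (i + k)) = 0"
        by (rule common_zero_kernel[OF rec_complex assms Q that]) (use r_le in auto)
      then have "Re (\<Sum>i<r. D z i * S (i + k)) = 0" by simp
      then show ?thesis by (simp add: v_def)
    qed
    moreover have "v q = 1" using Suc monic by (simp add: v_def quot_def)
    moreover have "q < r" using Suc by simp
    ultimately show False
      using det unfolding det_sq_hankel_eq_0_iff by (metis zero_neq_one)
  qed
qed

lemma sol_eqI:
  assumes "P z \<noteq> 0" "f * P z + Q z = 0"
  shows "f = sol z"
proof -
  have "f * P z = - Q z" using assms(2) by (simp only: eq_neg_iff_add_eq_0)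
  then show ?thesis unfolding sol_def using assms(1) by (metis nonzero_mult_div_cancel_right)
qed

lemma sol_cnj: "sol (cnj z) = cnj (sol z)"
  by (simp add: sol_def cnj_peval cnj_qeval)

lemma sol_analytic: "P z \<noteq> 0 \<Longrightarrow> sol analytic_on {z}"
  unfolding sol_def
  by (intro analytic_on_divide analytic_on_neg peval_analytic[of _ _ "{z}"] qeval_analytic[of _ _ _ "{z}"]) auto

lemma sol_pole:
  assumes "P z = 0"
  shows "is_pole sol z" "sol z = 0"
proof -
  have "isCont (\<lambda>z. - Q z) z"
    using qeval_analytic[of _ _ _ "{z}"] by (intro continuous_intros analytic_at_imp_isCont)
  moreover have "isCont P z" using peval_analytic by (rule analytic_at_imp_isCont)
  then have "filterlim P (at 0) (at z)"
    using eventually_peval_nz[of "\<lambda>i. of_real (u i)" r z] monic assms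
    unfolding filterlim_at isCont_def by (simp add: eventually_mono)
  ultimately show "is_pole sol z"
    unfolding sol_def using Q_nz[OF assms] by (intro is_pole_divide) auto
qed (use assms in \<open>simp add: sol_def\<close>)

lemma sol_analytic_iff: "sol analytic_on {z} \<longleftrightarrow> P z \<noteq> 0"
  using sol_analytic sol_pole(1) analytic_at_imp_no_pole by blast

lemma sol_nicely_meromorphic: "sol nicely_meromorphic_on A"
  unfolding nicely_meromorphic_on_def
proof (intro conjI ballI)
  show "sol meromorphic_on A"
    unfolding sol_def
    by (intro meromorphic_intros analytic_on_imp_meromorphic_on peval_analytic qeval_analytic)
  fix z assume "z \<in> A"
  show "is_pole sol z \<and> sol z = 0 \<or> sol \<midarrow>z\<rightarrow> sol z"
    using sol_pole sol_analytic analytic_at_imp_isCont unfolding isCont_def by blast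
qed

lemma neg_eigenvalues_reduced: "neg_eigenvalues (chankel s r) = neg_eigenvalues (hankel s n)"
  unfolding neg_eigenvalues_hankel
  by (rule neg_eigenvalues_chankel_recursive[of r "n + 1" u, symmetric]) (use r_le monic rec in auto)

lemma neg_eigenvalues_kernel_le:
  assumes "holomorphy_points sol m w"
  shows "neg_eigenvalues (kernel_matrix sol m w) \<le> neg_eigenvalues (hankel s n)"
proof -
  have "neg_eigenvalues (kernel_matrix sol m w) \<le> neg_eigenvalues (chankel s r)"
  proof (rule neg_eigenvalues_congruence[where C = "\<lambda>i j. D (w i) j / P (w i)" and n = r])
    fix i k assume i: "i < m" and k: "k < m"
    have "P (w i) \<noteq> 0" "P (w k) \<noteq> 0"
      using assms i k by (auto simp: holomorphy_points_def sol_analytic_iff)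
    then have P: "P (w i) \<noteq> 0" "P (cnj (w k)) \<noteq> 0"
      by (simp_all add: cnj_peval[symmetric])
    have "Im (w i) > 0" "Im (w k) > 0" using assms i k by (auto simp: holomorphy_points_def)
    then have ne: "w i - cnj (w k) \<noteq> 0" by (auto simp: complex_eq_iff)
    have "hform (chankel s r) (\<lambda>j. D (w i) j / P (w i)) (\<lambda>j. D (w k) j / P (w k))
      = (\<Sum>a<r. \<Sum>b<r. D (w i) a * S (a + b) * D (cnj (w k)) b) / (P (w i) * P (cnj (w k)))"
      by (simp add: hform_def chankel_def cnj_quot cnj_peval sum_divide_distrib mult_ac)
    also have "(\<Sum>a<r. \<Sum>b<r. D (w i) a * S (a + b) * D (cnj (w k)) b)
      = (\<Sum>b<r. (\<Sum>a<r. D (w i) a * S (a + b)) * D (cnj (w k)) b)"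
      unfolding sum_distrib_right by (rule sum.swap)
    also have "\<dots> = (Q (cnj (w k)) * P (w i) - Q (w i) * P (cnj (w k))) / (w i - cnj (w k))"
      using quot_bezout[OF rec_complex, of "w i" "cnj (w k)"] ne r_le
      by (simp add: field_simps)
    also have "\<dots> / (P (w i) * P (cnj (w k))) = (sol (w i) - sol (cnj (w k))) / (w i - cnj (w k))"
      using P ne by (simp add: sol_def field_simps)
    finally show "kernel_matrix sol m w $$ (i, k) = hform (chankel s r) (\<lambda>j. D (w i) j / P (w i)) (\<lambda>j. D (w k) j / P (w k))"
      using i k by (simp add: kernel_matrix_def sol_cnj)
  qed auto
  then show ?thesis by (simp add: neg_eigenvalues_reduced)
qed

lemma sol_tail: "((\<lambda>z. tail S (sol z) z (Suc (2 * n))) \<longlongrightarrow> 0) at_infinity"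
proof -
  have "\<forall>\<^sub>F z in at_infinity. sol z * P z + Q z = 0"
    using eventually_peval_nz_at_infinity[of "\<lambda>i. of_real (u i)" r] monic
    by (auto elim!: eventually_mono simp: sol_def)
  \<comment> \<open>The shift 2 n + 1 - r uses precisely the available relations j + r \<le> 2 n and
    brings the tail index to 2 n + 1.\<close>
  then have "((\<lambda>z. tail S (sol z) z (2 * n + 1 - r + r)) \<longlongrightarrow> 0) at_infinity"
    by (intro tail_tendsto_0[of "\<lambda>i. of_real (u i)"]) (use monic rec_complex r_le in auto)
  then show ?thesis using r_le by simp
qed

lemma sol_gen_nevanlinna: "sol \<in> gen_nevanlinna (neg_eigenvalues (hankel s n))"
proof -
  let ?\<kappa> = "neg_eigenvalues (hankel s n)"
  obtain W where W: "moment_asymptotics sol s n W"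
    using moment_asymptotics_exists[OF filterlim_compose[OF sol_tail filterlim_ray_at_infinity]] .
  have an: "\<forall>\<^sub>F y in at_top. sol analytic_on {complex_of_real y * node k}" for k
    unfolding sol_analytic_iff
    using eventually_peval_nz_at_infinity[of "\<lambda>i. of_real (u i)" r] monic
    by (intro eventually_compose_filterlim[OF _ filterlim_ray_at_infinity]) simp
  have "\<exists>m w. holomorphy_points sol m w \<and> neg_eigenvalues (kernel_matrix sol m w) = ?\<kappa>"
  proof (rule ccontr)
    assume "\<not> ?thesis"
    then have lt: "neg_eigenvalues (kernel_matrix sol m w) < ?\<kappa>" if "holomorphy_points sol m w" for m w
      using neg_eigenvalues_kernel_le[OF that] that by (metis le_neq_implies_less)
    then have "neg_eigenvalues (kernel_matrix sol m w) \<le> ?\<kappa> - 1" if "holomorphy_points sol m w" for m w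
      using that by fastforce
    \<comment> \<open>If the bound were never attained, the limit argument would give \<kappa> \<le>
      \<kappa> - 1, hence \<kappa> = 0 by truncated subtraction; but the empty family of points
      attains 0.\<close>
    from moment_asymptotics.neg_eigenvalues_hankel_le[OF W this an] have "?\<kappa> = 0" by simp
    then show False using lt[of 0 "\<lambda>_. 0"] by (simp add: holomorphy_points_def)
  qed
  then show ?thesis
    unfolding gen_nevanlinna_def using sol_nicely_meromorphic neg_eigenvalues_kernel_le sol_cnj by blast
qed

lemma sol_MP_solution: "MP_solution (neg_eigenvalues (hankel s n)) s n sol"
  unfolding MP_solution_def
proof (intro conjI allI impI)
  let ?\<kappa> = "neg_eigenvalues (hankel s n)"
  have nz: "\<forall>\<^sub>F z in nontangential \<delta>. z \<noteq> (0 :: complex)" for \<delta>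
    by (rule filter_leD[OF nontangential_le]) (rule eventually_not_equal_at_infinity)
  have lim: "((\<lambda>z. tail S (sol z) z (Suc (2 * n))) \<longlongrightarrow> 0) (nontangential \<delta>)" for \<delta>
    using sol_tail nontangential_le by (rule tendsto_mono[rotated])
  show "(\<lambda>z. sol z - (\<Sum>j\<le>2 * n. - S j / z ^ (j + 1))) \<in> o[nontangential \<delta>](\<lambda>z. 1 / z ^ (2 * n + 1))" for \<delta>
  proof (rule smalloI_tendsto)
    have "\<forall>\<^sub>F z in nontangential \<delta>. tail S (sol z) z (Suc (2 * n))
        = (sol z - (\<Sum>j\<le>2 * n. - S j / z ^ (j + 1))) / (1 / z ^ (2 * n + 1))"
      using nz by eventually_elim (rule tail_eq_quotient)
    then show "((\<lambda>z. (sol z - (\<Sum>j\<le>2 * n. - S j / z ^ (j + 1))) / (1 / z ^ (2 * n + 1))) \<longlongrightarrow> 0) (nontangential \<delta>)"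
      using lim[of \<delta>] by (simp only: tendsto_cong)
    show "\<forall>\<^sub>F z in nontangential \<delta>. 1 / z ^ (2 * n + 1) \<noteq> 0"
      using nz by eventually_elim simp
  qed
  show "sol \<in> gen_nevanlinna_asymp ?\<kappa> n"
  proof (cases "n = 0")
    case True
    \<comment> \<open>For n = 0 the class has its own definition; there r \<le> n leaves only the
      zero function.\<close>
    then have "r = 0" using r_le by simp
    then have "Q z = 0" for z by (simp add: qeval_def)
    then have "sol = (\<lambda>_. 0)" unfolding sol_def by simp
    moreover have "Limsup (nontangential \<delta>) (\<lambda>z. ereal 0) \<le> 0" for \<delta>
      by (rule Limsup_bounded) simp
    then have "Limsup (nontangential \<delta>) (\<lambda>z. ereal 0) < \<infinity>" for \<delta>
      by (rule le_less_trans) simp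
    ultimately show ?thesis
      using True sol_gen_nevanlinna by (auto simp: gen_nevanlinna_asymp_def zero_ereal_def)
  next
    case False
    \<comment> \<open>The constants of the class are \<gamma> = 0 and c = s. Multiplied by z, the
      scaled remainder tends to - s (2 n).\<close>
    have "(\<lambda>z. z ^ (2 * n) * (sol z - complex_of_real 0
              + (\<Sum>j = 1..2 * n. S (j - 1) / z ^ j))) \<in> O[nontangential \<delta>](\<lambda>z. 1 / z)" for \<delta>
    proof (rule bigoI_tendsto)
      have "((\<lambda>z. tail S (sol z) z (Suc (2 * n)) - S (2 * n)) \<longlongrightarrow> 0 - S (2 * n)) (nontangential \<delta>)"
        by (intro tendsto_diff lim tendsto_const)
      moreover have "\<forall>\<^sub>F z in nontangential \<delta>. tail S (sol z) z (Suc (2 * n)) - S (2 * n)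
         = (z ^ (2 * n) * (sol z - complex_of_real 0 + (\<Sum>j = 1..2 * n. S (j - 1) / z ^ j))) / (1 / z)"
        using nz
      proof eventually_elim
        case (elim z)
        have "(\<Sum>j = 1..2 * n. S (j - 1) / z ^ j) = (\<Sum>l<2 * n. S (0 + l) / z ^ (l + 1))"
          by (rule sum.reindex_bij_witness[of _ Suc "\<lambda>j. j - 1"]) auto
        then show ?case
          using tail_expand[OF elim, of S "sol z" 0 "2 * n"] elim by (simp add: field_simps)
      qed
      ultimately show "((\<lambda>z. (z ^ (2 * n) * (sol z - complex_of_real 0 + (\<Sum>j = 1..2 * n. S (j - 1) / z ^ j))) / (1 / z))
          \<longlongrightarrow> 0 - S (2 * n)) (nontangential \<delta>)"
        by (simp only: tendsto_cong)
      show "\<forall>\<^sub>F z in nontangential \<delta>. 1 / z \<noteq> (0 :: complex)"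
        using nz by eventually_elim simp
    qed
    then show ?thesis
      using False sol_gen_nevanlinna unfolding gen_nevanlinna_asymp_def
      by (simp only: if_False mem_Collect_eq) (intro conjI exI[of _ 0] exI[of _ s]; blast)
  qed
qed

lemma MP_solution_unique:
  assumes mp: "MP_solution (neg_eigenvalues (hankel s n)) s n \<phi>" and "Im z \<noteq> 0"
  shows "\<phi> z = sol z"
proof -
  have gn: "\<phi> \<in> gen_nevanlinna (neg_eigenvalues (hankel s n))"
    using MP_solution_asymptotics[OF mp] by blast
  then have mero: "\<phi> nicely_meromorphic_on {z. Im z > 0}"
    and sym: "\<And>z. Im z > 0 \<Longrightarrow> \<phi> (cnj z) = cnj (\<phi> z)" by (auto simp: gen_nevanlinna_def)
  have eq: "\<phi> z * P z + Q z = 0" if "Im z > 0" "\<phi> analytic_on {z}" for z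
    by (rule MP_solution_recursion(1)[OF mp r_le rec that]) (use r_le in auto)
  have upper: "\<phi> z = sol z" if z: "Im z > 0" for z
  proof (cases "\<phi> analytic_on {z}")
    case True
    \<comment> \<open>A zero of \<open>P\<close> at an analytic point would make \<open>Q\<close>
      vanish there too.\<close>
    then have "P z \<noteq> 0" using eq[OF z] Q_nz[of z] by auto
    then show ?thesis by (rule sol_eqI[OF _ eq[OF z True]])
  next
    case False
    then have pole: "is_pole \<phi> z"
      using nicely_meromorphic_on_imp_analytic_at[OF mero] z by blast
    then have phi0: "\<phi> z = 0"
      using mero z unfolding nicely_meromorphic_on_def is_pole_def
      using not_tendsto_and_filterlim_at_infinity[OF at_neq_bot] by blast
    \<comment> \<open>Otherwise \<phi> would agree with the continuous \<open>sol\<close> on a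
      punctured neighbourhood of its pole. At a zero of \<open>P\<close> both functions have the
      normalized value 0.\<close>
    have "P z = 0"
    proof (rule ccontr)
      assume Pz: "P z \<noteq> 0"
      have "\<phi> meromorphic_on {z}"
        using mero z by (auto simp: nicely_meromorphic_on_def intro: meromorphic_on_subset)
      then have "isolated_singularity_at \<phi> z"
        by (simp add: meromorphic_on_altdef)
      then have "\<forall>\<^sub>F x in at z. \<phi> analytic_on {x}"
        by (simp add: isolated_singularity_at_altdef)
      moreover have "\<forall>\<^sub>F x in at z. Im x > 0"
        using z by (intro order_tendstoD(1)[of Im "Im z"] tendsto_intros)
      moreover have "\<forall>\<^sub>F x in at z. P x \<noteq> 0"
        using eventually_peval_nz[of "\<lambda>i. of_real (u i)" r z] monic by simp
      ultimately have "\<forall>\<^sub>F x in at z. sol x = \<phi> x"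
      proof eventually_elim
        case (elim x)
        then show ?case using sol_eqI[of x "\<phi> x"] eq[of x] by metis
      qed
      moreover have "sol \<midarrow>z\<rightarrow> sol z"
        using sol_analytic[OF Pz] analytic_at_imp_isCont unfolding isCont_def by blast
      ultimately have "\<phi> \<midarrow>z\<rightarrow> sol z" by (simp add: tendsto_cong)
      then show False
        using pole unfolding is_pole_def
        using not_tendsto_and_filterlim_at_infinity[OF at_neq_bot] by blast
    qed
    then show ?thesis using phi0 by (simp add: sol_def)
  qed
  show ?thesis
  proof (cases "Im z > 0")
    case False
    then have "Im (cnj z) > 0" using assms(2) by simp
    then have "\<phi> z = cnj (sol (cnj z))" using sym[of "cnj z"] upper[of "cnj z"] by simp
    then show ?thesis by (simp add: sol_cnj)
  qed (rule upper)
qed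

end

section \<open>Identification with the polynomials of the first and second kind\<close>

lemma moment_functional_eq:
  assumes "\<And>j. N \<le> j \<Longrightarrow> coeff p j = 0"
  shows "moment_functional s p = (\<Sum>j<N. coeff p j * of_real (s j))"
proof -
  have "moment_functional s p = (\<Sum>j<N + Suc (degree p). coeff p j * of_real (s j))"
    unfolding moment_functional_def by (intro sum.mono_neutral_left) (auto simp: coeff_eq_0)
  also have "\<dots> = (\<Sum>j<N. coeff p j * of_real (s j))"
    by (intro sum.mono_neutral_right) (use assms in auto)
  finally show ?thesis .
qed

lemma comm_ring_hom_const_poly: "comm_ring_hom (\<lambda>x :: 'a :: comm_ring_1. [:x:])"
  by unfold_locales (auto simp: one_pCons)

lemma det_const_hankel:
  "Determinant.det (Matrix.mat m m (\<lambda>(i, j). [:complex_of_real (s (i + j)):]))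
    = [:complex_of_real (Determinant.det (sq_hankel s m)):]"
proof -
  have "Matrix.mat m m (\<lambda>(i, j). [:complex_of_real (s (i + j)):])
      = map_mat (\<lambda>x. [:x:]) (map_mat complex_of_real (sq_hankel s m))"
    by (rule eq_matI) (auto simp: sq_hankel_def)
  then show ?thesis by (simp only: comm_ring_hom.hom_det[OF comm_ring_hom_const_poly] of_real_hom.hom_det)
qed

context hankel_recursion
begin

definition mpoly :: "complex poly" where
  "mpoly = (\<Sum>a\<le>r. monom (of_real (u a)) a)"

lemma poly_mpoly: "poly mpoly z = P z"
  by (simp add: mpoly_def peval_def poly_sum poly_monom)

text \<open>Adding \<open>u\<^sub>k\<close> times the \<open>k\<close>-th column to the last one for all \<open>k < r\<close> clears the last column above its
  bottom entry, which becomes the polynomial with coefficients \<open>u\<close>.\<close>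

lemma poly_first_kind_eq:
  "poly_first_kind s r = Polynomial.smult (of_real (Determinant.det (sq_hankel s r))) mpoly"
proof -
  define A where "A = Matrix.mat (r + 1) (r + 1)
       (\<lambda>(i, j). if i < r then [:complex_of_real (s (i + j)):] else monom 1 j)"
  define C where "C = Matrix.mat (r + 1) (r + 1)
       (\<lambda>(i, j). if j = r then [:complex_of_real (u i):] else if i = j then 1 else 0)"
  have A: "A \<in> carrier_mat (r + 1) (r + 1)" and C: "C \<in> carrier_mat (r + 1) (r + 1)"
    by (simp_all add: A_def C_def)
  have "Determinant.det C = prod_list (diag_mat C)"
    by (rule det_upper_triangular[OF _ C]) (auto simp: C_def)
  also have "diag_mat C = map (\<lambda>_. 1) [0..<r + 1]"
    using monic by (auto simp: diag_mat_def C_def one_pCons)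
  finally have detC: "Determinant.det C = 1" by (simp add: prod_list_replicate map_replicate_const)
  have AC: "A * C \<in> carrier_mat (r + 1) (r + 1)" using A C by simp
  have idx: "(A * C) $$ (i, j) = (\<Sum>k<r + 1. A $$ (i, k) * C $$ (k, j))" if "i < r + 1" "j < r + 1" for i j
    using A C that by (simp add: scalar_prod_def lessThan_atLeast0)
  have last: "(A * C) $$ (i, r) = (if i < r then 0 else mpoly)" if "i < r + 1" for i
  proof (cases "i < r")
    case True
    have "(A * C) $$ (i, r) = (\<Sum>k\<le>r. [:complex_of_real (u k) * of_real (s (k + i)):])"
      unfolding idx[OF that less_add_one] Suc_eq_plus1[symmetric] lessThan_Suc_atMost
      using True by (intro sum.cong refl) (simp add: A_def C_def mult.commute add.commute)
    also have "\<dots> = [:\<Sum>k\<le>r. complex_of_real (u k) * of_real (s (k + i)):]"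
    proof -
      interpret comm_ring_hom "\<lambda>x :: complex. [:x:]" by (rule comm_ring_hom_const_poly)
      show ?thesis by (simp only: hom_sum)
    qed
    also have "(\<Sum>k\<le>r. complex_of_real (u k) * of_real (s (k + i))) = 0"
      using True r_le by (intro rec_complex) simp
    finally show ?thesis using True by simp
  next
    case False
    then have i: "i = r" using that by simp
    have "(A * C) $$ (r, r) = (\<Sum>k\<le>r. monom (of_real (u k)) k)"
      unfolding idx[OF less_add_one less_add_one] Suc_eq_plus1[symmetric] lessThan_Suc_atMost
      by (intro sum.cong refl) (simp add: A_def C_def smult_monom)
    then show ?thesis using i by (simp add: mpoly_def)
  qed
  have del: "mat_delete (A * C) r r = Matrix.mat r r (\<lambda>(i, j). [:complex_of_real (s (i + j)):])"
  proof (rule eq_matI)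
    fix i j assume "i < dim_row (Matrix.mat r r (\<lambda>(i, j). [:complex_of_real (s (i + j)):]))"
      and "j < dim_col (Matrix.mat r r (\<lambda>(i, j). [:complex_of_real (s (i + j)):]))"
    then have ij: "i < r" "j < r" by auto
    have "mat_delete (A * C) r r $$ (i, j) = (A * C) $$ (i, j)"
      using A C ij by (simp add: mat_delete_def)
    also have "\<dots> = (\<Sum>k<r + 1. A $$ (i, k) * C $$ (k, j))"
      using ij by (intro idx) auto
    also have "\<dots> = (\<Sum>k<r + 1. if k = j then A $$ (i, j) else 0)"
      by (intro sum.cong refl) (use ij in \<open>auto simp: C_def\<close>)
    also have "\<dots> = A $$ (i, j)" using ij by simp
    finally show "mat_delete (A * C) r r $$ (i, j) = Matrix.mat r r (\<lambda>(i, j). [:complex_of_real (s (i + j)):]) $$ (i, j)"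
      using ij by (simp add: A_def)
  qed (use A C in \<open>auto simp: mat_delete_def\<close>)
  have "poly_first_kind s r = Determinant.det A" by (simp add: poly_first_kind_def A_def)
  also have "\<dots> = Determinant.det (A * C)"
    using det_mult[OF A C] detC by simp
  also have "\<dots> = (\<Sum>i<r + 1. (A * C) $$ (i, r) * cofactor (A * C) i r)"
    by (rule laplace_expansion_column[OF AC]) simp
  also have "\<dots> = (\<Sum>i<r + 1. if i = r then mpoly * cofactor (A * C) r r else 0)"
    by (intro sum.cong refl) (auto simp: last)
  also have "\<dots> = mpoly * cofactor (A * C) r r" by simp
  also have "cofactor (A * C) r r = [:of_real (Determinant.det (sq_hankel s r)):]"
    unfolding cofactor_def del det_const_hankel by simp
  finally show ?thesis by simp
qed

lemma second_kind_eq: "second_kind s r z = of_real (Determinant.det (sq_hankel s r)) * Q z"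
proof -
  define c where "c = complex_of_real (Determinant.det (sq_hankel s r))"
  define q where "q = (\<Sum>i<r. monom (D z i) i)"
  have cq: "coeff q i = (if i < r then D z i else 0)" for i
    by (simp add: q_def coeff_sum)
  have "mpoly - [:P z:] = [:- z, 1:] * q"
  proof -
    have "poly (mpoly - [:P z:]) x = poly ([:- z, 1:] * q) x" for x
    proof -
      \<comment> \<open>\<open>quot_shift\<close> for the functional that evaluates at x.\<close>
      have "(\<Sum>j<r. z * D z j * x ^ j) = P z + (\<Sum>j<r. D z j * x ^ (j + 1)) - P x"
        using quot_shift[of z "\<lambda>i. of_real (u i)" r "\<lambda>j. x ^ j"] by (simp add: peval_def)
      moreover have "poly q x = (\<Sum>j<r. D z j * x ^ j)"
        by (simp add: q_def poly_sum poly_monom)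
      ultimately show ?thesis
        by (simp add: poly_mpoly algebra_simps sum_distrib_left)
    qed
    then show ?thesis by (intro poly_eqI_degree_lead_coeff poly_eq_poly_eq_iff[THEN iffD1] ext)
  qed
  then have "poly_first_kind s r - [:poly (poly_first_kind s r) z:] = [:- z, 1:] * Polynomial.smult c q"
  proof -
    assume eq: "mpoly - [:P z:] = [:- z, 1:] * q"
    have "poly_first_kind s r - [:poly (poly_first_kind s r) z:] = Polynomial.smult c (mpoly - [:P z:])"
      unfolding poly_first_kind_eq c_def[symmetric] by (simp add: poly_mpoly smult_diff_right)
    then show ?thesis unfolding eq by (simp only: mult_smult_right)
  qed
  then have "(poly_first_kind s r - [:poly (poly_first_kind s r) z:]) div [:- z, 1:] = Polynomial.smult c q"
    by (metis nonzero_mult_div_cancel_left one_neq_zero pCons_eq_0_iff)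
  then have "second_kind s r z = moment_functional s (Polynomial.smult c q)"
    by (simp add: second_kind_def Let_def)
  also have "\<dots> = (\<Sum>j<r. coeff (Polynomial.smult c q) j * S j)"
    by (rule moment_functional_eq) (simp add: cq)
  also have "\<dots> = c * Q z" by (simp add: cq qeval_def sum_distrib_left mult.assoc)
  finally show ?thesis by (simp add: c_def)
qed

text \<open>The nonzero factor \<open>det (sq_hankel s r)\<close> cancels; at zeros of
  \<open>P\<close> both sides are 0.\<close>

lemma sol_eq_quotient: "(\<lambda>z. - second_kind s r z / poly (poly_first_kind s r) z) = sol"
  using det by (auto simp: fun_eq_iff second_kind_eq poly_first_kind_eq poly_mpoly sol_def)

end

section \<open>The equivalences\<close>

lemma recursion_of_solution:
  assumes "MP_solution (neg_eigenvalues (hankel s n)) s n \<phi>" and deg: "Determinant.det (hankel s n) = 0"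
  shows "\<exists>r u. recursion s n r u"
proof -
  obtain u where u: "hankel_rank s n \<le> n" "u (hankel_rank s n) = 1"
    "\<And>k. k \<le> n \<Longrightarrow> (\<Sum>i\<le>hankel_rank s n. u i * s (i + k)) = 0"
    and ind: "\<And>j. j < hankel_rank s n \<Longrightarrow> col (hankel s n) j \<notin> col_span s n j"
    using hankel_rank_degenerate[OF deg] by blast
  \<comment> \<open>The Hankel rank supplies a relation in rows k \<le> n only; the solution extends
    it to the full range, and then minimality of the rank yields the nonzero minor.\<close>
  note rec = MP_solution_recursion(2)[where u = u, OF assms(1) u(1) u(3)]
  have "Determinant.det (sq_hankel s (hankel_rank s n)) \<noteq> 0"
    using det_of_recursion[where u = u, OF u(1) u(2) rec ind] by blast
  then show ?thesis using u rec unfolding recursion_def by blast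
qed

lemma recursion_of_extension:
  assumes ext: "neg_eigenvalues (hankel (s(2 * n + 1 := a, 2 * n + 2 := b)) (n + 1)) = neg_eigenvalues (hankel s n)"
    and deg: "Determinant.det (hankel s n) = 0"
  shows "\<exists>r u. recursion s n r u"
proof -
  obtain u where u: "hankel_rank s n \<le> n" "u (hankel_rank s n) = 1"
    "\<And>k. k \<le> n \<Longrightarrow> (\<Sum>i\<le>hankel_rank s n. u i * s (i + k)) = 0"
    and ind: "\<And>j. j < hankel_rank s n \<Longrightarrow> col (hankel s n) j \<notin> col_span s n j"
    using hankel_rank_degenerate[OF deg] by blast
  note rec = recursive_of_extension[where u = u, OF u(1) u(3) ext]
  have "Determinant.det (sq_hankel s (hankel_rank s n)) \<noteq> 0"
    using det_of_recursion[where u = u, OF u(1) u(2) rec ind] by blast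
  then show ?thesis using u rec unfolding recursion_def by blast
qed

theorem theorem1p3:
  fixes n :: nat and s :: "nat \<Rightarrow> real" and \<kappa> nN :: nat
  assumes degenerate: "Determinant.det (hankel s n) = 0"
    and nN: "nN = last_normal_index s n"
    and \<kappa>: "\<kappa> = neg_eigenvalues (hankel s n)"
  shows "((\<exists>\<phi>. MP_solution \<kappa> s n \<phi>) \<longleftrightarrow> vec_space.rank (n + 1) (hankel s n) = nN) \<and>
         (vec_space.rank (n + 1) (hankel s n) = nN \<longleftrightarrow>
            (\<exists>a b. neg_eigenvalues (hankel (s(2 * n + 1 := a, 2 * n + 2 := b)) (n + 1)) =
                   neg_eigenvalues (hankel s n))) \<and>
         ((\<exists>a b. neg_eigenvalues (hankel (s(2 * n + 1 := a, 2 * n + 2 := b)) (n + 1)) =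
                   neg_eigenvalues (hankel s n)) \<longleftrightarrow> recursively_generated s n) \<and>
         ((\<exists>\<phi>. MP_solution \<kappa> s n \<phi>) \<or>
          vec_space.rank (n + 1) (hankel s n) = nN \<or>
          (\<exists>a b. neg_eigenvalues (hankel (s(2 * n + 1 := a, 2 * n + 2 := b)) (n + 1)) =
                 neg_eigenvalues (hankel s n)) \<or>
          recursively_generated s n \<longrightarrow>
            MP_solution \<kappa> s n (\<lambda>z. - second_kind s nN z / poly (poly_first_kind s nN) z) \<and>
            (\<forall>\<phi>. MP_solution \<kappa> s n \<phi> \<longrightarrow>
               (\<forall>z. Im z \<noteq> 0 \<longrightarrow>
                  \<phi> z = - second_kind s nN z / poly (poly_first_kind s nN) z)))"
    (is "(?i \<longleftrightarrow> ?ii) \<and> (?ii \<longleftrightarrow> ?iii) \<and> (?iii \<longleftrightarrow> ?iv) \<and> (_ \<longrightarrow> ?sol)")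
proof -
  \<comment> \<open>The hub: each of the four conditions gives a monic recursion with nonzero
    leading minor, and such a recursion gives all four together with the formula.\<close>
  let ?R = "\<exists>r u. recursion s n r u"
  have to_R: "?i \<Longrightarrow> ?R" "?ii \<Longrightarrow> ?R" "?iii \<Longrightarrow> ?R" "?iv \<Longrightarrow> ?R"
    using recursion_of_solution[OF _ degenerate] recursion_of_rank[OF _ degenerate]
      recursion_of_extension[OF _ degenerate] recursion_of_recursively_generated[OF _ degenerate]
    unfolding nN \<kappa> by blast+
  have from_R: "?ii \<and> ?iii \<and> ?iv \<and> ?sol" if R: "?R"
  proof -
    obtain r u where ru: "recursion s n r u" using R by blast
    then interpret hankel_recursion s n r u by unfold_locales
    have r: "nN = r" "vec_space.rank (n + 1) (hankel s n) = r"
      using recursion_rank[OF ru] nN by simp_all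
    have ?sol
      using sol_MP_solution MP_solution_unique sol_eq_quotient[symmetric] unfolding \<kappa> r(1) by (simp add: fun_eq_iff)
    moreover have ?iii using neg_eigenvalues_flat_extension[OF r_le monic rec] .
    ultimately show ?thesis using r recursively_generated_of_recursion[OF ru degenerate] by blast
  qed
  show ?thesis using to_R from_R by blast
qed

end
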